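(* Let $(X^\delta,Y^\delta)_{\delta\in\Delta}$ be a family of pairs of closed, non-zero subspaces $X^\delta\subset X$, $Y^\delta\subset Y$ such that $$\gamma_\Delta^{\partial_t}:=\inf_{\delta\in\Delta}\ \inf_{\{w\in X^\delta:\ \partial_tw\neq0\}}\frac{\|(\partial_tw)|_{Y^\delta}\|_{(Y^\delta)'}}{\|\partial_tw\|_{Y'}}>0 .$$ Let $\beta\ge1$, $g\in Y'$, $u_0\in H$, and let $u\in X$ be the solution of $Bu=g$, $\gamma_0u=u_0$. Then for each $\delta\in\Delta$ there exists a unique $\bar u^\delta\in X^\delta$ such that for all $w\in X^\delta$ $$(Cw)(R^\delta C\bar u^\delta)+(A_s\bar u^\delta)(w)+\langle\gamma_T\bar u^\delta,\gamma_Tw\rangle+(\beta-1)\langle\gamma_0\bar u^\delta,\gamma_0w\rangle=(Cw)(R^\delta g)+g(w)+\beta\langle u_0,\gamma_0w\rangle ,$$ and, with $\alpha:=\|A_a\|_{\mathcal L(Y,Y')}$ and $\gamma:=\gamma_\Delta^{\partial_t}$, $$\|u-\bar u^\delta\|_X\le\frac{\Big(1+\tfrac12\big(\alpha^2+\alpha\sqrt{\alpha^2+4}\big)\Big)\inf_{w\in X^\delta}\|u-w\|_X+\sqrt{1+\alpha^2}\,\inf_{v\in Y^\delta}\|u-v\|_Y}{\tfrac12\Big(\gamma^2+\alpha^2+1-\sqrt{(\gamma^2+\alpha^2+1)^2-4\gamma^2}\Big)} .$$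
   Context: All spaces are over $\mathbb R$. $V,H$ are separable Hilbert spaces with $V\hookrightarrow H$ continuously and densely; $H$ is identified with its dual, giving the Gelfand triple $V\hookrightarrow H\simeq H'\hookrightarrow V'$. $\langle\cdot,\cdot\rangle$ denotes the scalar product on $H$ and its extension to the duality pairing on $V'\times V$ (or $V\times V'$); $\|\cdot\|$ is the norm of $H$. $I=(0,T)$. For a.e. $t\in I$, $a(t;\cdot,\cdot)$ is a bilinear form on $V\times V$, measurable in $t$ for each fixed pair of arguments, and, with constants independent of $t$, bounded, $|a(t;\eta,\zeta)|\lesssim\|\eta\|_V\|\zeta\|_V$, and coercive, $a(t;\eta,\eta)\gtrsim\|\eta\|_V^2$, for $\eta,\zeta\in V$. $X:=L_2(I;V)\cap H^1(I;V')$, $Y:=L_2(I;V)$. $\gamma_t:X\to H$, $u\mapsto u(t,\cdot)$, $t\in\bar I$, is the trace map. Operators: $A:Y\to Y'$, $(Aw)(v):=\int_I a(t;w(t),v(t))\,dt$; $A_s:=\frac12(A+A')$; $A_a:=\frac12(A-A')$; $\partial_t:X\to Y'$, $(\partial_tw)(v):=\int_I\langle\frac{dw}{dt}(t),v(t)\rangle\,dt$; $B:=\partial_t+A:X\to Y'$; $C:=B-A_s=\partial_t+A_a:X\to Y'$. Under these assumptions $(B,\gamma_0):X\to Y'\times H$ is boundedly invertible (known), so $Bu=g$, $\gamma_0u=u_0$ has a unique solution $u\in X$. Norms: $Y$ is equipped with $\|v\|_Y:=\sqrt{(A_sv)(v)}$ (equivalent to the standard norm), $Y'$ with the resulting dual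 norm, $Y^\delta$ with $\|\cdot\|_Y$ and $(Y^\delta)'$ with the resulting dual norm. For the constant $\beta\ge1$, $X$ is equipped with $\|w\|_X:=\sqrt{\|w\|_Y^2+\|\partial_tw\|_{Y'}^2+\|\gamma_Tw\|^2+(\beta-1)\|\gamma_0w\|^2}$. $\|A_a\|_{\mathcal L(Y,Y')}$ is the operator norm with respect to these norms. For $f\in Y'$, $f|_{Y^\delta}\in(Y^\delta)'$ is its restriction, and $R^\delta f\in Y^\delta$ denotes the unique element with $(A_sR^\delta f)(v)=f(v)$ for all $v\in Y^\delta$. The displayed discrete problem is the Brézis–Ekeland–Nayroles (BEN) discretization of the parabolic problem. *)

theory Defs
  imports "HOL-Analysis.Analysis"
begin

text \<open>
  Elements of the Bochner spaces on \<open>I = (0,T)\<close> are represented by functions on the real line, of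
  which only the restriction to \<open>I\<close> up to null sets matters: equality in \<open>L\<^sub>2\<close> is equality almost
  everywhere, and norms are seminorms on representatives.  The dual \<open>V'\<close> is the type of bounded
  linear functionals.  Elements of \<open>Y'\<close> and of the duals of subspaces of \<open>Y\<close> are real functions on
  representatives, of which only the values on \<open>Y\<close> (on the subspace) matter.  The embedding of \<open>V\<close>
  into \<open>H\<close> is an explicit map \<open>j\<close>.
\<close>

definition gelfand_embedding :: "('v::real_inner \<Rightarrow> 'h::real_inner) \<Rightarrow> bool" where
  "gelfand_embedding j \<longleftrightarrow> bounded_linear j \<and> inj j \<and> closure (range j) = UNIV"

abbreviation timeM :: "real \<Rightarrow> real measure" where
  "timeM T \<equiv> lebesgue_on {0<..<T}"

definition parabolic_form :: "real \<Rightarrow> (real \<Rightarrow> 'v::real_inner \<Rightarrow> 'v \<Rightarrow> real) \<Rightarrow> bool" where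
  "parabolic_form T a \<longleftrightarrow>
     (\<forall>\<eta> \<zeta>. (\<lambda>t. a t \<eta> \<zeta>) \<in> borel_measurable (timeM T)) \<and>
     (\<exists>K>0. \<exists>c>0. AE t in timeM T. bilinear (a t) \<and>
        (\<forall>\<eta> \<zeta>. \<bar>a t \<eta> \<zeta>\<bar> \<le> K * norm \<eta> * norm \<zeta>) \<and> (\<forall>\<eta>. a t \<eta> \<eta> \<ge> c * (norm \<eta>)\<^sup>2))"

text \<open>Both \<open>V\<close> and \<open>V'\<close> are separable, so Borel measurability coincides with strong measurability.\<close>

definition L2 :: "real \<Rightarrow> (real \<Rightarrow> 'b::real_normed_vector) set" where
  "L2 T = {f \<in> borel_measurable (timeM T). integrable (timeM T) (\<lambda>t. (norm (f t))\<^sup>2)}"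

definition test_fun :: "real \<Rightarrow> (real \<Rightarrow> real) \<Rightarrow> bool" where
  "test_fun T \<phi> \<longleftrightarrow> (\<forall>k t. ((deriv ^^ k) \<phi>) field_differentiable (at t)) \<and>
     closure {t. \<phi> t \<noteq> 0} \<subseteq> {0<..<T}"

text \<open>
  The identity \<open>\<integral> \<phi>' u dt = - \<integral> \<phi> z dt\<close> is one between elements of \<open>V'\<close>; it is written out by
  evaluating both sides at every \<open>\<eta> \<in> V\<close>.  An element \<open>w\<close> of \<open>V\<close> acts on \<open>V\<close> as \<open>\<langle>w, \<cdot>\<rangle>\<close>, with the
  scalar product of \<open>H\<close>.
\<close>

definition is_weak_deriv ::
    "real \<Rightarrow> ('v::real_inner \<Rightarrow> 'h::real_inner) \<Rightarrow> (real \<Rightarrow> 'v) \<Rightarrow> (real \<Rightarrow> 'v \<Rightarrow>\<^sub>L real) \<Rightarrow> bool" where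
  "is_weak_deriv T j u z \<longleftrightarrow> (\<forall>\<phi> \<eta>. test_fun T \<phi> \<longrightarrow>
     (\<integral>t. deriv \<phi> t * (j (u t) \<bullet> j \<eta>) \<partial>timeM T) = - (\<integral>t. \<phi> t * blinfun_apply (z t) \<eta> \<partial>timeM T))"

definition spaceY :: "real \<Rightarrow> (real \<Rightarrow> 'v::real_inner) set" where
  "spaceY T = L2 T"

definition spaceX :: "real \<Rightarrow> ('v::real_inner \<Rightarrow> 'h::real_inner) \<Rightarrow> (real \<Rightarrow> 'v) set" where
  "spaceX T j = {u \<in> L2 T. \<exists>z \<in> L2 T. is_weak_deriv T j u z}"

text \<open>For \<open>u \<in> X\<close> the weak derivative is determined up to a null set.\<close>

definition weak_deriv ::
    "real \<Rightarrow> ('v::real_inner \<Rightarrow> 'h::real_inner) \<Rightarrow> (real \<Rightarrow> 'v) \<Rightarrow> real \<Rightarrow> 'v \<Rightarrow>\<^sub>L real" where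
  "weak_deriv T j u = (SOME z. z \<in> L2 T \<and> is_weak_deriv T j u z)"

text \<open>The trace at time \<open>t\<close> is the value at \<open>t\<close> of the representative in \<open>C([0,T];H)\<close>.\<close>

definition trace_map ::
    "real \<Rightarrow> ('v::real_inner \<Rightarrow> 'h::real_inner) \<Rightarrow> real \<Rightarrow> (real \<Rightarrow> 'v) \<Rightarrow> 'h" where
  "trace_map T j t u = (THE h. \<exists>U. continuous_on {0..T} U \<and>
     (AE s in timeM T. U s = j (u s)) \<and> h = U t)"

definition opA :: "real \<Rightarrow> (real \<Rightarrow> 'v \<Rightarrow> 'v \<Rightarrow> real) \<Rightarrow> (real \<Rightarrow> 'v) \<Rightarrow> (real \<Rightarrow> 'v) \<Rightarrow> real" where
  "opA T a w v = (\<integral>t. a t (w t) (v t) \<partial>timeM T)"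

definition opA_adj :: "real \<Rightarrow> (real \<Rightarrow> 'v \<Rightarrow> 'v \<Rightarrow> real) \<Rightarrow> (real \<Rightarrow> 'v) \<Rightarrow> (real \<Rightarrow> 'v) \<Rightarrow> real" where
  "opA_adj T a w v = opA T a v w"

definition opAs :: "real \<Rightarrow> (real \<Rightarrow> 'v \<Rightarrow> 'v \<Rightarrow> real) \<Rightarrow> (real \<Rightarrow> 'v) \<Rightarrow> (real \<Rightarrow> 'v) \<Rightarrow> real" where
  "opAs T a w v = (opA T a w v + opA_adj T a w v) / 2"

definition opAa :: "real \<Rightarrow> (real \<Rightarrow> 'v \<Rightarrow> 'v \<Rightarrow> real) \<Rightarrow> (real \<Rightarrow> 'v) \<Rightarrow> (real \<Rightarrow> 'v) \<Rightarrow> real" where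
  "opAa T a w v = (opA T a w v - opA_adj T a w v) / 2"

definition op_dt ::
    "real \<Rightarrow> ('v::real_inner \<Rightarrow> 'h::real_inner) \<Rightarrow> (real \<Rightarrow> 'v) \<Rightarrow> (real \<Rightarrow> 'v) \<Rightarrow> real" where
  "op_dt T j w v = (\<integral>t. blinfun_apply (weak_deriv T j w t) (v t) \<partial>timeM T)"

definition opB :: "real \<Rightarrow> ('v::real_inner \<Rightarrow> 'h::real_inner) \<Rightarrow> (real \<Rightarrow> 'v \<Rightarrow> 'v \<Rightarrow> real) \<Rightarrow>
    (real \<Rightarrow> 'v) \<Rightarrow> (real \<Rightarrow> 'v) \<Rightarrow> real" where
  "opB T j a w v = op_dt T j w v + opA T a w v"

definition opC :: "real \<Rightarrow> ('v::real_inner \<Rightarrow> 'h::real_inner) \<Rightarrow> (real \<Rightarrow> 'v \<Rightarrow> 'v \<Rightarrow> real) \<Rightarrow>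
    (real \<Rightarrow> 'v) \<Rightarrow> (real \<Rightarrow> 'v) \<Rightarrow> real" where
  "opC T j a w v = opB T j a w v - opAs T a w v"

definition normY :: "real \<Rightarrow> (real \<Rightarrow> 'v \<Rightarrow> 'v \<Rightarrow> real) \<Rightarrow> (real \<Rightarrow> 'v) \<Rightarrow> real" where
  "normY T a v = sqrt (opAs T a v v)"

text \<open>Dual norm on \<open>S'\<close>, for a subspace \<open>S\<close> of \<open>Y\<close> normed by \<open>normY\<close>.\<close>

definition dual_norm :: "real \<Rightarrow> (real \<Rightarrow> 'v \<Rightarrow> 'v \<Rightarrow> real) \<Rightarrow> (real \<Rightarrow> 'v) set \<Rightarrow>
    ((real \<Rightarrow> 'v) \<Rightarrow> real) \<Rightarrow> real" where
  "dual_norm T a S f = (SUP v\<in>{v \<in> S. normY T a v \<le> 1}. \<bar>f v\<bar>)"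

definition dualY :: "real \<Rightarrow> (real \<Rightarrow> 'v::real_inner \<Rightarrow> 'v \<Rightarrow> real) \<Rightarrow> ((real \<Rightarrow> 'v) \<Rightarrow> real) set" where
  "dualY T a = {f. (\<forall>v\<in>spaceY T. \<forall>w\<in>spaceY T. f (\<lambda>t. v t + w t) = f v + f w) \<and>
     (\<forall>c. \<forall>v\<in>spaceY T. f (\<lambda>t. c *\<^sub>R v t) = c * f v) \<and>
     (\<exists>K. \<forall>v\<in>spaceY T. \<bar>f v\<bar> \<le> K * normY T a v)}"

definition op_normY :: "real \<Rightarrow> (real \<Rightarrow> 'v::real_inner \<Rightarrow> 'v \<Rightarrow> real) \<Rightarrow>
    ((real \<Rightarrow> 'v) \<Rightarrow> (real \<Rightarrow> 'v) \<Rightarrow> real) \<Rightarrow> real" where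
  "op_normY T a L = (SUP w\<in>{w \<in> spaceY T. normY T a w \<le> 1}. dual_norm T a (spaceY T) (L w))"

definition normX :: "real \<Rightarrow> ('v::real_inner \<Rightarrow> 'h::real_inner) \<Rightarrow> (real \<Rightarrow> 'v \<Rightarrow> 'v \<Rightarrow> real) \<Rightarrow>
    real \<Rightarrow> (real \<Rightarrow> 'v) \<Rightarrow> real" where
  "normX T j a \<beta> w = sqrt ((normY T a w)\<^sup>2 + (dual_norm T a (spaceY T) (op_dt T j w))\<^sup>2
     + (norm (trace_map T j T w))\<^sup>2 + (\<beta> - 1) * (norm (trace_map T j 0 w))\<^sup>2)"

text \<open>
  Closed non-zero linear subspaces \<open>S\<close> of a space \<open>Z\<close> seminormed by \<open>N\<close>.  Closedness under
  \<open>N\<close>-limits makes \<open>S\<close> invariant under changes on null sets (take a constant sequence).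
\<close>

definition closed_nonzero_subspace ::
    "real \<Rightarrow> ((real \<Rightarrow> 'v::real_inner) \<Rightarrow> real) \<Rightarrow> (real \<Rightarrow> 'v) set \<Rightarrow> (real \<Rightarrow> 'v) set \<Rightarrow> bool" where
  "closed_nonzero_subspace T N Z S \<longleftrightarrow> S \<subseteq> Z \<and> (\<lambda>t. 0) \<in> S \<and>
     (\<forall>f\<in>S. \<forall>h\<in>S. (\<lambda>t. f t + h t) \<in> S) \<and> (\<forall>c. \<forall>f\<in>S. (\<lambda>t. c *\<^sub>R f t) \<in> S) \<and>
     (\<forall>f u. (\<forall>n. f n \<in> S) \<and> u \<in> Z \<and> (\<lambda>n::nat. N (\<lambda>t. f n t - u t)) \<longlonglongrightarrow> 0 \<longrightarrow> u \<in> S) \<and>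
     (\<exists>f\<in>S. \<not> (AE t in timeM T. f t = 0))"

text \<open>The element \<open>R\<^sup>\<delta> f\<close> for \<open>S = Y\<^sup>\<delta>\<close>; it is determined up to a null set.\<close>

definition riesz_lift :: "real \<Rightarrow> (real \<Rightarrow> 'v \<Rightarrow> 'v \<Rightarrow> real) \<Rightarrow> (real \<Rightarrow> 'v) set \<Rightarrow>
    ((real \<Rightarrow> 'v) \<Rightarrow> real) \<Rightarrow> (real \<Rightarrow> 'v)" where
  "riesz_lift T a S f = (SOME y. y \<in> S \<and> (\<forall>v\<in>S. opAs T a y v = f v))"

text \<open>
  Extended-real valued, so that the infimum over an empty set is \<open>\<infinity>\<close>.
\<close>

definition inf_sup :: "real \<Rightarrow> ('v::real_inner \<Rightarrow> 'h::real_inner) \<Rightarrow> (real \<Rightarrow> 'v \<Rightarrow> 'v \<Rightarrow> real) \<Rightarrow>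
    'd set \<Rightarrow> ('d \<Rightarrow> (real \<Rightarrow> 'v) set) \<Rightarrow> ('d \<Rightarrow> (real \<Rightarrow> 'v) set) \<Rightarrow> ereal" where
  "inf_sup T j a \<Delta> Xd Yd = (INF \<delta>\<in>\<Delta>. INF w\<in>{w \<in> Xd \<delta>. \<exists>v\<in>spaceY T. op_dt T j w v \<noteq> 0}.
     ereal (dual_norm T a (Yd \<delta>) (op_dt T j w) / dual_norm T a (spaceY T) (op_dt T j w)))"

definition BEN_solution :: "real \<Rightarrow> ('v::real_inner \<Rightarrow> 'h::real_inner) \<Rightarrow>
    (real \<Rightarrow> 'v \<Rightarrow> 'v \<Rightarrow> real) \<Rightarrow> real \<Rightarrow> ((real \<Rightarrow> 'v) \<Rightarrow> real) \<Rightarrow> 'h \<Rightarrow>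
    (real \<Rightarrow> 'v) set \<Rightarrow> (real \<Rightarrow> 'v) set \<Rightarrow> (real \<Rightarrow> 'v) \<Rightarrow> bool" where
  "BEN_solution T j a \<beta> g u0 Xs Ys ub \<longleftrightarrow> ub \<in> Xs \<and> (\<forall>w\<in>Xs.
     opC T j a w (riesz_lift T a Ys (opC T j a ub)) + opAs T a ub w
       + trace_map T j T ub \<bullet> trace_map T j T w
       + (\<beta> - 1) * (trace_map T j 0 ub \<bullet> trace_map T j 0 w)
     = opC T j a w (riesz_lift T a Ys g) + g w + \<beta> * (u0 \<bullet> trace_map T j 0 w))"

text \<open>
  The denominator of the error bound.  If \<open>\<partial>\<^sub>t\<close> vanishes on all discrete trial spaces, \<open>\<gamma> = \<infinity>\<close> and
  the formula is read as its limit for \<open>\<gamma> \<longrightarrow> \<infinity>\<close>, which is 1.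
\<close>

definition stab_const :: "real \<Rightarrow> ereal \<Rightarrow> real" where
  "stab_const \<alpha> \<gamma> = (if \<gamma> = \<infinity> then 1 else
     (let c = real_of_ereal \<gamma> in
       1/2 * (c\<^sup>2 + \<alpha>\<^sup>2 + 1 - sqrt ((c\<^sup>2 + \<alpha>\<^sup>2 + 1)\<^sup>2 - 4 * c\<^sup>2))))"

end

theory Submission
  imports Defs "HOL-Library.Function_Algebras"
begin

text \<open>
  The bilinear form \<open>b(w, v) = (C v)(R\<^sup>\<delta> C w) + (A\<^sub>s w)(v) + \<langle>\<gamma>\<^sub>T w, \<gamma>\<^sub>T v\<rangle> + (\<beta> - 1) \<langle>\<gamma>\<^sub>0 w, \<gamma>\<^sub>0 v\<rangle>\<close> is symmetric
  and positive semidefinite.  The eigenvalues of two \<open>2 \<times> 2\<close> matrices give \<open>b(w, w) \<le> M \<parallel>w\<parallel>\<^sub>X\<^sup>2\<close> on \<open>X\<close> and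
  \<open>b(w, w) \<ge> \<mu> \<parallel>w\<parallel>\<^sub>X\<^sup>2\<close> on \<open>X\<^sup>\<delta>\<close>, where \<open>M\<close> and \<open>\<mu>\<close> are the constants of the error bound, so the discrete
  problem is solvable by the Riesz theorem.  Integration by parts in time shows that its right-hand
  side is \<open>b(u, w) - (C w)(u - P u)\<close> with \<open>P\<close> the \<open>A\<^sub>s\<close>-orthogonal projection onto \<open>Y\<^sup>\<delta>\<close>.  The first term
  contributes the error of the \<open>b\<close>-orthogonal projection \<open>Q\<close> onto \<open>X\<^sup>\<delta>\<close>, for which \<open>\<parallel>I - Q\<parallel> = \<parallel>Q\<parallel> \<le> M / \<mu>\<close>;
  the second one contributes the best approximation error in \<open>Y\<^sup>\<delta>\<close>.

  The integration by parts and the trace theorem are obtained without mollification in time.  With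
  \<open>\<langle>S v, w\<rangle>\<^sub>V = \<langle>j v, j w\<rangle>\<^sub>H\<close> and \<open>r\<close> the Riesz representative of the weak derivative, \<open>S u\<close> is an
  indefinite integral of \<open>r\<close>; for \<open>E = I - \<kappa> S\<close> the functions \<open>(I - E\<^sup>n) u\<close> are continuous images of \<open>S u\<close>,
  satisfy the product rule, and converge to \<open>u\<close> since \<open>E\<^sup>n \<rightarrow> 0\<close> strongly.
\<close>

section \<open>Semi-inner product spaces\<close>

text \<open>Origin of the two matrices: let x be the norm of the time derivative in Y' and y the
  norm in Y. As \<open>C\<close> differs from the time derivative by a skew part of size \<alpha>,
  the lift of \<open>C w\<close> has norm at most x + \<alpha> y on X and at least \<gamma> x -
  \<alpha> y on the discrete space. Apart from the traces, b(w, w) is thus compared with (x +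
  \<alpha> y)^2 + y^2 from above and with (\<gamma> x - \<alpha> y)^2 + y^2 from below.
  \<open>M\<close> is the larger eigenvalue of the former quadratic form, \<mu> the smaller
  eigenvalue of the latter; the trace terms fit in because \<mu> \<le> 1 \<le> M. The obstacle that
  shapes the development: functions matter only up to null sets, so every norm is a seminorm, and
  lifts, projections and weak derivatives are choices determined up to seminorm zero. Such choices
  cannot be treated as linear maps. Hilbert space arguments are therefore carried out for degenerate
  forms on carrier sets, and linearity is used only after a choice has been paired with something.
  The term (C w)(u - P u) arises because g is seen through its lift: on Y it equals C u + A_s u, and
  the lift turns the second summand into P u instead of u.\<close>

lemma Cauchy_dominated:
  fixes x y :: "nat \<Rightarrow> nat \<Rightarrow> real"
  assumes cau: "\<forall>e>0. \<exists>n0. \<forall>m\<ge>n0. \<forall>n\<ge>n0. x m n < e" and le: "\<And>m n. y m n \<le> k * x m n" and k: "k > 0"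
  shows "\<forall>e>0. \<exists>n0. \<forall>m\<ge>n0. \<forall>n\<ge>n0. y m n < e"
proof (intro allI impI)
  fix e :: real assume e: "e > 0"
  then obtain n0 where n0: "\<forall>m\<ge>n0. \<forall>n\<ge>n0. x m n < e / k" using cau k by force
  have "y m n < e" if "m \<ge> n0" "n \<ge> n0" for m n
  proof -
    have "k * x m n < e" using n0 that k by (simp add: pos_less_divide_eq mult.commute)
    then show ?thesis using le[of m n] by simp
  qed
  then show "\<exists>n0. \<forall>m\<ge>n0. \<forall>n\<ge>n0. y m n < e" by blast
qed

lemma tendsto_0_dominated:
  fixes x y :: "nat \<Rightarrow> real"
  assumes "x \<longlonglongrightarrow> 0" "\<And>n. 0 \<le> y n" "\<And>n. y n \<le> k * x n"
  shows "y \<longlonglongrightarrow> 0"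
  by (rule real_tendsto_sandwich[OF _ _ tendsto_const tendsto_mult_right_zero[OF assms(1), of k]])
    (use assms(2,3) in auto)

text \<open>The form lives on a carrier set and may be degenerate: functions equal almost everywhere
  have distance zero, and one set of functions carries several forms at once.\<close>

locale semi_inner =
  fixes S :: "'e::real_vector set" and b :: "'e \<Rightarrow> 'e \<Rightarrow> real"
  assumes subspace: "subspace S"
    and add_left: "\<lbrakk>x \<in> S; y \<in> S; z \<in> S\<rbrakk> \<Longrightarrow> b (x + y) z = b x z + b y z"
    and scale_left: "\<lbrakk>x \<in> S; y \<in> S\<rbrakk> \<Longrightarrow> b (c *\<^sub>R x) y = c * b x y"
    and sym: "\<lbrakk>x \<in> S; y \<in> S\<rbrakk> \<Longrightarrow> b x y = b y x"
    and nonneg: "x \<in> S \<Longrightarrow> 0 \<le> b x x"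
begin

definition N :: "'e \<Rightarrow> real" where "N x = sqrt (b x x)"

lemmas mem = subspace_add[OF subspace] subspace_scale[OF subspace] subspace_diff[OF subspace]
  subspace_0[OF subspace] subspace_neg[OF subspace]

lemma add_right: "\<lbrakk>x \<in> S; y \<in> S; z \<in> S\<rbrakk> \<Longrightarrow> b z (x + y) = b z x + b z y"
  using add_left sym mem by metis

lemma scale_right: "\<lbrakk>x \<in> S; y \<in> S\<rbrakk> \<Longrightarrow> b y (c *\<^sub>R x) = c * b y x"
  using scale_left sym mem by metis

lemma diff_left: "\<lbrakk>x \<in> S; y \<in> S; z \<in> S\<rbrakk> \<Longrightarrow> b (x - y) z = b x z - b y z"
  using add_left[of x "(-1) *\<^sub>R y" z] scale_left[of y z "-1"] mem by simp

lemma diff_right: "\<lbrakk>x \<in> S; y \<in> S; z \<in> S\<rbrakk> \<Longrightarrow> b z (x - y) = b z x - b z y"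
  using diff_left sym mem by metis

lemmas bil = add_left add_right scale_left scale_right diff_left diff_right

lemma N_nonneg [simp]: "x \<in> S \<Longrightarrow> 0 \<le> N x"
  by (simp add: N_def nonneg)

lemma N_sq: "x \<in> S \<Longrightarrow> (N x)\<^sup>2 = b x x"
  by (simp add: N_def nonneg)

lemma expand_diff: "\<lbrakk>x \<in> S; y \<in> S\<rbrakk> \<Longrightarrow> b (x - y) (x - y) = b x x - 2 * b x y + b y y"
  by (simp add: bil mem sym[of y x])

lemma expand_add: "\<lbrakk>x \<in> S; y \<in> S\<rbrakk> \<Longrightarrow> b (x + y) (x + y) = b x x + 2 * b x y + b y y"
  by (simp add: bil mem sym[of y x])

lemma Cauchy_Schwarz:
  assumes x: "x \<in> S" and y: "y \<in> S"
  shows "\<bar>b x y\<bar> \<le> N x * N y"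
proof -
  have q: "0 \<le> b x x + 2 * s * b x y + s\<^sup>2 * b y y" for s
    using nonneg[of "x + s *\<^sub>R y"] expand_add[of x "s *\<^sub>R y"] x y
    by (simp add: mem bil sym[of y x] power2_eq_square algebra_simps)
  have "(b x y)\<^sup>2 \<le> b x x * b y y"
  proof (cases "b y y = 0")
    case True
    have "b x y = 0"
    proof (rule ccontr)
      assume ne: "b x y \<noteq> 0"
      \<comment> \<open>With \<open>b y y = 0\<close> the polynomial in \<open>q\<close> is affine
        in s, and this s gives it the value -1.\<close>
      have "0 \<le> b x x + 2 * (- (b x x + 1) / (2 * b x y)) * b x y"
        using q[of "- (b x x + 1) / (2 * b x y)"] True by simp
      also have "\<dots> = -1" using ne by (simp add: field_simps)
      finally show False by simp
    qed
    then show ?thesis using True by simp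
  next
    case False
    then have pos: "b y y > 0" using nonneg[OF y] by simp
    have "0 \<le> b y y * (b x x + 2 * (- b x y / b y y) * b x y + (- b x y / b y y)\<^sup>2 * b y y)"
      using q[of "- b x y / b y y"] pos by (intro mult_nonneg_nonneg) auto
    also have "\<dots> = b x x * b y y - (b x y)\<^sup>2"
      using pos by (simp add: field_simps power2_eq_square)
    finally show ?thesis by simp
  qed
  then have "(b x y)\<^sup>2 \<le> (N x * N y)\<^sup>2"
    using x y by (simp add: N_sq power_mult_distrib)
  then show ?thesis
    by (metis N_nonneg abs_le_square_iff abs_of_nonneg mult_nonneg_nonneg x y)
qed

lemma N_scale: "x \<in> S \<Longrightarrow> N (c *\<^sub>R x) = \<bar>c\<bar> * N x"
  by (simp add: N_def bil mem real_sqrt_mult mult.assoc[symmetric])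

lemma triangle:
  assumes "x \<in> S" "y \<in> S"
  shows "N (x + y) \<le> N x + N y"
proof (rule power2_le_imp_le)
  show "(N (x + y))\<^sup>2 \<le> (N x + N y)\<^sup>2"
    using assms Cauchy_Schwarz[of x y] expand_add[of x y]
    by (simp add: N_sq mem power2_sum)
qed (use assms in simp)

lemma N_diff_commute: "\<lbrakk>x \<in> S; y \<in> S\<rbrakk> \<Longrightarrow> N (x - y) = N (y - x)"
  by (simp add: N_def expand_diff sym[of y x])

lemma triangle_diff:
  "\<lbrakk>x \<in> S; y \<in> S; z \<in> S\<rbrakk> \<Longrightarrow> N (x - z) \<le> N (x - y) + N (y - z)"
  using triangle[of "x - y" "y - z"] by (simp add: mem)

section \<open>Completeness and the Riesz representation theorem\<close>

definition seq_complete :: bool where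
  "seq_complete \<longleftrightarrow> (\<forall>f. (\<forall>n::nat. f n \<in> S) \<longrightarrow>
     (\<forall>e>0. \<exists>n0. \<forall>m\<ge>n0. \<forall>n\<ge>n0. N (f m - f n) < e) \<longrightarrow> (\<exists>x\<in>S. (\<lambda>n. N (f n - x)) \<longlonglongrightarrow> 0))"

definition bounded_functional :: "('e \<Rightarrow> real) \<Rightarrow> bool" where
  "bounded_functional f \<longleftrightarrow> (\<forall>x\<in>S. \<forall>y\<in>S. f (x + y) = f x + f y) \<and>
     (\<forall>c. \<forall>x\<in>S. f (c *\<^sub>R x) = c * f x) \<and> (\<exists>K. \<forall>x\<in>S. \<bar>f x\<bar> \<le> K * N x)"

lemma bounded_functionalI:
  assumes "\<And>x y. \<lbrakk>x \<in> S; y \<in> S\<rbrakk> \<Longrightarrow> f (x + y) = f x + f y"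
    and "\<And>c x. x \<in> S \<Longrightarrow> f (c *\<^sub>R x) = c * f x" and "\<And>x. x \<in> S \<Longrightarrow> \<bar>f x\<bar> \<le> K * N x"
  shows "bounded_functional f"
  unfolding bounded_functional_def using assms by blast

text \<open>The representer minimises \<open>J\<close>, the energy minus twice the functional. The
  parallelogram law makes a minimising sequence Cauchy, and the vanishing first variation at its
  limit is the claim. Nothing is divided by \<open>b v v\<close>, so degenerate forms are
  allowed.\<close>

theorem Riesz:
  assumes comp: seq_complete and f: "bounded_functional f"
  shows "\<exists>x\<in>S. \<forall>v\<in>S. b x v = f v"
proof -
  have fa: "\<And>x y. x \<in> S \<Longrightarrow> y \<in> S \<Longrightarrow> f (x + y) = f x + f y"
    and fs: "\<And>c x. x \<in> S \<Longrightarrow> f (c *\<^sub>R x) = c * f x"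
    using f by (auto simp: bounded_functional_def)
  obtain K where K: "\<And>x. x \<in> S \<Longrightarrow> \<bar>f x\<bar> \<le> K * N x"
    using f unfolding bounded_functional_def by blast
  define J where "J x = b x x - 2 * f x" for x
  have low: "- K\<^sup>2 \<le> J x" if "x \<in> S" for x
  proof -
    have "0 \<le> (N x - K)\<^sup>2" by simp
    then show ?thesis using K[OF that] N_sq[OF that] unfolding J_def
      by (simp add: power2_diff algebra_simps)
  qed
  define m where "m = (INF x\<in>S. J x)"
  have bdd: "bdd_below (J ` S)" using low by (intro bdd_belowI2[where m="- K\<^sup>2"]) auto
  have ne: "S \<noteq> {}" using mem by auto
  have m_le: "m \<le> J x" if "x \<in> S" for x
    unfolding m_def using bdd that by (rule cINF_lower)
  have "\<exists>x\<in>S. J x < m + 1 / Suc n" for n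
    using cINF_less_iff[OF ne bdd, of "m + 1 / Suc n"] m_def by simp
  then obtain g where gS: "\<And>n. g n \<in> S" and gJ: "\<And>n. J (g n) < m + 1 / Suc n"
    by metis
  \<comment> \<open>Parallelogram law: at the midpoint of x and y the value of \<open>J\<close> is
    still at least m.\<close>
  have par: "b (x - y) (x - y) \<le> 2 * (J x - m) + 2 * (J y - m)" if "x \<in> S" "y \<in> S" for x y
  proof -
    have "m \<le> J ((1/2) *\<^sub>R (x + y))" using m_le that mem by blast
    also have "\<dots> = (b x x + 2 * b x y + b y y) / 4 - f x - f y"
      using that by (simp add: J_def bil mem fa fs sym[of y x] field_simps)
    finally have "m \<le> (b x x + 2 * b x y + b y y) / 4 - f x - f y" .
    then show ?thesis unfolding expand_diff[OF that] by (simp add: J_def field_simps)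
  qed
  have "\<exists>n0. \<forall>m\<ge>n0. \<forall>n\<ge>n0. N (g m - g n) < e" if e: "e > 0" for e
  proof -
    obtain n0 where n0: "4 / e\<^sup>2 < Suc n0" using reals_Archimedean2 e
      by (metis less_Suc_eq of_nat_less_iff order_less_trans)
    have "N (g k - g n) < e" if "k \<ge> n0" "n \<ge> n0" for k n
    proof -
      have inv: "1 / real (Suc l) \<le> 1 / Suc n0" if "l \<ge> n0" for l
        using that by (intro divide_left_mono) auto
      have "b (g k - g n) (g k - g n) < 2 * (1 / Suc k) + 2 * (1 / Suc n)"
        using par[OF gS gS, of k n] gJ[of k] gJ[of n] by (simp add: algebra_simps)
      also have "\<dots> \<le> 4 * (1 / Suc n0)" using inv[OF that(1)] inv[OF that(2)] by simp
      also have "\<dots> < e\<^sup>2" using n0 e by (simp add: field_simps)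
      finally show ?thesis using e unfolding N_def
        by (metis less_eq_real_def real_sqrt_less_mono real_sqrt_abs abs_of_nonneg)
    qed
    then show ?thesis by blast
  qed
  then obtain x where x: "x \<in> S" and lim: "(\<lambda>n. N (g n - x)) \<longlonglongrightarrow> 0"
    using comp gS unfolding seq_complete_def by blast
  have "b x v = f v" if v: "v \<in> S" for v
  proof -
    have "(\<lambda>n. b (g n - x) v) \<longlonglongrightarrow> 0"
      by (rule tendsto_rabs_zero_cancel, rule tendsto_0_dominated[OF lim, where k = "N v"])
        (use Cauchy_Schwarz[OF mem(3)[OF gS x] v] in \<open>auto simp: mult.commute\<close>)
    then have gv: "(\<lambda>n. b (g n) v) \<longlonglongrightarrow> b x v"
      using gS x v by (simp add: diff_left LIM_zero_iff)
    \<comment> \<open>The variational inequality holds along the sequence up to 1 / Suc n. Only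
      \<open>b (g n) v\<close> has to be passed to the limit, so \<open>J\<close> need not be
      evaluated at x.\<close>
    have q: "0 \<le> 2 * s * (b x v - f v) + s\<^sup>2 * b v v" for s
    proof -
      have "m \<le> m + 1 / Suc n + 2 * s * (b (g n) v - f v) + s\<^sup>2 * b v v" for n
      proof -
        have "m \<le> J (g n + s *\<^sub>R v)" using m_le gS v mem by blast
        also have "\<dots> = J (g n) + 2 * s * (b (g n) v - f v) + s\<^sup>2 * b v v"
          using gS[of n] v unfolding J_def
          by (simp add: bil mem fa fs sym[of v "g n"] power2_eq_square algebra_simps)
        finally show ?thesis using gJ[of n] by simp
      qed
      moreover have "(\<lambda>n. m + 1 / Suc n + 2 * s * (b (g n) v - f v) + s\<^sup>2 * b v v)
          \<longlonglongrightarrow> m + 0 + 2 * s * (b x v - f v) + s\<^sup>2 * b v v"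
        by (intro tendsto_intros gv LIMSEQ_inverse_real_of_nat[unfolded inverse_eq_divide])
      ultimately have "m \<le> m + 0 + 2 * s * (b x v - f v) + s\<^sup>2 * b v v"
        by (intro LIMSEQ_le_const) auto
      then show ?thesis by simp
    qed
    \<comment> \<open>The choice s = - r / B makes the quadratic at most - r^2 / B. Adding 1 to
      \<open>b v v\<close> keeps B positive for degenerate v.\<close>
    define r where "r = b x v - f v"
    define B where "B = b v v + 1"
    have B: "B > 0" "b v v < B" using nonneg[OF v] by (auto simp: B_def)
    have "0 \<le> 2 * (- r / B) * r + (- r / B)\<^sup>2 * b v v" using q[of "- r / B"] r_def by simp
    also have "\<dots> \<le> 2 * (- r / B) * r + (- r / B)\<^sup>2 * B"
      using B by (intro add_left_mono mult_left_mono) auto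
    also have "\<dots> = - (r\<^sup>2 / B)" using B by (simp add: power2_eq_square field_simps)
    finally have "r\<^sup>2 / B \<le> 0" by simp
    then have "r = 0" using B by (simp add: divide_le_0_iff)
    then show ?thesis by (simp add: r_def)
  qed
  then show ?thesis using x by blast
qed

text \<open>
  Kato's identity \<open>\<parallel>I - Q\<parallel> = \<parallel>Q\<parallel>\<close> for projections: exchanging the lengths of \<open>Q x\<close> and
  \<open>x - Q x\<close> produces a vector of the same norm as \<open>x\<close>.
\<close>

lemma complementary_projection_bound:
  assumes Q: "\<And>x. x \<in> S \<Longrightarrow> Q x \<in> S" and bnd: "\<And>x. x \<in> S \<Longrightarrow> N (Q x) \<le> K * N x"
    and comb: "\<And>x c d. x \<in> S \<Longrightarrow> N (Q (c *\<^sub>R Q x + d *\<^sub>R (x - Q x))) = \<bar>c\<bar> * N (Q x)"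
    and K: "1 \<le> K" and x: "x \<in> S"
  shows "N (x - Q x) \<le> K * N x"
proof -
  define y z where "y = Q x" and "z = x - Q x"
  have yz: "y \<in> S" "z \<in> S" "x = y + z" using Q x mem by (auto simp: y_def z_def)
  \<comment> \<open>If one part has length zero, the lengths cannot be exchanged by scaling; these
    cases follow from \<open>1 \<le> K\<close> and the triangle inequality.\<close>
  consider "N z = 0" | "N y = 0" | "N y > 0" "N z > 0"
    using yz N_nonneg by (metis less_eq_real_def)
  then show ?thesis
  proof cases
    case 1
    then show ?thesis using K x by (simp add: z_def)
  next
    case 2
    have "N z \<le> N x + N y" using triangle[of x "(-1) *\<^sub>R y"] N_scale[of y "-1"] yz x mem by simp
    also have "\<dots> \<le> K * N x" using 2 K x mult_right_mono[of 1 K "N x"] by simp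
    finally show ?thesis by (simp add: z_def)
  next
    case 3
    define c d where "c = N z / N y" and "d = N y / N z"
    define x' where "x' = c *\<^sub>R y + d *\<^sub>R z"
    have x': "x' \<in> S" using yz mem by (auto simp: x'_def)
    have cc: "c * (c * (N y)\<^sup>2) = (N z)\<^sup>2" and dd: "d * (d * (N z)\<^sup>2) = (N y)\<^sup>2" and cd: "c * d = 1"
      using 3 by (simp_all add: c_def d_def power2_eq_square)
    have "b x' x' = c * (c * (N y)\<^sup>2) + 2 * (c * d) * b y z + d * (d * (N z)\<^sup>2)"
      using yz sym[of z y] by (simp add: x'_def expand_add mem bil N_sq algebra_simps)
    also have "\<dots> = b x x" using yz by (simp only: cc dd cd) (simp add: expand_add N_sq)
    finally have "N x' = N x" by (simp add: N_def)
    \<comment> \<open>\<open>comb\<close> stands in for linearity and idempotence of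
      \<open>Q\<close>, which in the application hold only up to vectors of length zero.\<close>
    moreover have "N (Q x') = N z"
      using comb[OF x, of c d] 3 by (simp add: x'_def y_def z_def c_def)
    ultimately show ?thesis using bnd[OF x'] by (simp add: z_def)
  qed
qed

end

lemma semi_inner_subset:
  assumes "semi_inner S b" "subspace S'" "S' \<subseteq> S"
  shows "semi_inner S' b"
proof -
  interpret semi_inner S b by fact
  show ?thesis
    using assms(2,3) by unfold_locales (auto simp: bil sym nonneg subset_iff)
qed

lemma (in semi_inner) seq_complete_subset:
  assumes comp: seq_complete and S': "S' \<subseteq> S"
    and closed: "\<And>f x. \<lbrakk>\<And>n::nat. f n \<in> S'; x \<in> S; (\<lambda>n. N (f n - x)) \<longlonglongrightarrow> 0\<rbrakk> \<Longrightarrow> x \<in> S'"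
    and sub: "subspace S'"
  shows "semi_inner.seq_complete S' b"
proof -
  interpret S': semi_inner S' b by (rule semi_inner_subset[OF semi_inner_axioms sub S'])
  show ?thesis
    unfolding S'.seq_complete_def
  proof (intro allI impI)
    fix f :: "nat \<Rightarrow> 'e"
    assume f: "\<forall>n. f n \<in> S'" and cau: "\<forall>e>0. \<exists>n0. \<forall>m\<ge>n0. \<forall>n\<ge>n0. N (f m - f n) < e"
    have "\<forall>n. f n \<in> S" using f S' by auto
    from comp[unfolded seq_complete_def, rule_format, OF this[rule_format] cau[rule_format]]
    obtain x where x: "x \<in> S" "(\<lambda>n. N (f n - x)) \<longlonglongrightarrow> 0" by blast
    then show "\<exists>x\<in>S'. (\<lambda>n. N (f n - x)) \<longlonglongrightarrow> 0" using closed f by blast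
  qed
qed

lemma semi_inner_sum:
  assumes "semi_inner S b" "semi_inner S b'"
  shows "semi_inner S (\<lambda>x y. b x y + b' x y)"
proof -
  interpret B: semi_inner S b by fact
  interpret B': semi_inner S b' by fact
  show ?thesis
  proof
    show "subspace S" by (rule B.subspace)
    fix x y z c assume "x \<in> S" "y \<in> S"
    then show "b (c *\<^sub>R x) y + b' (c *\<^sub>R x) y = c * (b x y + b' x y)" "b x y + b' x y = b y x + b' y x"
      "z \<in> S \<Longrightarrow> b (x + y) z + b' (x + y) z = b x z + b' x z + (b y z + b' y z)" "0 \<le> b x x + b' x x"
      using B.sym[of x y] B'.sym[of x y]
      by (simp_all add: B.scale_left B'.scale_left B.add_left B'.add_left B.nonneg B'.nonneg distrib_left)
  qed
qed

section \<open>Eigenvalue bounds for quadratic forms in two variables\<close>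

text \<open>The left side is the quadratic form of the matrix with rows (1, \<alpha>) and (\<alpha>,
  1 + \<alpha>^2). Its trace is 2 + \<alpha>^2 and its determinant 1, and the constant is its larger
  eigenvalue.\<close>

lemma coupling_upper_bound:
  fixes x y \<alpha> :: real
  assumes "0 \<le> \<alpha>"
  shows "(x + \<alpha> * y)\<^sup>2 + y\<^sup>2 \<le> (1 + 1/2 * (\<alpha>\<^sup>2 + \<alpha> * sqrt (\<alpha>\<^sup>2 + 4))) * (x\<^sup>2 + y\<^sup>2)"
proof -
  define r where "r = sqrt (\<alpha>\<^sup>2 + 4)"
  have r2: "r * r = \<alpha> * \<alpha> + 4" by (simp add: r_def power2_eq_square[symmetric] add_nonneg_nonneg)
  have ra: "\<alpha> \<le> r" unfolding r_def by (intro real_le_rsqrt) simp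
  \<comment> \<open>p is the eigenvalue minus 1 and q = p - \<alpha>^2. They are the diagonal of the
    singular matrix that remains, so p q = \<alpha>^2 and the remainder is a perfect square.\<close>
  define p q where "p = (\<alpha> * \<alpha> + \<alpha> * r) / 2" and "q = (\<alpha> * r - \<alpha> * \<alpha>) / 2"
  have p: "p \<ge> 0" and q: "q \<ge> 0" and pq: "p * q = \<alpha> * \<alpha>"
  proof -
    show "p \<ge> 0" using assms ra by (simp add: p_def)
    show "q \<ge> 0" using assms mult_left_mono[OF ra assms] by (simp add: q_def)
    have "p * q = \<alpha> * \<alpha> * (r * r - \<alpha> * \<alpha>) / 4"
      by (simp add: p_def q_def field_simps)
    then show "p * q = \<alpha> * \<alpha>" by (simp add: r2)
  qed
  have s: "sqrt p * sqrt q = \<alpha>" using assms by (simp add: real_sqrt_mult[symmetric] pq)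
  have "0 \<le> (sqrt p * x - sqrt q * y)\<^sup>2" by simp
  also have "\<dots> = (sqrt p)\<^sup>2 * x\<^sup>2 - 2 * (sqrt p * sqrt q) * x * y + (sqrt q)\<^sup>2 * y\<^sup>2"
    by (simp add: power2_eq_square algebra_simps)
  also have "\<dots> = p * x\<^sup>2 - 2 * \<alpha> * x * y + q * y\<^sup>2" using p q by (simp add: s)
  also have "\<dots> = (1 + p) * (x\<^sup>2 + y\<^sup>2) - ((x + \<alpha> * y)\<^sup>2 + y\<^sup>2)"
    by (simp add: p_def q_def power2_eq_square field_simps)
  finally show ?thesis by (simp add: p_def r_def power2_eq_square)
qed

text \<open>\<mu> is the smaller eigenvalue of the matrix of (c x - \<alpha> y)^2 + y^2, which has
  trace c^2 + \<alpha>^2 + 1 and determinant c^2. Here p will be the norm of the lift of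
  \<open>C w\<close>, and c the inf-sup constant of the time derivative.\<close>

lemma coupling_lower_bound:
  fixes c \<alpha> :: real
  assumes c: "0 < c" and \<alpha>: "0 \<le> \<alpha>"
  defines "\<mu> \<equiv> 1/2 * (c\<^sup>2 + \<alpha>\<^sup>2 + 1 - sqrt ((c\<^sup>2 + \<alpha>\<^sup>2 + 1)\<^sup>2 - 4 * c\<^sup>2))"
  shows "0 < \<mu>" "\<mu> \<le> 1"
    "\<And>x y p. \<lbrakk>0 \<le> x; 0 \<le> y; 0 \<le> p; c * x \<le> p + \<alpha> * y\<rbrakk> \<Longrightarrow> \<mu> * (x\<^sup>2 + y\<^sup>2) \<le> p\<^sup>2 + y\<^sup>2"
proof -
  define s where "s = c\<^sup>2 + \<alpha>\<^sup>2 + 1"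
  define D where "D = s\<^sup>2 - 4 * c\<^sup>2"
  \<comment> \<open>Two ways to complete the square in the discriminant: \<open>D1\<close> yields
    \<mu> \<le> 1, and \<open>D2\<close> bounds \<mu> by both diagonal entries c^2 and 1 +
    \<alpha>^2.\<close>
  have D1: "D = (c\<^sup>2 + \<alpha>\<^sup>2 - 1)\<^sup>2 + 4 * \<alpha>\<^sup>2" 
    and D2: "D = (c\<^sup>2 - \<alpha>\<^sup>2 - 1)\<^sup>2 + 4 * \<alpha>\<^sup>2 * c\<^sup>2"
    by (simp_all add: D_def s_def power2_eq_square algebra_simps)
  have s0: "s > 0" unfolding s_def by (simp add: add_nonneg_pos)
  have D0: "0 \<le> D" by (simp add: D1)
  have lam: "\<mu> = (s - sqrt D) / 2" unfolding \<mu>_def D_def s_def by simp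
  have "sqrt D < s" using s0 c by (intro real_less_lsqrt) (auto simp: D_def)
  then show pos: "0 < \<mu>" by (simp add: lam)
  have "c\<^sup>2 + \<alpha>\<^sup>2 - 1 \<le> sqrt D" by (rule real_le_rsqrt) (simp add: D1)
  then show le1: "\<mu> \<le> 1" by (simp add: lam s_def)
  have "\<bar>c\<^sup>2 - \<alpha>\<^sup>2 - 1\<bar> \<le> sqrt D" by (rule real_le_rsqrt) (simp add: D2)
  then have u1: "\<mu> \<le> c\<^sup>2" and u2: "\<mu> \<le> 1 + \<alpha>\<^sup>2" by (simp_all add: lam s_def)
  have "s - 2 * \<mu> = sqrt D" unfolding lam by (simp add: field_simps)
  then have "(s - 2 * \<mu>)\<^sup>2 = D" using D0 by simp
  then have root: "\<mu> * \<mu> - s * \<mu> + c\<^sup>2 = 0"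
    by (simp add: D_def power2_eq_square algebra_simps)
  \<comment> \<open>The matrix shifted by its eigenvalue is singular with nonnegative diagonal; its
    quadratic form is the square of h x - k y below.\<close>
  then have det: "(c\<^sup>2 - \<mu>) * (1 + \<alpha>\<^sup>2 - \<mu>) = (c * \<alpha>)\<^sup>2"
    by (simp add: s_def power2_eq_square algebra_simps)
  fix x y p :: real
  assume x: "0 \<le> x" and y: "0 \<le> y" and p: "0 \<le> p" and le: "c * x \<le> p + \<alpha> * y"
  show "\<mu> * (x\<^sup>2 + y\<^sup>2) \<le> p\<^sup>2 + y\<^sup>2"
  \<comment> \<open>If c x \<le> \<alpha> y, the hypothesis gives no more than p \<ge> 0, and x has
    to be controlled by y alone. Otherwise c x - \<alpha> y is a nonnegative lower bound of p and
    may be squared.\<close>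
  proof (cases "c * x \<le> \<alpha> * y")
    case True
    have k: "\<mu> * \<alpha>\<^sup>2 \<le> c\<^sup>2 * (1 - \<mu>)"
    proof -
      have "c\<^sup>2 * (1 - \<mu>) = \<mu> * \<alpha>\<^sup>2 + \<mu> * (1 - \<mu>)"
        using root by (simp add: s_def algebra_simps)
      then show ?thesis using pos le1 by simp
    qed
    have "c\<^sup>2 * (\<mu> * x\<^sup>2) = \<mu> * (c * x)\<^sup>2" by (simp add: power_mult_distrib)
    also have "\<dots> \<le> \<mu> * (\<alpha> * y)\<^sup>2"
      using True c x pos by (intro mult_left_mono power_mono) auto
    also have "\<dots> = (\<mu> * \<alpha>\<^sup>2) * y\<^sup>2" by (simp add: power_mult_distrib)
    also have "\<dots> \<le> c\<^sup>2 * (1 - \<mu>) * y\<^sup>2" using k by (intro mult_right_mono) auto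
    finally have "c\<^sup>2 * (\<mu> * x\<^sup>2) \<le> c\<^sup>2 * ((1 - \<mu>) * y\<^sup>2)" by simp
    then have "\<mu> * x\<^sup>2 \<le> (1 - \<mu>) * y\<^sup>2" using c by simp
    then show ?thesis by (simp add: algebra_simps add_increasing)
  next
    case False
    define h k where "h = sqrt (c\<^sup>2 - \<mu>)" and "k = sqrt (1 + \<alpha>\<^sup>2 - \<mu>)"
    have hk: "h\<^sup>2 = c\<^sup>2 - \<mu>" "k\<^sup>2 = 1 + \<alpha>\<^sup>2 - \<mu>" "h * k = c * \<alpha>"
      using u1 u2 c \<alpha> by (simp_all add: h_def k_def real_sqrt_mult[symmetric] det)
    have "0 \<le> (h * x - k * y)\<^sup>2" by simp
    also have "\<dots> = h\<^sup>2 * x\<^sup>2 - 2 * (h * k) * x * y + k\<^sup>2 * y\<^sup>2"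
      by (simp add: power2_eq_square algebra_simps)
    also have "\<dots> = (c * x - \<alpha> * y)\<^sup>2 + y\<^sup>2 - \<mu> * (x\<^sup>2 + y\<^sup>2)"
      unfolding hk by (simp add: power2_eq_square algebra_simps)
    also have "(c * x - \<alpha> * y)\<^sup>2 \<le> p\<^sup>2" using False le by (intro power_mono) auto
    finally show ?thesis by simp
  qed
qed

section \<open>The discrete problem in abstract form\<close>

text \<open>
  \<open>A\<close>, \<open>D\<close> and \<open>G\<close> stand for the symmetric forms behind \<open>A\<^sub>s\<close>, \<open>\<parallel>\<partial>\<^sub>t \<cdot>\<parallel>\<^sub>Y\<^sub>'\<^sup>2\<close> and the traces; \<open>d\<close> and
  \<open>s\<close> for \<open>\<partial>\<^sub>t\<close> and \<open>A\<^sub>a\<close>; \<open>L\<close> for the Riesz lift \<open>R\<^sup>\<delta>\<close> into \<open>Ys\<close>.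
\<close>

locale discrete_BEN =
  Y: semi_inner Y A + X\<^sub>D: semi_inner X D + X\<^sub>G: semi_inner X G + Ys: semi_inner Ys A
  for Y X Ys :: "'e::real_vector set" and A D G +
  fixes Xs :: "'e set" and d s :: "'e \<Rightarrow> 'e \<Rightarrow> real" and L :: "('e \<Rightarrow> real) \<Rightarrow> 'e"
    and \<alpha> \<mu> :: real
  assumes XY: "X \<subseteq> Y" and Xs: "subspace Xs" "Xs \<subseteq> X" and YsY: "Ys \<subseteq> Y"
    and d_add1: "\<lbrakk>w \<in> X; w' \<in> X; v \<in> Y\<rbrakk> \<Longrightarrow> d (w + w') v = d w v + d w' v"
    and d_scale1: "\<lbrakk>w \<in> X; v \<in> Y\<rbrakk> \<Longrightarrow> d (c *\<^sub>R w) v = c * d w v"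
    and d_add2: "\<lbrakk>w \<in> X; v \<in> Y; v' \<in> Y\<rbrakk> \<Longrightarrow> d w (v + v') = d w v + d w v'"
    and d_scale2: "\<lbrakk>w \<in> X; v \<in> Y\<rbrakk> \<Longrightarrow> d w (c *\<^sub>R v) = c * d w v"
    and d_bound: "\<lbrakk>w \<in> X; v \<in> Y\<rbrakk> \<Longrightarrow> \<bar>d w v\<bar> \<le> X\<^sub>D.N w * Y.N v"
    and s_add1: "\<lbrakk>w \<in> Y; w' \<in> Y; v \<in> Y\<rbrakk> \<Longrightarrow> s (w + w') v = s w v + s w' v"
    and s_scale1: "\<lbrakk>w \<in> Y; v \<in> Y\<rbrakk> \<Longrightarrow> s (c *\<^sub>R w) v = c * s w v"
    and s_skew: "\<lbrakk>w \<in> Y; v \<in> Y\<rbrakk> \<Longrightarrow> s w v = - s v w"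
    and s_bound: "\<lbrakk>w \<in> Y; v \<in> Y\<rbrakk> \<Longrightarrow> \<bar>s w v\<bar> \<le> \<alpha> * Y.N w * Y.N v"
    and \<alpha>: "0 \<le> \<alpha>"
    and lift_mem: "Ys.bounded_functional f \<Longrightarrow> L f \<in> Ys"
    and lift_eq: "\<lbrakk>Ys.bounded_functional f; v \<in> Ys\<rbrakk> \<Longrightarrow> A (L f) v = f v"
    and \<mu>: "0 < \<mu>" "\<mu> \<le> 1"
    and coercive: "\<lbrakk>w \<in> Xs; 0 \<le> p; X\<^sub>D.N w \<noteq> 0 \<Longrightarrow> Y.N (L (d w)) \<le> p + \<alpha> * Y.N w\<rbrakk>
       \<Longrightarrow> \<mu> * (D w w + A w w) \<le> p\<^sup>2 + A w w"
    and complete: "semi_inner.seq_complete Xs (\<lambda>w v. A w v + D w v + G w v)"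
begin

definition C where "C w v = d w v + s w v"
definition P where "P w v = A w v + D w v + G w v"
definition b where "b w v = C v (L (C w)) + A w v + G w v"
definition M where "M = 1 + 1/2 * (\<alpha>\<^sup>2 + \<alpha> * sqrt (\<alpha>\<^sup>2 + 4))"

lemma XsY: "Xs \<subseteq> Y" using Xs XY by blast

lemma P_eq: "P = (\<lambda>w v. A w v + D w v + G w v)" by (auto simp: P_def fun_eq_iff)

lemma AX: "semi_inner X A"
  by (rule semi_inner_subset[OF Y.semi_inner_axioms X\<^sub>D.subspace XY])

sublocale X: semi_inner X P
  unfolding P_eq by (intro semi_inner_sum AX X\<^sub>D.semi_inner_axioms X\<^sub>G.semi_inner_axioms)

lemma s_add2: "\<lbrakk>w \<in> Y; v \<in> Y; v' \<in> Y\<rbrakk> \<Longrightarrow> s w (v + v') = s w v + s w v'"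
  using s_skew[of w v] s_skew[of w v'] s_skew[of w "v + v'"] s_add1[of v v' w] Y.mem(1)[of v v'] by simp

lemma s_scale2: "\<lbrakk>w \<in> Y; v \<in> Y\<rbrakk> \<Longrightarrow> s w (c *\<^sub>R v) = c * s w v"
  using s_skew[of w v] s_skew[of w "c *\<^sub>R v"] s_scale1[of v w c] Y.mem(2)[of v c] by simp

lemma X_sq: "w \<in> X \<Longrightarrow> (X.N w)\<^sup>2 = (Y.N w)\<^sup>2 + (X\<^sub>D.N w)\<^sup>2 + G w w"
  using XY by (simp add: X.N_sq Y.N_sq X\<^sub>D.N_sq subset_iff P_def)

lemma d_functional: "w \<in> X \<Longrightarrow> Ys.bounded_functional (d w)"
  using YsY d_bound
  by (intro Ys.bounded_functionalI[where K = "X\<^sub>D.N w"]) (auto simp: d_add2 d_scale2 subset_iff)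

lemma s_functional: "w \<in> Y \<Longrightarrow> Ys.bounded_functional (s w)"
  using YsY s_bound
  by (intro Ys.bounded_functionalI[where K = "\<alpha> * Y.N w"]) (auto simp: s_add2 s_scale2 subset_iff)

lemma A_functional: "w \<in> Y \<Longrightarrow> Ys.bounded_functional (A w)"
  using YsY Y.Cauchy_Schwarz
  by (intro Ys.bounded_functionalI[where K = "Y.N w"]) (auto simp: Y.bil subset_iff)

lemma functional_add:
  assumes "Ys.bounded_functional f" "Ys.bounded_functional h"
  shows "Ys.bounded_functional (\<lambda>v. f v + h v)"
proof -
  obtain K where K: "\<And>x. x \<in> Ys \<Longrightarrow> \<bar>f x\<bar> \<le> K * Y.N x"
    using assms unfolding Ys.bounded_functional_def by blast
  obtain K' where K': "\<And>x. x \<in> Ys \<Longrightarrow> \<bar>h x\<bar> \<le> K' * Y.N x"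
    using assms unfolding Ys.bounded_functional_def by blast
  show ?thesis
  proof (rule Ys.bounded_functionalI[where K = "K + K'"])
    show "\<bar>f x + h x\<bar> \<le> (K + K') * Y.N x" if "x \<in> Ys" for x
      using K[OF that] K'[OF that] by (simp add: distrib_right)
  qed (use assms in \<open>auto simp: Ys.bounded_functional_def algebra_simps\<close>)
qed

lemma C_functional: "w \<in> X \<Longrightarrow> Ys.bounded_functional (C w)"
  using functional_add[OF d_functional s_functional, of w w] XY
  by (auto simp: C_def[abs_def] subset_iff)

lemma C_bound:
  assumes "w \<in> X" "v \<in> Y"
  shows "\<bar>C w v\<bar> \<le> (X\<^sub>D.N w + \<alpha> * Y.N w) * Y.N v"
  using d_bound[OF assms] s_bound[of w v] assms XY
  unfolding C_def by (auto simp: distrib_right)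

lemma C_add1: "\<lbrakk>w \<in> X; w' \<in> X; v \<in> Y\<rbrakk> \<Longrightarrow> C (w + w') v = C w v + C w' v"
  using XY by (simp add: C_def d_add1 s_add1 subset_iff)

lemma C_scale1: "\<lbrakk>w \<in> X; v \<in> Y\<rbrakk> \<Longrightarrow> C (c *\<^sub>R w) v = c * C w v"
  using XY by (simp add: C_def d_scale1 s_scale1 subset_iff algebra_simps)

lemma LC: "w \<in> X \<Longrightarrow> L (C w) \<in> Ys" "w \<in> X \<Longrightarrow> L (C w) \<in> Y"
  using lift_mem C_functional YsY by auto

text \<open>Testing the lift of \<open>C v\<close> with \<open>L (C w)\<close>, itself an element of
  \<open>Ys\<close>, turns the lifted term of \<open>b\<close> into an \<open>A\<close>-product of
  two lifts. Symmetry and semidefiniteness of \<open>b\<close> rest on this.\<close>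

lemma lift_sym: "\<lbrakk>w \<in> X; v \<in> X\<rbrakk> \<Longrightarrow> C v (L (C w)) = A (L (C v)) (L (C w))"
  using lift_eq C_functional LC by simp

text \<open>\<open>L\<close> is specified only through the equation for its values and need not be
  additive. Linearity of \<open>b\<close> in its first argument is obtained by moving that argument
  out of the lift.\<close>

lemma lift_swap: "\<lbrakk>w \<in> X; v \<in> X\<rbrakk> \<Longrightarrow> C v (L (C w)) = C w (L (C v))"
  using lift_sym Y.sym LC by metis

lemma b_sq: "w \<in> X \<Longrightarrow> b w w = (Y.N (L (C w)))\<^sup>2 + (Y.N w)\<^sup>2 + G w w"
  using XY LC by (auto simp: b_def lift_sym Y.N_sq)

sublocale B: semi_inner X b
proof
  show "subspace X" by (rule X.subspace)
next
  fix x y z assume xyz: "x \<in> X" "y \<in> X" "z \<in> X"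
  then show "b (x + y) z = b x z + b y z"
    using XY lift_swap[of "x + y" z] lift_swap[of x z] lift_swap[of y z] X.mem(1)[of x y]
    by (simp add: b_def C_add1 LC X\<^sub>G.bil Y.bil subset_iff)
next
  fix x y c assume "x \<in> X" "y \<in> X"
  then show "b (c *\<^sub>R x) y = c * b x y"
    using XY lift_swap[of "c *\<^sub>R x" y] lift_swap[of x y] X.mem(2)[of x c]
    by (simp add: b_def C_scale1 LC X\<^sub>G.bil Y.bil subset_iff algebra_simps)
next
  fix x y assume "x \<in> X" "y \<in> X"
  then show "b x y = b y x"
    using XY lift_swap[of x y] Y.sym X\<^sub>G.sym by (auto simp: b_def subset_iff)
next
  fix x assume "x \<in> X"
  then show "0 \<le> b x x" using X\<^sub>G.nonneg by (simp add: b_sq)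
qed

lemma M_ge_1: "1 \<le> M" using \<alpha> by (simp add: M_def)

lemma N_LC_le: 
  assumes "w \<in> X" shows "Y.N (L (C w)) \<le> X\<^sub>D.N w + \<alpha> * Y.N w"
proof -
  let ?l = "L (C w)"
  have "Y.N ?l * Y.N ?l = \<bar>C w ?l\<bar>"
    using lift_sym[OF assms assms] Y.N_sq[of ?l] LC[OF assms] Y.nonneg[of ?l]
    by (simp add: power2_eq_square)
  also have "\<dots> \<le> (X\<^sub>D.N w + \<alpha> * Y.N w) * Y.N ?l" using C_bound LC assms by blast
  finally have le: "Y.N ?l * Y.N ?l \<le> (X\<^sub>D.N w + \<alpha> * Y.N w) * Y.N ?l" .
  have "0 \<le> X\<^sub>D.N w + \<alpha> * Y.N w" using assms XY \<alpha> by (auto simp: subset_iff)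
  then show ?thesis
    using mult_right_le_imp_le[OF le] Y.N_nonneg[OF LC(2)[OF assms]] by (cases "Y.N ?l = 0") auto
qed

lemma b_upper:
  assumes w: "w \<in> X" shows "B.N w \<le> sqrt M * X.N w"
proof -
  have wY: "w \<in> Y" using w XY by auto
  have "b w w \<le> (X\<^sub>D.N w + \<alpha> * Y.N w)\<^sup>2 + (Y.N w)\<^sup>2 + G w w"
    unfolding b_sq[OF w] using N_LC_le[OF w] LC[OF w] wY by (intro add_mono power_mono) auto
  also have "\<dots> \<le> M * ((X\<^sub>D.N w)\<^sup>2 + (Y.N w)\<^sup>2) + M * G w w"
    unfolding M_def[symmetric]
    using coupling_upper_bound[OF \<alpha>, of "X\<^sub>D.N w" "Y.N w"] M_ge_1 X\<^sub>G.nonneg[OF w]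
      mult_right_mono[of 1 M "G w w"] by (simp add: M_def)
  also have "\<dots> = M * (X.N w)\<^sup>2" by (simp add: X_sq[OF w] algebra_simps)
  finally have "sqrt (b w w) \<le> sqrt (M * (X.N w)\<^sup>2)" by (rule real_sqrt_le_mono)
  then show ?thesis using w by (simp add: B.N_def real_sqrt_mult)
qed

text \<open>On \<open>Ys\<close> the functional \<open>d w\<close> is \<open>C w\<close> minus the
  skew part, so the lift of \<open>d w\<close> is longer than that of \<open>C w\<close> by at most
  \<alpha> times the \<open>Y\<close>-norm of w. This transfers stability of the time derivative to
  \<open>C\<close>, by \<open>coercive\<close> with p the norm of the lift of
  \<open>C w\<close>.\<close>

lemma b_lower:
  assumes w: "w \<in> Xs" shows "sqrt \<mu> * X.N w \<le> B.N w"
proof -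
  have wX: "w \<in> X" and wY: "w \<in> Y" using w XsY Xs by auto
  define l where "l = L (d w)"
  have l: "l \<in> Ys" "l \<in> Y" using lift_mem[OF d_functional[OF wX]] YsY by (auto simp: l_def)
  have "Y.N l * Y.N l = d w l"
    using lift_eq[OF d_functional[OF wX] l(1)] Y.N_sq[OF l(2)]
    by (simp add: l_def power2_eq_square)
  also have "\<dots> = A (L (C w)) l - s w l"
    using lift_eq[OF C_functional[OF wX] l(1)] by (simp add: C_def)
  also have "\<dots> \<le> (Y.N (L (C w)) + \<alpha> * Y.N w) * Y.N l"
    using Y.Cauchy_Schwarz[OF LC(2)[OF wX] l(2)] s_bound[OF wY l(2)]
    by (simp add: distrib_right abs_le_iff)
  finally have "Y.N l \<le> Y.N (L (C w)) + \<alpha> * Y.N w"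
    using Y.N_nonneg[OF l(2)] Y.N_nonneg[OF LC(2)[OF wX]] Y.N_nonneg[OF wY] \<alpha>
    by (cases "Y.N l = 0") auto
  then have "\<mu> * (D w w + A w w) \<le> (Y.N (L (C w)))\<^sup>2 + A w w"
    using LC[OF wX] by (intro coercive w) (auto simp: l_def)
  then have "\<mu> * (X.N w)\<^sup>2 \<le> b w w"
    using \<mu> X\<^sub>G.nonneg[OF wX] mult_right_mono[of \<mu> 1 "G w w"]
    unfolding X_sq[OF wX] b_sq[OF wX] Y.N_sq[OF wY] X\<^sub>D.N_sq[OF wX]
    by (simp add: algebra_simps)
  then have "sqrt (\<mu> * (X.N w)\<^sup>2) \<le> sqrt (b w w)" by (rule real_sqrt_le_mono)
  then show ?thesis using wX by (simp add: B.N_def real_sqrt_mult)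
qed

sublocale Xs: semi_inner Xs P
  by (rule semi_inner_subset[OF X.semi_inner_axioms Xs])

sublocale Bs: semi_inner Xs b
  by (rule semi_inner_subset[OF B.semi_inner_axioms Xs])

text \<open>On \<open>Xs\<close> the seminorms of \<open>b\<close> and \<open>P\<close> are
  equivalent by \<open>b_lower\<close> and \<open>b_upper\<close>, so completeness carries
  over.\<close>

lemma B_complete: "Bs.seq_complete"
  unfolding Bs.seq_complete_def
proof (intro allI impI)
  fix f :: "nat \<Rightarrow> 'e"
  assume f: "\<forall>n. f n \<in> Xs" and cau: "\<forall>e>0. \<exists>n0. \<forall>m\<ge>n0. \<forall>n\<ge>n0. B.N (f m - f n) < e"
  have "X.N (f m - f n) \<le> 1 / sqrt \<mu> * B.N (f m - f n)" for m n
    using b_lower[OF Xs.mem(3)[of "f m" "f n"]] f \<mu> by (simp add: field_simps)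
  from Cauchy_dominated[OF cau this] \<mu>
  have "\<forall>e>0. \<exists>n0. \<forall>m\<ge>n0. \<forall>n\<ge>n0. X.N (f m - f n) < e" by simp
  then obtain x where x: "x \<in> Xs" "(\<lambda>n. X.N (f n - x)) \<longlonglongrightarrow> 0"
    using complete[folded P_eq] f unfolding Xs.seq_complete_def by blast
  have fx: "f n - x \<in> X" for n using f x Xs(2) Xs.mem(3)[of "f n" x] by auto
  have "(\<lambda>n. B.N (f n - x)) \<longlonglongrightarrow> 0"
    by (rule tendsto_0_dominated[OF x(2) B.N_nonneg[OF fx] b_upper[OF fx]])
  then show "\<exists>x\<in>Xs. (\<lambda>n. B.N (f n - x)) \<longlonglongrightarrow> 0" using x by blast
qed

lemma b_functional: "x \<in> X \<Longrightarrow> Bs.bounded_functional (b x)"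
  using Xs B.Cauchy_Schwarz
  by (intro Bs.bounded_functionalI[where K = "B.N x"]) (auto simp: B.bil subset_iff)

lemma C_X_bound:
  assumes w: "w \<in> X" and v: "v \<in> Y" shows "\<bar>C w v\<bar> \<le> sqrt (1 + \<alpha>\<^sup>2) * X.N w * Y.N v"
proof -
  have "X\<^sub>D.N w + \<alpha> * Y.N w \<le> sqrt (1 + \<alpha>\<^sup>2) * X.N w"
  proof (rule power2_le_imp_le)
    \<comment> \<open>Lagrange's identity for the vectors (1, \<alpha>) and
      (\<open>X\<^sub>D.N w\<close>, \<open>Y.N w\<close>).\<close>
    have "(X\<^sub>D.N w + \<alpha> * Y.N w)\<^sup>2 = (1 + \<alpha>\<^sup>2) * ((X\<^sub>D.N w)\<^sup>2 + (Y.N w)\<^sup>2) - (\<alpha> * X\<^sub>D.N w - Y.N w)\<^sup>2"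
      by (simp add: power2_eq_square algebra_simps)
    also have "\<dots> \<le> (1 + \<alpha>\<^sup>2) * (X.N w)\<^sup>2"
      using X\<^sub>G.nonneg[OF w] unfolding X_sq[OF w]
      by (smt (verit, best) mult_left_mono zero_le_power2)
    finally show "(X\<^sub>D.N w + \<alpha> * Y.N w)\<^sup>2 \<le> (sqrt (1 + \<alpha>\<^sup>2) * X.N w)\<^sup>2"
      by (simp add: power_mult_distrib)
  qed (use w in simp)
  then show ?thesis using C_bound[OF w v] mult_right_mono[OF _ Y.N_nonneg[OF v]] order_trans by blast
qed

text \<open>The solution x is compared with the b-projection of u: the distance from u to the
  projection does not see the consistency term of f, and the distance from the projection to x sees
  nothing else.\<close>

theorem quasi_optimality:
  assumes u: "u \<in> X" and nz: "\<exists>x\<in>Xs. X.N x \<noteq> 0"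
    and rhs: "\<And>w. w \<in> Xs \<Longrightarrow> f w = b u w - C w (u - L (A u))"
  shows "\<exists>x\<in>Xs. (\<forall>w\<in>Xs. b x w = f w) \<and> (\<forall>x'\<in>Xs. (\<forall>w\<in>Xs. b x' w = f w) \<longrightarrow> X.N (x' - x) = 0) \<and>
    (\<forall>w\<in>Xs. \<forall>v\<in>Ys. X.N (u - x) \<le> (M * X.N (u - w) + sqrt (1 + \<alpha>\<^sup>2) * Y.N (u - v)) / \<mu>)"
proof -
  have uY: "u \<in> Y" using u XY by blast
  have Pu: "L (A u) \<in> Ys" "L (A u) \<in> Y" using lift_mem[OF A_functional[OF uY]] YsY by auto
  define e where "e = u - L (A u)"
  have eY: "e \<in> Y" using uY Pu by (auto simp: e_def intro: Y.mem)
  \<comment> \<open>A choice function: it is additive, homogeneous and idempotent only up to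
    seminorm zero, which \<open>unique\<close> and \<open>cong\<close> make usable.\<close>
  define Q where "Q x = (SOME y. y \<in> Xs \<and> (\<forall>w\<in>Xs. b y w = b x w))" for x
  have Q: "Q x \<in> Xs" "\<And>w. w \<in> Xs \<Longrightarrow> b (Q x) w = b x w" if "x \<in> X" for x
  proof -
    have "\<exists>y. y \<in> Xs \<and> (\<forall>w\<in>Xs. b y w = b x w)"
      using Bs.Riesz[OF B_complete b_functional[OF that]] by blast
    then have "Q x \<in> Xs \<and> (\<forall>w\<in>Xs. b (Q x) w = b x w)" unfolding Q_def by (rule someI_ex)
    then show "Q x \<in> Xs" "\<And>w. w \<in> Xs \<Longrightarrow> b (Q x) w = b x w" by auto
  qed
  have QX: "Q x \<in> X" if "x \<in> X" for x using Q(1)[OF that] Xs by blast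
  have unique: "X.N (x - y) = 0" if "x \<in> Xs" "y \<in> Xs" "\<And>w. w \<in> Xs \<Longrightarrow> b x w = b y w" for x y
  proof -
    have xy: "x - y \<in> Xs" using that by (intro Xs.mem)
    have "b (x - y) (x - y) = 0" using that(3)[OF xy] Bs.diff_left[of x y "x - y"] that xy by simp
    then have "sqrt \<mu> * X.N (x - y) \<le> 0" using b_lower[OF xy] by (simp add: B.N_def)
    then show ?thesis using \<mu> Xs.N_nonneg[OF xy] by (auto simp: mult_le_0_iff)
  qed
  have cong: "X.N x = X.N y" if "x \<in> X" "y \<in> X" "X.N (x - y) = 0" for x y
    using X.triangle[of "x - y" y] X.triangle[of "y - x" x] X.N_diff_commute[of x y] that X.mem(3)[of x y] X.mem(3)[of y x]
    by simp
  define K where "K = M / \<mu>"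
  have K1: "1 \<le> K" using M_ge_1 \<mu> by (simp add: K_def)
  have Q_bound: "X.N (Q x) \<le> K * X.N x" if x: "x \<in> X" for x
  proof -
    have "(B.N (Q x))\<^sup>2 = b x (Q x)" using Q[OF x] QX[OF x] by (simp add: B.N_sq)
    also have "\<dots> \<le> B.N x * B.N (Q x)" using B.Cauchy_Schwarz[OF x QX[OF x]] by simp
    finally have "B.N (Q x) * B.N (Q x) \<le> B.N x * B.N (Q x)" by (simp add: power2_eq_square)
    then have "B.N (Q x) \<le> B.N x"
      using B.N_nonneg[OF QX[OF x]] B.N_nonneg[OF x] by (cases "B.N (Q x) = 0") auto
    then have "sqrt \<mu> * X.N (Q x) \<le> sqrt M * X.N x"
      using b_lower[OF Q(1)[OF x]] b_upper[OF x] by simp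
    then have "X.N (Q x) \<le> sqrt K * X.N x"
      using \<mu> by (simp add: K_def real_sqrt_divide field_simps)
    \<comment> \<open>Comparing \<open>b\<close> with \<open>P\<close> from above at x and from
      below at \<open>Q x\<close> costs the square root of M / \<mu>; since 1 \<le> K this is at
      most the constant K of the claim.\<close>
    also have "\<dots> \<le> K * X.N x"
      using K1 x by (intro mult_right_mono) (auto intro!: real_le_lsqrt simp: power2_eq_square)
    finally show ?thesis .
  qed
  have QI: "X.N (x - Q x) \<le> K * X.N x" if x: "x \<in> X" for x
  proof (rule X.complementary_projection_bound[OF QX Q_bound _ K1 x])
    fix x c d assume x: "x \<in> X"
    let ?z = "c *\<^sub>R Q x + d *\<^sub>R (x - Q x)"
    have zX: "?z \<in> X" using x QX by (intro X.mem) auto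
    have "b (Q ?z) w = b (c *\<^sub>R Q x) w" if w: "w \<in> Xs" for w
    proof -
      have wX: "w \<in> X" using w Xs by blast
      have "b (Q ?z) w = b ?z w" using Q(2)[OF zX w] .
      also have "\<dots> = c * b (Q x) w + d * (b x w - b (Q x) w)"
        using x QX[OF x] wX by (simp add: B.bil B.mem)
      finally show ?thesis using Q(2)[OF x w] QX[OF x] wX by (simp add: B.bil)
    qed
    then have "X.N (Q ?z - c *\<^sub>R Q x) = 0"
      using Q(1)[OF zX] Q(1)[OF x] by (intro unique Xs.mem)
    then have "X.N (Q ?z) = X.N (c *\<^sub>R Q x)" using QX zX x by (intro cong X.mem)
    then show "X.N (Q ?z) = \<bar>c\<bar> * X.N (Q x)" using X.N_scale QX[OF x] by simp
  qed
  have opt: "X.N (u - Q u) \<le> K * X.N (u - w)" if w: "w \<in> Xs" for w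
  proof -
    have wX: "w \<in> X" using w Xs by blast
    have uw: "u - w \<in> X" using wX u by (intro X.mem)
    \<comment> \<open>\<open>Q\<close> fixes w up to seminorm zero, so subtracting w from u does not
      change the complementary part u - Q u.\<close>
    have "X.N ((Q u - w) - Q (u - w)) = 0"
    proof (rule unique)
      show "Q u - w \<in> Xs" "Q (u - w) \<in> Xs" using Q(1) u uw w by (auto intro: Xs.mem)
      fix v assume v: "v \<in> Xs"
      then show "b (Q u - w) v = b (Q (u - w)) v"
        using Q(2)[OF u v] Q(2)[OF uw v] Xs QX[OF u] wX u by (simp add: B.bil subset_iff)
    qed
    then have "X.N (((u - w) - Q (u - w)) - (u - Q u)) = 0" by (simp add: algebra_simps)
    then have "X.N (u - Q u) = X.N ((u - w) - Q (u - w))"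
      using u uw wX QX by (intro cong[symmetric, where x = "(u - w) - Q (u - w)"] X.mem)
    then show ?thesis using QI[OF uw] by simp
  qed
  have f_functional: "Bs.bounded_functional f"
    unfolding Bs.bounded_functional_def
  proof (intro conjI ballI allI exI)
    fix x y assume "x \<in> Xs" "y \<in> Xs"
    then show "f (x + y) = f x + f y"
      using rhs Xs(2) u C_add1[of x y e] eY Xs.mem(1)[of x y] by (simp add: B.bil e_def[symmetric] subset_iff)
  next
    fix c x assume "x \<in> Xs"
    then show "f (c *\<^sub>R x) = c * f x"
      using rhs Xs(2) u C_scale1[of x e c] eY Xs.mem(2)[of x c]
      by (simp add: B.bil e_def[symmetric] right_diff_distrib subset_iff)
  next
    fix x assume x: "x \<in> Xs"
    then have xX: "x \<in> X" using Xs by blast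
    have "\<bar>f x\<bar> \<le> \<bar>b u x\<bar> + \<bar>C x e\<bar>" using rhs[OF x] by (simp add: e_def)
    also have "\<dots> \<le> B.N u * B.N x + sqrt (1 + \<alpha>\<^sup>2) * (B.N x / sqrt \<mu>) * Y.N e"
    proof (rule add_mono)
      have "\<bar>C x e\<bar> \<le> sqrt (1 + \<alpha>\<^sup>2) * X.N x * Y.N e" using C_X_bound[OF xX eY] .
      also have "\<dots> \<le> sqrt (1 + \<alpha>\<^sup>2) * (B.N x / sqrt \<mu>) * Y.N e"
        using b_lower[OF x] \<mu> eY
        by (intro mult_right_mono mult_left_mono) (auto simp: field_simps)
      finally show "\<bar>C x e\<bar> \<le> sqrt (1 + \<alpha>\<^sup>2) * (B.N x / sqrt \<mu>) * Y.N e" .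
    qed (use B.Cauchy_Schwarz u xX in auto)
    finally show "\<bar>f x\<bar> \<le> (B.N u + sqrt (1 + \<alpha>\<^sup>2) / sqrt \<mu> * Y.N e) * B.N x"
      by (simp add: algebra_simps)
  qed
  obtain x where x: "x \<in> Xs" "\<And>w. w \<in> Xs \<Longrightarrow> b x w = f w"
    using Bs.Riesz[OF B_complete f_functional] by blast
  have xX: "x \<in> X" using x Xs by blast
  have best: "Y.N e \<le> Y.N (u - v)" if v: "v \<in> Ys" for v
  proof -
    have vY: "v \<in> Y" using v YsY by blast
    define z where "z = L (A u) - v"
    have z: "z \<in> Ys" "z \<in> Y" using v Pu YsY Ys.mem(3)[of "L (A u)" v] by (auto simp: z_def)
    have "A e z = 0" using lift_eq[OF A_functional[OF uY] z(1)] uY Pu z by (simp add: e_def Y.bil)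
    moreover have "u - v = e + z" by (simp add: e_def z_def)
    \<comment> \<open>Pythagoras: e is \<open>A\<close>-orthogonal to \<open>Ys\<close>.\<close>
    ultimately have "A e e \<le> A (u - v) (u - v)" 
      using Y.expand_add[OF eY z(2)] Y.nonneg[OF z(2)] by simp
    then show ?thesis by (simp add: Y.N_def)
  qed
  have xQ: "X.N (Q u - x) \<le> sqrt (1 + \<alpha>\<^sup>2) * Y.N e / \<mu>"
  proof -
    define r where "r = Q u - x"
    have r: "r \<in> Xs" "r \<in> X" using x Q(1)[OF u] Xs(2) Xs.mem(3)[of "Q u" x] by (auto simp: r_def)
    have "\<mu> * (X.N r)\<^sup>2 = (sqrt \<mu> * X.N r)\<^sup>2" using \<mu> by (simp add: power_mult_distrib)
    also have "\<dots> \<le> (B.N r)\<^sup>2" using b_lower[OF r(1)] \<mu> r by (intro power_mono) auto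
    \<comment> \<open>Against r in \<open>Xs\<close>, \<open>Q u\<close> may be replaced by u and x
      by its equation, so only the consistency error \<open>C r e\<close> survives.\<close>
    also have "\<dots> = b (Q u) r - b x r" using r QX[OF u] xX by (simp add: B.N_sq B.bil r_def)
    also have "\<dots> = C r e" using Q(2)[OF u r(1)] x(2)[OF r(1)] rhs[OF r(1)] by (simp add: e_def)
    also have "\<dots> \<le> sqrt (1 + \<alpha>\<^sup>2) * Y.N e * X.N r"
      using C_X_bound[OF r(2) eY] by (simp add: algebra_simps)
    finally have "X.N r * (\<mu> * X.N r) \<le> X.N r * (sqrt (1 + \<alpha>\<^sup>2) * Y.N e)"
      by (simp add: power2_eq_square algebra_simps)
    then have "\<mu> * X.N r \<le> sqrt (1 + \<alpha>\<^sup>2) * Y.N e"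
      using X.N_nonneg[OF r(2)] Y.N_nonneg[OF eY] by (cases "X.N r = 0") auto
    then show ?thesis using \<mu> by (simp add: r_def field_simps)
  qed
  show ?thesis
  proof (intro bexI[OF _ x(1)] conjI ballI impI)
    fix w v assume w: "w \<in> Xs" and v: "v \<in> Ys"
    have "X.N (u - x) \<le> X.N (u - Q u) + X.N (Q u - x)"
      using X.triangle_diff u QX xX by blast
    also have "\<dots> \<le> K * X.N (u - w) + sqrt (1 + \<alpha>\<^sup>2) * Y.N (u - v) / \<mu>"
    proof (intro add_mono opt w order_trans[OF xQ] divide_right_mono mult_left_mono best v)
    qed (use \<mu> in auto)
    finally show "X.N (u - x) \<le> (M * X.N (u - w) + sqrt (1 + \<alpha>\<^sup>2) * Y.N (u - v)) / \<mu>"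
      by (simp add: K_def add_divide_distrib)
  next
    fix x' assume "x' \<in> Xs" "\<forall>w\<in>Xs. b x' w = f w"
    then show "X.N (x' - x) = 0" using unique x by auto
  qed (use x in auto)
qed

end

section \<open>Square integrable functions\<close>

text \<open>With pointwise scaling, sets of functions can be subspaces and hence carriers of
  semi-inner products; pointwise addition comes from the imported function algebras.\<close>

instantiation "fun" :: (type, real_vector) real_vector
begin

definition scaleR_fun_def: "c *\<^sub>R f = (\<lambda>x. c *\<^sub>R f x)"

instance
  by standard (simp_all add: scaleR_fun_def fun_eq_iff algebra_simps)

end

lemma scaleR_fun_apply [simp]: "(c *\<^sub>R f) x = c *\<^sub>R f x"
  by (simp add: scaleR_fun_def)

lemma finite_measure_timeM: "finite_measure (timeM T)"
  by (intro finite_measure_lebesgue_on) auto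

lemma L2_measurable: "f \<in> L2 T \<Longrightarrow> f \<in> borel_measurable (timeM T)"
  by (simp add: L2_def)

lemma L2_norm_mult_integrable:
  fixes f :: "real \<Rightarrow> 'b::{real_normed_vector, second_countable_topology}"
    and g :: "real \<Rightarrow> 'c::{real_normed_vector, second_countable_topology}"
  assumes f: "f \<in> L2 T" and g: "g \<in> L2 T"
  shows "integrable (timeM T) (\<lambda>t. norm (f t) * norm (g t))"
proof (rule Bochner_Integration.integrable_bound)
  note [measurable] = L2_measurable[OF f] L2_measurable[OF g]
  show "integrable (timeM T) (\<lambda>t. (norm (f t))\<^sup>2 + (norm (g t))\<^sup>2)"
    using f g by (auto simp: L2_def)
  show "(\<lambda>t. norm (f t) * norm (g t)) \<in> borel_measurable (timeM T)" by measurable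
  show "AE t in timeM T. norm (norm (f t) * norm (g t)) \<le> norm ((norm (f t))\<^sup>2 + (norm (g t))\<^sup>2)"
  proof (rule AE_I2)
    fix t
    have "0 \<le> (norm (f t) - norm (g t))\<^sup>2" by simp
    moreover have "0 \<le> norm (f t) * norm (g t)" by simp
    ultimately have "norm (f t) * norm (g t) \<le> (norm (f t))\<^sup>2 + (norm (g t))\<^sup>2"
      unfolding power2_diff by linarith
    then show "norm (norm (f t) * norm (g t)) \<le> norm ((norm (f t))\<^sup>2 + (norm (g t))\<^sup>2)"
      by simp
  qed
qed

lemma L2_boundedI:
  fixes f :: "real \<Rightarrow> 'b::{real_normed_vector, second_countable_topology}"
  assumes g: "g \<in> L2 T" and f: "f \<in> borel_measurable (timeM T)"
    and le: "AE t in timeM T. norm (f t) \<le> c * norm (g t)"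
  shows "f \<in> L2 T"
proof -
  have "integrable (timeM T) (\<lambda>t. (norm (f t))\<^sup>2)"
  proof (rule Bochner_Integration.integrable_bound)
    show "integrable (timeM T) (\<lambda>t. c\<^sup>2 * (norm (g t))\<^sup>2)" using g by (auto simp: L2_def)
    show "(\<lambda>t. (norm (f t))\<^sup>2) \<in> borel_measurable (timeM T)" using f by measurable
    show "AE t in timeM T. norm ((norm (f t))\<^sup>2) \<le> norm (c\<^sup>2 * (norm (g t))\<^sup>2)"
      using le
    proof eventually_elim
      case (elim t)
      then have "(norm (f t))\<^sup>2 \<le> (c * norm (g t))\<^sup>2" by (intro power_mono) auto
      then show ?case by (simp add: power_mult_distrib)
    qed
  qed
  then show ?thesis using f by (simp add: L2_def)
qed

lemma L2_add:
  fixes f g :: "real \<Rightarrow> 'b::{real_normed_vector, second_countable_topology}"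
  assumes f: "f \<in> L2 T" and g: "g \<in> L2 T"
  shows "f + g \<in> L2 T"
proof -
  note [measurable] = L2_measurable[OF f] L2_measurable[OF g]
  have "integrable (timeM T) (\<lambda>t. (norm (f t + g t))\<^sup>2)"
  proof (rule Bochner_Integration.integrable_bound)
    show "integrable (timeM T) (\<lambda>t. (norm (f t))\<^sup>2 + 2 * (norm (f t) * norm (g t)) + (norm (g t))\<^sup>2)"
      using f g L2_norm_mult_integrable[OF f g] by (auto simp: L2_def)
    show "(\<lambda>t. (norm (f t + g t))\<^sup>2) \<in> borel_measurable (timeM T)" by measurable
    show "AE t in timeM T. norm ((norm (f t + g t))\<^sup>2)
      \<le> norm ((norm (f t))\<^sup>2 + 2 * (norm (f t) * norm (g t)) + (norm (g t))\<^sup>2)"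
    proof (rule AE_I2)
      fix t
      have "(norm (f t + g t))\<^sup>2 \<le> (norm (f t) + norm (g t))\<^sup>2"
        by (intro power_mono norm_triangle_ineq) auto
      then show "norm ((norm (f t + g t))\<^sup>2)
        \<le> norm ((norm (f t))\<^sup>2 + 2 * (norm (f t) * norm (g t)) + (norm (g t))\<^sup>2)"
        by (simp add: power2_sum)
    qed
  qed
  then show ?thesis by (simp add: L2_def plus_fun_def)
qed

lemma L2_scale:
  fixes f :: "real \<Rightarrow> 'b::{real_normed_vector, second_countable_topology}"
  assumes f: "f \<in> L2 T"
  shows "c *\<^sub>R f \<in> L2 T"
proof (rule L2_boundedI[OF f, where c = "\<bar>c\<bar>"])
  show "c *\<^sub>R f \<in> borel_measurable (timeM T)"
    using L2_measurable[OF f] unfolding scaleR_fun_def by measurable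
qed simp

lemma subspace_L2: "subspace (L2 T :: (real \<Rightarrow> 'b::{real_normed_vector, second_countable_topology}) set)"
  by (intro subspaceI L2_add L2_scale) (auto simp: L2_def zero_fun_def)

lemmas L2_diff = subspace_diff[OF subspace_L2]

lemma L2_norm: 
  fixes f :: "real \<Rightarrow> 'b::{real_normed_vector, second_countable_topology}"
  assumes f: "f \<in> L2 T" shows "(\<lambda>t. norm (f t)) \<in> L2 T"
  by (rule L2_boundedI[OF f, where c = 1]) (use L2_measurable[OF f] in auto)

lemma L2_const: "(\<lambda>t. c) \<in> L2 T"
  using finite_measure.integrable_const[OF finite_measure_timeM] by (auto simp: L2_def)

lemma L2_bounded_linear:
  fixes L :: "'b::{real_normed_vector, second_countable_topology} \<Rightarrow> 'c::{real_normed_vector, second_countable_topology}"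
  assumes L: "bounded_linear L" and f: "f \<in> L2 T" shows "(\<lambda>t. L (f t)) \<in> L2 T"
proof -
  obtain K where K: "\<And>x. norm (L x) \<le> norm x * K" using L bounded_linear.bounded by blast
  have "(\<lambda>t. L (f t)) \<in> borel_measurable (timeM T)"
    using L2_measurable[OF f] borel_measurable_continuous_onI[OF linear_continuous_on[OF L]]
    by measurable
  then show ?thesis using K by (intro L2_boundedI[OF f, where c = K]) (auto simp: mult.commute)
qed

definition L2ip :: "real \<Rightarrow> (real \<Rightarrow> 'b::real_inner) \<Rightarrow> (real \<Rightarrow> 'b) \<Rightarrow> real" where
  "L2ip T f g = (\<integral>t. f t \<bullet> g t \<partial>timeM T)"

lemma L2_inner_integrable:
  fixes f g :: "real \<Rightarrow> 'b::{real_inner, second_countable_topology}"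
  assumes f: "f \<in> L2 T" and g: "g \<in> L2 T"
  shows "integrable (timeM T) (\<lambda>t. f t \<bullet> g t)"
proof (rule Bochner_Integration.integrable_bound[OF L2_norm_mult_integrable[OF f g]])
  note [measurable] = L2_measurable[OF f] L2_measurable[OF g]
  show "(\<lambda>t. f t \<bullet> g t) \<in> borel_measurable (timeM T)" by measurable
qed (simp add: Cauchy_Schwarz_ineq2)

lemma semi_inner_L2:
  "semi_inner (L2 T :: (real \<Rightarrow> 'b::{real_inner, second_countable_topology}) set) (L2ip T)"
proof
  fix x y z :: "real \<Rightarrow> 'b" and c :: real
  assume "x \<in> L2 T" "y \<in> L2 T"
  note xy = this
  show "z \<in> L2 T \<Longrightarrow> L2ip T (x + y) z = L2ip T x z + L2ip T y z"
    using L2_inner_integrable[of x T z] L2_inner_integrable[of y T z] xy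
    by (simp add: L2ip_def inner_add_left)
  show "L2ip T (c *\<^sub>R x) y = c * L2ip T x y" by (simp add: L2ip_def)
  show "L2ip T x y = L2ip T y x" by (simp add: L2ip_def inner_commute)
  show "0 \<le> L2ip T x x" by (simp add: L2ip_def)
qed (rule subspace_L2)

interpretation L2: semi_inner "L2 T :: (real \<Rightarrow> 'b::{real_inner, second_countable_topology}) set" "L2ip T" for T
  by (rule semi_inner_L2)

lemma L2_N_sq: "(L2.N T f)\<^sup>2 = (\<integral>t. (norm (f t))\<^sup>2 \<partial>timeM T)"
  by (simp add: L2.N_def L2ip_def dot_square_norm)

lemma L2_integral_norm_mult_le:
  fixes f :: "real \<Rightarrow> 'b::{real_inner, second_countable_topology}"
    and g :: "real \<Rightarrow> 'c::{real_inner, second_countable_topology}"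
  assumes f: "f \<in> L2 T" and g: "g \<in> L2 T"
  shows "(\<integral>t. norm (f t) * norm (g t) \<partial>timeM T) \<le> L2.N T f * L2.N T g"
proof -
  have "L2ip T (\<lambda>t. norm (f t)) (\<lambda>t. norm (g t)) \<le> L2.N T f * L2.N T g"
    using L2.Cauchy_Schwarz[OF L2_norm[OF f] L2_norm[OF g]]
    by (simp add: L2.N_def L2ip_def dot_square_norm power2_eq_square)
  then show ?thesis by (simp add: L2ip_def)
qed

lemma L2_integrable:
  fixes f :: "real \<Rightarrow> 'b::{banach, second_countable_topology}"
  assumes f: "f \<in> L2 T" shows "integrable (timeM T) f"
  using L2_norm_mult_integrable[OF f L2_const[of "1::real"]] L2_measurable[OF f]
  by (simp add: integrable_norm_iff)

text \<open>Riesz-Fischer: a Cauchy sequence in L2 is Cauchy in L1 because the measure is finite, so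
  a subsequence converges almost everywhere. Fatou's lemma along it shows that the pointwise limit
  is also the L2 limit.\<close>

theorem L2_complete:
  "semi_inner.seq_complete (L2 T :: (real \<Rightarrow> 'b::{real_inner, banach, second_countable_topology}) set) (L2ip T)"
  unfolding L2.seq_complete_def
proof (intro allI impI)
  fix f :: "nat \<Rightarrow> real \<Rightarrow> 'b"
  assume "\<forall>n. f n \<in> L2 T" and cau: "\<forall>e>0. \<exists>n0. \<forall>m\<ge>n0. \<forall>n\<ge>n0. L2.N T (f m - f n) < e"
  then have f: "f n \<in> L2 T" for n by auto
  note [measurable] = L2_measurable[OF f]
  let ?M = "timeM T"
  have fd: "f m - f n \<in> L2 T" for m n using f L2_diff by blast
  \<comment> \<open>Cauchy-Schwarz against the constant 1; k exceeds the norm of that constant by 1,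
    so that it may be divided by.\<close>
  have "\<exists>n0. \<forall>m\<ge>n0. \<forall>n\<ge>n0. (LINT x|?M. norm (f m x - f n x)) < e" if "e > 0" for e
  proof -
    define k where "k = L2.N T (\<lambda>_. 1::real) + 1"
    have k: "k > 0" "L2.N T (\<lambda>_. 1::real) \<le> k" using L2.N_nonneg[OF L2_const[of "1::real" T]] by (auto simp: k_def add_nonneg_pos)
    obtain n0 where n0: "\<forall>m\<ge>n0. \<forall>n\<ge>n0. L2.N T (f m - f n) < e / k"
      using cau \<open>e > 0\<close> k by (meson divide_pos_pos)
    have "(LINT x|?M. norm (f m x - f n x)) < e" if "m \<ge> n0" "n \<ge> n0" for m n
    proof -
      have "(LINT x|?M. norm (f m x - f n x)) \<le> L2.N T (f m - f n) * L2.N T (\<lambda>_. 1::real)"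
        using L2_integral_norm_mult_le[OF fd L2_const, of m n "1::real"] by simp
      also have "\<dots> \<le> L2.N T (f m - f n) * k" using fd k by (intro mult_left_mono) auto
      also have "\<dots> < e" using n0 that k by (simp add: pos_less_divide_eq)
      finally show ?thesis .
    qed
    then show ?thesis by blast
  qed
  then obtain r where r: "strict_mono r" "AE x in ?M. Cauchy (\<lambda>i. f (r i) x)"
    using cauchy_L1_AE_cauchy_subseq[of ?M f] L2_integrable[OF f] by blast
  define g where "g x = lim (\<lambda>i. f (r i) x)" for x
  have [measurable]: "g \<in> borel_measurable ?M" unfolding g_def by measurable
  have lim: "AE x in ?M. (\<lambda>i. f (r i) x) \<longlonglongrightarrow> g x"
    using r(2) by eventually_elim (auto simp: g_def Cauchy_convergent_iff convergent_LIMSEQ_iff)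
  \<comment> \<open>Fatou applied to f n - f (r i) for fixed n as i grows.\<close>
  have key: "f n - g \<in> L2 T \<and> L2.N T (f n - g) \<le> e"
    if e: "e > 0" and n0: "\<forall>m\<ge>n0. \<forall>n\<ge>n0. L2.N T (f m - f n) < e" and n: "n \<ge> n0" for e n0 n
  proof -
    have "(\<integral>\<^sup>+x. ennreal ((norm (f n x - g x))\<^sup>2) \<partial>?M)
        = (\<integral>\<^sup>+x. liminf (\<lambda>i. ennreal ((norm (f n x - f (r i) x))\<^sup>2)) \<partial>?M)"
    proof (rule nn_integral_cong_AE, use lim in eventually_elim)
      case (elim x)
      have "(\<lambda>i. ennreal ((norm (f n x - f (r i) x))\<^sup>2)) \<longlonglongrightarrow> ennreal ((norm (f n x - g x))\<^sup>2)"
        by (intro tendsto_intros elim)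
      then show ?case by (metis lim_imp_Liminf sequentially_bot)
    qed
    also have "\<dots> \<le> liminf (\<lambda>i. \<integral>\<^sup>+x. ennreal ((norm (f n x - f (r i) x))\<^sup>2) \<partial>?M)"
      by (intro nn_integral_liminf) measurable
    also have "\<dots> \<le> liminf (\<lambda>i::nat. ennreal (e\<^sup>2))"
    proof (intro Liminf_mono eventually_sequentiallyI[of n0])
      fix i assume "i \<ge> n0"
      then have "r i \<ge> n0" using r(1) strict_mono_imp_increasing[of r i] by simp
      then have "L2.N T (f n - f (r i)) < e" using n0 n by blast
      then have "(L2.N T (f n - f (r i)))\<^sup>2 \<le> e\<^sup>2" using fd by (intro power_mono) auto
      moreover have "integrable ?M (\<lambda>x. (norm (f n x - f (r i) x))\<^sup>2)"
        using fd[of n "r i"] by (simp add: L2_def)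
      ultimately show "(\<integral>\<^sup>+x. ennreal ((norm (f n x - f (r i) x))\<^sup>2) \<partial>?M) \<le> ennreal (e\<^sup>2)"
        by (subst nn_integral_eq_integral) (auto simp: L2_N_sq intro!: ennreal_leI)
    qed
    also have "\<dots> = ennreal (e\<^sup>2)" by (simp add: Liminf_const)
    finally have le: "(\<integral>\<^sup>+x. ennreal ((norm (f n x - g x))\<^sup>2) \<partial>?M) \<le> ennreal (e\<^sup>2)" .
    have int: "integrable ?M (\<lambda>x. (norm (f n x - g x))\<^sup>2)"
      using le by (intro integrableI_bounded) (auto simp: order_le_less_trans)
    then have mem: "f n - g \<in> L2 T" unfolding L2_def fun_diff_def by auto
    have "ennreal ((L2.N T (f n - g))\<^sup>2) \<le> ennreal (e\<^sup>2)"
      using le int by (subst (asm) nn_integral_eq_integral) (auto simp: L2_N_sq)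
    then have "(L2.N T (f n - g))\<^sup>2 \<le> e\<^sup>2" by (simp add: ennreal_le_iff)
    then show ?thesis using mem e by (auto intro: power2_le_imp_le)
  qed
  have "g \<in> L2 T"
  proof -
    obtain n0 where "\<forall>m\<ge>n0. \<forall>n\<ge>n0. L2.N T (f m - f n) < 1" using cau zero_less_one by blast
    then have "f n0 - g \<in> L2 T" using key[of 1 n0 n0] by simp
    from L2_diff[OF f[of n0] this] show ?thesis by simp
  qed
  moreover have "(\<lambda>n. L2.N T (f n - g)) \<longlonglongrightarrow> 0"
  proof (rule LIMSEQ_I)
    fix e :: real assume e: "e > 0"
    then obtain n0 where n0: "\<forall>m\<ge>n0. \<forall>n\<ge>n0. L2.N T (f m - f n) < e / 2"
      using cau half_gt_zero by blast
    have "norm (L2.N T (f n - g) - 0) < e" if "n \<ge> n0" for n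
      using key[OF half_gt_zero[OF e] n0 that] e L2.N_nonneg[of "f n - g" T] by auto
    then show "\<exists>n0. \<forall>n\<ge>n0. norm (L2.N T (f n - g) - 0) < e" by blast
  qed
  ultimately show "\<exists>x\<in>L2 T. (\<lambda>n. L2.N T (f n - x)) \<longlonglongrightarrow> 0" by blast
qed

text \<open>Lebesgue measure is complete, so values on a null set do not affect measurability. This
  matters because a form is bilinear and bounded only for almost every t.\<close>

lemma borel_measurable_timeM_AE:
  fixes f g :: "real \<Rightarrow> 'b::{second_countable_topology, real_normed_vector}"
  assumes f: "f \<in> borel_measurable (timeM T)" and eq: "AE t in timeM T. f t = g t"
  shows "g \<in> borel_measurable (timeM T)"
proof (rule measurableI)
  fix A :: "'b set" assume A: "A \<in> sets borel"
  let ?M = "timeM T"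
  obtain N where N: "N \<in> null_sets ?M" "{t \<in> space ?M. f t \<noteq> g t} \<subseteq> N"
    using eq by (auto elim!: AE_E simp: null_sets_def)
  have sub: "B \<in> sets ?M" if "B \<subseteq> N" for B
  proof -
    have "N \<in> null_sets lebesgue" "N \<subseteq> {0<..<T}"
      using N(1) null_sets_restrict_space[of "{0<..<T}" lebesgue] by auto
    then have "B \<in> null_sets lebesgue" using that
      by (meson completion.complete2)
    then show ?thesis using that \<open>N \<subseteq> {0<..<T}\<close>
      by (auto simp: sets_restrict_space_iff)
  qed
  have "g -` A \<inter> space ?M = (f -` A \<inter> space ?M - N) \<union> (g -` A \<inter> N \<inter> space ?M)"
    using N(2) by auto
  also have "\<dots> \<in> sets ?M"
    using measurable_sets[OF f A] N(1) sub by (intro sets.Un sets.Diff) auto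
  finally show "g -` A \<inter> space ?M \<in> sets ?M" .
qed simp

section \<open>Time-dependent forms\<close>

locale parabolic =
  fixes T :: real and a :: "real \<Rightarrow> 'v::{real_inner, banach, second_countable_topology} \<Rightarrow> 'v \<Rightarrow> real"
    and K c :: real
  assumes form_measurable_const: "\<And>\<eta> \<zeta>. (\<lambda>t. a t \<eta> \<zeta>) \<in> borel_measurable (timeM T)"
    and K: "0 < K" and c: "0 < c"
    and form: "AE t in timeM T. bilinear (a t) \<and> (\<forall>\<eta> \<zeta>. \<bar>a t \<eta> \<zeta>\<bar> \<le> K * norm \<eta> * norm \<zeta>) \<and>
      (\<forall>\<eta>. a t \<eta> \<eta> \<ge> c * (norm \<eta>)\<^sup>2)"
begin

abbreviation Y :: "(real \<Rightarrow> 'v) set" where "Y \<equiv> L2 T"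

text \<open>Measurability is assumed only for fixed arguments. It passes to simple functions, which
  take finitely many values, and to their pointwise limits since \<open>a t\<close> is continuous
  for almost every t.\<close>

lemma form_measurable:
  assumes w: "w \<in> borel_measurable (timeM T)" and v: "v \<in> borel_measurable (timeM T)"
  shows "(\<lambda>t. a t (w t) (v t)) \<in> borel_measurable (timeM T)"
proof -
  let ?M = "timeM T"
  obtain N where N: "N \<in> null_sets ?M"
    and good: "\<And>t. t \<in> space ?M - N \<Longrightarrow> bilinear (a t) \<and> (\<forall>\<eta> \<zeta>. \<bar>a t \<eta> \<zeta>\<bar> \<le> K * norm \<eta> * norm \<zeta>)"
    using form by (elim AE_E3) blast
  obtain W where W: "\<And>i. simple_function ?M (W i)" "\<And>t. t \<in> space ?M \<Longrightarrow> (\<lambda>i. W i t) \<longlonglongrightarrow> w t"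
    using borel_measurable_implies_sequence_metric[OF w, of 0] by blast
  obtain V where V: "\<And>i. simple_function ?M (V i)" "\<And>t. t \<in> space ?M \<Longrightarrow> (\<lambda>i. V i t) \<longlonglongrightarrow> v t"
    using borel_measurable_implies_sequence_metric[OF v, of 0] by blast
  \<comment> \<open>On the exceptional set nothing is known about \<open>a t\<close>, and the limit
    would be unjustified there; both \<open>h\<close> and \<open>h'\<close> are cut off to
    0.\<close>
  define h where "h i t = (if t \<in> N then 0 else a t (W i t) (V i t))" for i t
  define h' where "h' t = (if t \<in> N then 0 else a t (w t) (v t))" for t
  have [measurable]: "N \<in> sets ?M" using N by auto
  have [measurable]: "(\<lambda>t. a t (W i t) (V i t)) \<in> borel_measurable ?M" for i
  proof -
    have "simple_function ?M (\<lambda>t. (W i t, V i t))" using W V by (intro simple_function_Pair)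
    then have "(\<lambda>t. (W i t, V i t)) \<in> measurable ?M (count_space ((\<lambda>t. (W i t, V i t)) ` space ?M))"
      and cnt: "countable ((\<lambda>t. (W i t, V i t)) ` space ?M)"
      by (auto simp: measurable_simple_function simple_function_def countable_finite
          intro!: measurable_count_space_eq_countable[THEN iffD2])
    from measurable_compose_countable'[OF _ this, of "\<lambda>p t. a t (fst p) (snd p)" borel]
    show ?thesis using form_measurable_const by simp
  qed
  have "h i \<in> borel_measurable ?M" for i unfolding h_def by measurable
  moreover have "(\<lambda>i. h i t) \<longlonglongrightarrow> h' t" if t: "t \<in> space ?M" for t
  proof (cases "t \<in> N")
    case False
    then have "bounded_bilinear (a t)"
      using good t unfolding bilinear_conv_bounded_bilinear[symmetric] 
      by (auto simp: bounded_bilinear_def bilinear_def linear_iff mult.assoc mult.commute[of K]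
          intro!: exI[of _ K])
    from bounded_bilinear.tendsto[OF this W(2)[OF t] V(2)[OF t]]
    show ?thesis using False by (simp add: h_def h'_def)
  qed (simp add: h_def h'_def)
  ultimately have "h' \<in> borel_measurable ?M" by (rule borel_measurable_LIMSEQ_metric)
  moreover have "AE t in ?M. h' t = a t (w t) (v t)"
    using AE_not_in[OF N] by eventually_elim (simp add: h'_def)
  ultimately show ?thesis by (rule borel_measurable_timeM_AE)
qed

lemma form_integrable:
  assumes w: "w \<in> Y" and v: "v \<in> Y"
  shows "integrable (timeM T) (\<lambda>t. a t (w t) (v t))"
proof (rule Bochner_Integration.integrable_bound)
  show "integrable (timeM T) (\<lambda>t. K * (norm (w t) * norm (v t)))"
    using L2_norm_mult_integrable[OF w v] by simp
  show "AE t in timeM T. norm (a t (w t) (v t)) \<le> norm (K * (norm (w t) * norm (v t)))"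
    using form by eventually_elim (use K in \<open>auto simp: mult.assoc\<close>)
qed (intro form_measurable L2_measurable w v)

lemma form_borel:
  "w \<in> Y \<Longrightarrow> v \<in> Y \<Longrightarrow> (\<lambda>t. a t (w t) (v t)) \<in> borel_measurable (timeM T)"
  by (intro form_measurable L2_measurable)

lemma opA_add_left:
  assumes "w \<in> Y" "w' \<in> Y" "v \<in> Y"
  shows "opA T a (w + w') v = opA T a w v + opA T a w' v"
proof -
  have "opA T a (w + w') v = (\<integral>t. a t (w t) (v t) + a t (w' t) (v t) \<partial>timeM T)"
    unfolding opA_def
  proof (rule integral_cong_AE)
    show "AE t in timeM T. a t ((w + w') t) (v t) = a t (w t) (v t) + a t (w' t) (v t)"
      using form by eventually_elim (simp add: bilinear_ladd)
  qed (use assms form_borel[of "w + w'" v] form_borel[of w v] form_borel[of w' v] L2_add[of w T w'] in auto)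
  then show ?thesis using form_integrable assms by (simp add: opA_def)
qed

lemma opA_scale_left:
  assumes "w \<in> Y" "v \<in> Y"
  shows "opA T a (r *\<^sub>R w) v = r * opA T a w v"
proof -
  have "opA T a (r *\<^sub>R w) v = (\<integral>t. r * a t (w t) (v t) \<partial>timeM T)"
    unfolding opA_def
  proof (rule integral_cong_AE)
    show "AE t in timeM T. a t ((r *\<^sub>R w) t) (v t) = r * a t (w t) (v t)"
      using form by eventually_elim (simp add: bilinear_lmul)
  qed (use assms form_borel[of "r *\<^sub>R w" v] form_borel[of w v] L2_scale[of w T r] in auto)
  then show ?thesis by (simp add: opA_def)
qed

text \<open>The assumptions are symmetric in the two arguments, so statements about the right
  argument follow from those about the left one.\<close>

lemma transposed: "parabolic T (\<lambda>t x y. a t y x) K c"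
proof
  show "AE t in timeM T. bilinear (\<lambda>x y. a t y x) \<and> (\<forall>\<eta> \<zeta>. \<bar>a t \<zeta> \<eta>\<bar> \<le> K * norm \<eta> * norm \<zeta>) \<and>
      (\<forall>\<eta>. a t \<eta> \<eta> \<ge> c * (norm \<eta>)\<^sup>2)"
    using form
  proof eventually_elim
    case (elim t)
    then have "\<bar>a t \<zeta> \<eta>\<bar> \<le> K * norm \<eta> * norm \<zeta>" for \<eta> \<zeta>
      by (metis mult.assoc mult.commute)
    then show ?case using elim by (simp add: bilinear_def)
  qed
qed (use K c form_measurable_const in auto)

lemma opA_add_right:
  "\<lbrakk>w \<in> Y; v \<in> Y; v' \<in> Y\<rbrakk> \<Longrightarrow> opA T a w (v + v') = opA T a w v + opA T a w v'"
  using parabolic.opA_add_left[OF transposed, of v v' w] by (simp add: opA_def)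

lemma opA_scale_right:
  "\<lbrakk>w \<in> Y; v \<in> Y\<rbrakk> \<Longrightarrow> opA T a w (r *\<^sub>R v) = r * opA T a w v"
  using parabolic.opA_scale_left[OF transposed, of v w r] by (simp add: opA_def)

lemmas opA_bil = opA_add_left opA_scale_left opA_add_right opA_scale_right

lemma opA_bound:
  assumes w: "w \<in> Y" and v: "v \<in> Y"
  shows "\<bar>opA T a w v\<bar> \<le> K * (L2.N T w * L2.N T v)"
proof -
  have "\<bar>opA T a w v\<bar> \<le> (\<integral>t. norm (a t (w t) (v t)) \<partial>timeM T)"
    using integral_norm_bound[of "timeM T" "\<lambda>t. a t (w t) (v t)"] by (simp add: opA_def)
  also have "\<dots> \<le> (\<integral>t. K * (norm (w t) * norm (v t)) \<partial>timeM T)"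
  proof (rule integral_mono_AE)
    show "AE t in timeM T. norm (a t (w t) (v t)) \<le> K * (norm (w t) * norm (v t))"
      using form by eventually_elim (auto simp: mult.assoc)
  qed (use form_integrable[OF w v] L2_norm_mult_integrable[OF w v] in auto)
  also have "\<dots> \<le> K * (L2.N T w * L2.N T v)"
    using K L2_integral_norm_mult_le[OF w v] by simp
  finally show ?thesis .
qed

lemma opA_coercive:
  assumes v: "v \<in> Y" shows "c * (L2.N T v)\<^sup>2 \<le> opA T a v v"
proof -
  have "(\<integral>t. c * (norm (v t))\<^sup>2 \<partial>timeM T) \<le> opA T a v v"
    unfolding opA_def
  proof (rule integral_mono_AE)
    show "AE t in timeM T. c * (norm (v t))\<^sup>2 \<le> a t (v t) (v t)"
      using form by eventually_elim auto
  qed (use form_integrable[OF v v] v in \<open>auto simp: L2_def\<close>)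
  then show ?thesis by (simp add: L2_N_sq)
qed

sublocale As: semi_inner Y "opAs T a"
proof
  fix w v :: "real \<Rightarrow> 'v" and r :: real
  assume wv: "w \<in> Y" "v \<in> Y"
  show "opAs T a (r *\<^sub>R w) v = r * opAs T a w v"
    using wv by (simp add: opAs_def opA_adj_def opA_bil algebra_simps)
  show "opAs T a w v = opAs T a v w" by (simp add: opAs_def opA_adj_def)
  have "0 \<le> c * (L2.N T w)\<^sup>2" using c by simp
  then show "0 \<le> opAs T a w w" using opA_coercive[OF wv(1)] by (simp add: opAs_def opA_adj_def)
next
  fix w w' v :: "real \<Rightarrow> 'v"
  assume "w \<in> Y" "w' \<in> Y" "v \<in> Y"
  then show "opAs T a (w + w') v = opAs T a w v + opAs T a w' v"
    by (simp add: opAs_def opA_adj_def opA_bil field_simps)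
qed (rule subspace_L2)

lemma normY_eq: "normY T a = As.N" by (simp add: fun_eq_iff normY_def As.N_def)

lemma As_le: "v \<in> Y \<Longrightarrow> As.N v \<le> sqrt K * L2.N T v"
  using opA_bound[of v v] real_sqrt_le_mono[of "opA T a v v" "K * (L2.N T v)\<^sup>2"]
  by (simp add: As.N_def opAs_def opA_adj_def real_sqrt_mult power2_eq_square)

lemma As_ge: "v \<in> Y \<Longrightarrow> sqrt c * L2.N T v \<le> As.N v"
  using real_sqrt_le_mono[OF opA_coercive[of v]]
  by (simp add: As.N_def opAs_def opA_adj_def real_sqrt_mult)

lemma L2_le_As: "v \<in> Y \<Longrightarrow> L2.N T v \<le> As.N v / sqrt c"
  using As_ge[of v] c by (simp add: field_simps)

lemma As_complete: "As.seq_complete"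
  unfolding As.seq_complete_def
proof (intro allI impI)
  fix f :: "nat \<Rightarrow> real \<Rightarrow> 'v"
  assume f: "\<forall>n. f n \<in> Y" and cau: "\<forall>e>0. \<exists>n0. \<forall>m\<ge>n0. \<forall>n\<ge>n0. As.N (f m - f n) < e"
  have "L2.N T (f m - f n) \<le> 1 / sqrt c * As.N (f m - f n)" for m n
    using L2_le_As[OF L2_diff[of "f m" T "f n"]] f by simp
  from Cauchy_dominated[OF cau this] c
  have "\<forall>e>0. \<exists>n0. \<forall>m\<ge>n0. \<forall>n\<ge>n0. L2.N T (f m - f n) < e" by simp
  then obtain x where x: "x \<in> Y" "(\<lambda>n. L2.N T (f n - x)) \<longlonglongrightarrow> 0"
    using L2_complete[of T] f unfolding L2.seq_complete_def by blast
  have fx: "f n - x \<in> Y" for n using f x L2_diff by blast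
  have "(\<lambda>n. As.N (f n - x)) \<longlonglongrightarrow> 0"
    by (rule tendsto_0_dominated[OF x(2) As.N_nonneg[OF fx] As_le[OF fx]])
  then show "\<exists>x\<in>Y. (\<lambda>n. As.N (f n - x)) \<longlonglongrightarrow> 0" using x by blast
qed

section \<open>Discrete subspaces, Riesz lifts and dual norms\<close>

lemma closed_subspace:
  assumes "closed_nonzero_subspace T N Z S"
  shows "subspace S" "S \<subseteq> Z"
    "\<And>f x. \<lbrakk>\<And>n::nat. f n \<in> S; x \<in> Z; (\<lambda>n. N (f n - x)) \<longlonglongrightarrow> 0\<rbrakk> \<Longrightarrow> x \<in> S"
    "\<exists>f\<in>S. \<not> (AE t in timeM T. f t = 0)"
proof -
  note cl = assms[unfolded closed_nonzero_subspace_def]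
  show "subspace S" "S \<subseteq> Z" "\<exists>f\<in>S. \<not> (AE t in timeM T. f t = 0)"
    using cl by (simp_all add: subspace_def plus_fun_def scaleR_fun_def zero_fun_def)
  show "x \<in> S" if "\<And>n::nat. f n \<in> S" "x \<in> Z" "(\<lambda>n. N (f n - x)) \<longlonglongrightarrow> 0" for f x
    using cl that unfolding fun_diff_def by blast
qed

lemma Ys_complete:
  assumes "closed_nonzero_subspace T (normY T a) (spaceY T) S"
  shows "semi_inner S (opAs T a)" "semi_inner.seq_complete S (opAs T a)"
proof -
  note cl = closed_subspace[OF assms, unfolded spaceY_def normY_eq]
  show "semi_inner S (opAs T a)" by (rule semi_inner_subset[OF As.semi_inner_axioms cl(1,2)])
  show "semi_inner.seq_complete S (opAs T a)"
    by (rule As.seq_complete_subset[OF As_complete cl(2,3,1)])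
qed

lemma riesz_lift:
  assumes S: "semi_inner S (opAs T a)" "semi_inner.seq_complete S (opAs T a)"
    and f: "semi_inner.bounded_functional S (opAs T a) f"
  shows "riesz_lift T a S f \<in> S" "\<And>v. v \<in> S \<Longrightarrow> opAs T a (riesz_lift T a S f) v = f v"
proof -
  have "\<exists>y. y \<in> S \<and> (\<forall>v\<in>S. opAs T a y v = f v)"
    using semi_inner.Riesz[OF S f] by blast
  then have "riesz_lift T a S f \<in> S \<and> (\<forall>v\<in>S. opAs T a (riesz_lift T a S f) v = f v)"
    unfolding riesz_lift_def by (rule someI_ex)
  then show "riesz_lift T a S f \<in> S" "\<And>v. v \<in> S \<Longrightarrow> opAs T a (riesz_lift T a S f) v = f v"
    by auto
qed

text \<open>The supremum is attained at the normalised Riesz representer, or at 0 if the representer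
  has length zero. Replacing dual norms by norms of lifts makes them accessible to the bilinear
  calculus.\<close>

lemma dual_norm_eq:
  assumes S: "semi_inner S (opAs T a)" "semi_inner.seq_complete S (opAs T a)"
    and f: "semi_inner.bounded_functional S (opAs T a) f"
  shows "dual_norm T a S f = As.N (riesz_lift T a S f)"
proof -
  interpret S: semi_inner S "opAs T a" by fact
  define y where "y = riesz_lift T a S f"
  have y: "y \<in> S" "\<And>v. v \<in> S \<Longrightarrow> opAs T a y v = f v"
    using riesz_lift[OF assms] by (auto simp: y_def)
  let ?B = "{v \<in> S. normY T a v \<le> 1}"
  have le: "\<bar>f v\<bar> \<le> As.N y" if "v \<in> ?B" for v
  proof -
    have "\<bar>f v\<bar> \<le> As.N y * As.N v" using S.Cauchy_Schwarz[of y v] y that by auto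
    also have "\<dots> \<le> As.N y * 1" using that S.N_nonneg[OF y(1)]
      by (intro mult_left_mono) (auto simp: normY_eq)
    finally show ?thesis by simp
  qed
  have "0 \<in> ?B" by (simp add: S.mem normY_eq As.N_scale[of 0 0, simplified] As.mem)
  moreover have "\<exists>v\<in>?B. As.N y \<le> \<bar>f v\<bar>"
  proof (cases "As.N y = 0")
    case True
    then show ?thesis using \<open>0 \<in> ?B\<close> by auto
  next
    case False
    then have pos: "As.N y > 0" using S.N_nonneg[OF y(1)] by simp
    define v where "v = (1 / As.N y) *\<^sub>R y"
    have "v \<in> ?B" using y pos by (simp add: v_def S.mem normY_eq S.N_scale)
    moreover have "f v = As.N y"
      using y(2)[of v] \<open>v \<in> ?B\<close> S.scale_right[OF y(1) y(1), of "1 / As.N y"] S.N_sq[OF y(1), symmetric] pos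
      by (simp add: v_def power2_eq_square)
    ultimately show ?thesis by (intro bexI[of _ v]) auto
  qed
  ultimately obtain v where v: "v \<in> ?B" "As.N y \<le> \<bar>f v\<bar>" and ne: "?B \<noteq> {}" by blast
  have "bdd_above ((\<lambda>v. \<bar>f v\<bar>) ` ?B)" using le by (rule bdd_aboveI2)
  then show ?thesis
    unfolding dual_norm_def y_def[symmetric]
    using v ne le by (intro antisym cSUP_least cSUP_upper2[of _ _ v])
qed

text \<open>A real supremum bounds its members only if the set is bounded above. The crude constant
  K / c ensures this for the operator norm and also settles w of length zero; all other w are
  normalised to reach the sharp constant.\<close>

lemma opAa_bound:
  assumes w: "w \<in> Y" and v: "v \<in> Y"
  shows "\<bar>opAa T a w v\<bar> \<le> op_normY T a (opAa T a) * As.N w * As.N v" "0 \<le> op_normY T a (opAa T a)"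
proof -
  have crude: "\<bar>opAa T a w v\<bar> \<le> K / c * As.N w * As.N v" if w: "w \<in> Y" and v: "v \<in> Y" for w v
  proof -
    have "\<bar>opAa T a w v\<bar> \<le> K * (L2.N T w * L2.N T v)"
      using opA_bound[OF w v] opA_bound[OF v w] unfolding opAa_def opA_adj_def
      by (simp add: mult.commute[of "L2.N T v"])
    also have "\<dots> \<le> K * ((As.N w / sqrt c) * (As.N v / sqrt c))"
      using K c w v by (intro mult_left_mono mult_mono L2_le_As) auto
    also have "\<dots> = K / c * As.N w * As.N v" using c by simp
    finally show ?thesis .
  qed
  have bf: "As.bounded_functional (opAa T a w)" if w: "w \<in> Y" for w
    by (rule As.bounded_functionalI[OF _ _ crude[OF w]])
      (use w in \<open>auto simp: opAa_def opA_adj_def opA_bil field_simps\<close>)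
  have lift: "As.N (riesz_lift T a Y (opAa T a w)) \<le> K / c * As.N w" 
    and lift_bound: "\<And>v. v \<in> Y \<Longrightarrow> \<bar>opAa T a w v\<bar> \<le> As.N (riesz_lift T a Y (opAa T a w)) * As.N v" if w: "w \<in> Y" for w
  proof -
    note r = riesz_lift[OF As.semi_inner_axioms As_complete bf[OF w]]
    let ?r = "riesz_lift T a Y (opAa T a w)"
    have "As.N ?r * As.N ?r \<le> (K / c * As.N w) * As.N ?r"
      using r(2)[OF r(1)] crude[OF w r(1)] As.N_sq[OF r(1)] by (simp add: power2_eq_square)
    then show "As.N ?r \<le> K / c * As.N w"
      using As.N_nonneg[OF r(1)] As.N_nonneg[OF w] K c mult_right_le_imp_le[of "As.N ?r" "As.N ?r"]
      by (cases "As.N ?r = 0") (simp_all del: times_divide_eq_left)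
    show "\<bar>opAa T a w v\<bar> \<le> As.N ?r * As.N v" if "v \<in> Y" for v
      using As.Cauchy_Schwarz[OF r(1) that] r(2)[OF that] by simp
  qed
  let ?d = "\<lambda>w. dual_norm T a (spaceY T) (opAa T a w)" and ?B = "{w \<in> spaceY T. normY T a w \<le> 1}"
  have d: "?d w = As.N (riesz_lift T a Y (opAa T a w))" if "w \<in> Y" for w
    using dual_norm_eq[OF As.semi_inner_axioms As_complete bf[OF that]] by (simp add: spaceY_def)
  have bdd: "bdd_above (?d ` ?B)"
  proof (rule bdd_aboveI2)
    fix w assume "w \<in> ?B"
    then have w: "w \<in> Y" "As.N w \<le> 1" by (auto simp: spaceY_def normY_eq)
    then have "?d w \<le> K / c * As.N w" using lift d by simp
    also have "\<dots> \<le> K / c * 1" using K c w by (intro mult_left_mono) auto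
    finally show "?d w \<le> K / c * 1" .
  qed
  have N0: "As.N 0 = 0" by (simp add: As.N_scale[of 0 0, simplified] As.mem)
  have "0 \<le> ?d 0"
    using d[OF As.mem(4)] riesz_lift(1)[OF As.semi_inner_axioms As_complete bf[OF As.mem(4)]] by simp
  also have "?d 0 \<le> op_normY T a (opAa T a)"
    unfolding op_normY_def using N0 As.mem(4) by (intro cSUP_upper bdd) (auto simp: spaceY_def normY_eq zero_fun_def[symmetric])
  finally show nn: "0 \<le> op_normY T a (opAa T a)" .
  show "\<bar>opAa T a w v\<bar> \<le> op_normY T a (opAa T a) * As.N w * As.N v"
  proof (cases "As.N w = 0")
    case True
    then show ?thesis using crude[OF w v] by simp
  next
    case False
    then have pos: "As.N w > 0" using As.N_nonneg[OF w] by simp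
    define z where "z = (1 / As.N w) *\<^sub>R w"
    have z: "z \<in> Y" "As.N z \<le> 1" using w pos by (auto simp: z_def As.mem As.N_scale)
    have "\<bar>opAa T a w v\<bar> = As.N w * \<bar>opAa T a z v\<bar>"
      using w v pos by (simp add: z_def opAa_def opA_adj_def opA_bil abs_mult flip: right_diff_distrib diff_divide_distrib)
    also have "\<dots> \<le> As.N w * (?d z * As.N v)"
      using lift_bound[OF z(1) v] pos d[OF z(1)] by simp
    also have "\<dots> \<le> As.N w * (op_normY T a (opAa T a) * As.N v)"
      unfolding op_normY_def using z pos v
      by (intro mult_left_mono mult_right_mono cSUP_upper bdd) (auto simp: spaceY_def normY_eq)
    finally show ?thesis by (simp add: algebra_simps)
  qed
qed

end

section \<open>Indefinite integrals and the fundamental lemma\<close>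

lemma borel_measurable_timeM: "f \<in> borel_measurable borel \<Longrightarrow> f \<in> borel_measurable (timeM T)"
  by (intro measurable_restrict_space1 measurable_completion) simp

lemma indicator_integrable:
  fixes r :: "real \<Rightarrow> 'b::{banach, second_countable_topology}"
  assumes r: "integrable (timeM T) r" and A: "A \<in> sets borel"
  shows "integrable (timeM T) (\<lambda>x. indicator A x *\<^sub>R r x)"
proof (rule Bochner_Integration.integrable_bound[OF r])
  have [measurable]: "indicat_real A \<in> borel_measurable (timeM T)"
    using A by (intro borel_measurable_timeM borel_measurable_indicator)
  show "(\<lambda>x. indicator A x *\<^sub>R r x) \<in> borel_measurable (timeM T)"
    using borel_measurable_integrable[OF r] by measurable
qed (auto split: split_indicator)

lemma AE_timeM_neq: "AE x in timeM T. x \<noteq> t"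
proof -
  have "AE x in lebesgue. x \<noteq> t" by (rule AE_completion) (rule AE_lborel_singleton)
  then show ?thesis by (subst AE_restrict_space_iff) auto
qed

text \<open>Integrating an indicator against a fixed measure makes the indefinite integral a total
  function of t, constant on both sides of the time interval.\<close>

definition indef :: "real \<Rightarrow> (real \<Rightarrow> 'b::{banach, second_countable_topology}) \<Rightarrow> real \<Rightarrow> 'b" where
  "indef T r t = (\<integral>x. indicator {..t} x *\<^sub>R r x \<partial>timeM T)"

lemma indef_diff:
  assumes "integrable (timeM T) r" "s \<le> t"
  shows "indef T r t - indef T r s = (\<integral>x. indicator {s<..t} x *\<^sub>R r x \<partial>timeM T)"
proof -
  have "indef T r t - indef T r s = (\<integral>x. indicator {..t} x *\<^sub>R r x - indicator {..s} x *\<^sub>R r x \<partial>timeM T)"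
    unfolding indef_def using assms by (intro Bochner_Integration.integral_diff[symmetric] indicator_integrable) auto
  also have "\<dots> = (\<integral>x. indicator {s<..t} x *\<^sub>R r x \<partial>timeM T)"
    using assms(2) by (intro Bochner_Integration.integral_cong) (auto split: split_indicator)
  finally show ?thesis .
qed

lemma indef_0: "s \<le> 0 \<Longrightarrow> indef T r s = 0"
  unfolding indef_def by (rule integral_eq_zero_AE) (auto split: split_indicator)

lemma indef_T: "T \<le> t \<Longrightarrow> indef T r t = (\<integral>x. r x \<partial>timeM T)"
  unfolding indef_def by (intro Bochner_Integration.integral_cong) (auto split: split_indicator)

lemma indef_norm_le:
  assumes r: "integrable (timeM T) r"
  shows "norm (indef T r t) \<le> (\<integral>x. norm (r x) \<partial>timeM T)"
proof -
  have "norm (indef T r t) \<le> (\<integral>x. norm (indicator {..t} x *\<^sub>R r x) \<partial>timeM T)"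
    unfolding indef_def by (rule integral_norm_bound)
  also have "\<dots> \<le> (\<integral>x. norm (r x) \<partial>timeM T)"
    by (intro integral_mono integrable_norm indicator_integrable r) (auto split: split_indicator)
  finally show ?thesis .
qed

lemma indef_continuous:
  assumes r: "integrable (timeM T) r"
  shows "continuous_on S (indef T r)"
proof -
  have "isCont (indef T r) t" for t
    unfolding continuous_at_sequentially o_def
  proof (intro allI impI)
    fix s :: "nat \<Rightarrow> real" assume s: "s \<longlonglongrightarrow> t"
    show "(\<lambda>n. indef T r (s n)) \<longlonglongrightarrow> indef T r t"
      unfolding indef_def
    proof (rule integral_dominated_convergence[where w = "\<lambda>x. norm (r x)"])
      show "AE x in timeM T. (\<lambda>n. indicator {..s n} x *\<^sub>R r x) \<longlonglongrightarrow> indicator {..t} x *\<^sub>R r x"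
        using AE_timeM_neq[where t = t]
      proof eventually_elim
        case (elim x)
        have "\<forall>\<^sub>F n in sequentially. indicator {..s n} x *\<^sub>R r x = indicator {..t} x *\<^sub>R r x"
        proof (cases "x < t")
          case True
          then show ?thesis using order_tendstoD(1)[OF s True] by (auto elim!: eventually_mono)
        next
          case False
          then have tx: "t < x" using elim by auto
          show ?thesis using tx order_tendstoD(2)[OF s tx] by (auto elim!: eventually_mono)
        qed
        then show ?case by (rule tendsto_eventually)
      qed
    qed (use r indicator_integrable[OF r] borel_measurable_integrable
        in \<open>auto split: split_indicator\<close>)
  qed
  then show ?thesis by (simp add: continuous_at_imp_continuous_on)
qed

lemma indef_inner:
  fixes r :: "real \<Rightarrow> 'v::{real_inner, banach, second_countable_topology}"
  assumes r: "integrable (timeM T) r"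
  shows "indef T (\<lambda>x. r x \<bullet> \<eta>) t = indef T r t \<bullet> \<eta>"
proof -
  have "(\<integral>x. (indicator {..t} x *\<^sub>R r x) \<bullet> \<eta> \<partial>timeM T) = (\<integral>x. indicator {..t} x *\<^sub>R r x \<partial>timeM T) \<bullet> \<eta>"
    by (intro integral_inner_left indicator_integrable r) simp
  then show ?thesis by (simp add: indef_def)
qed

lemma abs_indicator_integral_le:
  fixes z :: "real \<Rightarrow> real"
  assumes z: "integrable (timeM T) z" and A: "A \<in> sets borel"
  shows "\<bar>\<integral>x. indicator A x *\<^sub>R z x \<partial>timeM T\<bar> \<le> (\<integral>x. \<bar>z x\<bar> \<partial>timeM T)"
proof -
  have "\<bar>\<integral>x. indicator A x *\<^sub>R z x \<partial>timeM T\<bar> \<le> (\<integral>x. \<bar>indicator A x *\<^sub>R z x\<bar> \<partial>timeM T)"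
    using integral_norm_bound[of "timeM T" "\<lambda>x. indicator A x *\<^sub>R z x"] by simp
  also have "\<dots> \<le> (\<integral>x. \<bar>z x\<bar> \<partial>timeM T)"
    by (intro integral_mono integrable_abs indicator_integrable z A) (auto split: split_indicator)
  finally show ?thesis .
qed

section \<open>The product rule for indefinite integrals\<close>

text \<open>Increments of D over short steps are at most e times those of \<rho>. Telescoping over a
  fine partition leaves e times the total increment of \<rho>, for every e. It replaces an argument
  by derivatives, which for indefinite integrals exist only almost everywhere.\<close>

lemma constant_of_small_increments:
  fixes D :: "real \<Rightarrow> real"
  assumes st: "s \<le> t"
    and small: "\<And>e. e > 0 \<Longrightarrow> \<exists>\<delta>>0. \<forall>x y. s \<le> x \<longrightarrow> x \<le> y \<longrightarrow> y \<le> t \<longrightarrow> y - x < \<delta> \<longrightarrow>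
      \<bar>D y - D x\<bar> \<le> e * (\<rho> y - \<rho> x)"
  shows "D t = D s"
proof -
  have le: "\<bar>D t - D s\<bar> \<le> e * (\<rho> t - \<rho> s)" if e: "e > 0" for e
  proof -
    obtain \<delta> where \<delta>: "\<delta> > 0" "\<And>x y. s \<le> x \<Longrightarrow> x \<le> y \<Longrightarrow> y \<le> t \<Longrightarrow> y - x < \<delta> \<Longrightarrow>
        \<bar>D y - D x\<bar> \<le> e * (\<rho> y - \<rho> x)" using small[OF e] by blast
    obtain n :: nat where n: "(t - s) / \<delta> < Suc n"
      using reals_Archimedean2 by (metis less_Suc_eq of_nat_less_iff order_less_trans)
    define h where "h = (t - s) / Suc n"
    have h: "0 \<le> h" "h < \<delta>" using st n \<delta> by (auto simp: h_def field_simps)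
    define p where "p i = s + real i * h" for i
    have p: "p 0 = s" "p (Suc n) = t" by (auto simp: p_def h_def)
    have step: "\<bar>D (p (Suc i)) - D (p i)\<bar> \<le> e * (\<rho> (p (Suc i)) - \<rho> (p i))" if "i < Suc n" for i
    proof (rule \<delta>(2))
      have "real (Suc i) * h \<le> real (Suc n) * h" using that h by (intro mult_right_mono) auto
      then show "p (Suc i) \<le> t" using p(2) by (simp add: p_def)
    qed (use h in \<open>auto simp: p_def algebra_simps\<close>)
    have "\<bar>D t - D s\<bar> = \<bar>\<Sum>i<Suc n. D (p (Suc i)) - D (p i)\<bar>"
      unfolding sum_lessThan_telescope[of "\<lambda>i. D (p i)" "Suc n"] p ..
    also have "\<dots> \<le> (\<Sum>i<Suc n. \<bar>D (p (Suc i)) - D (p i)\<bar>)" by (rule sum_abs)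
    also have "\<dots> \<le> (\<Sum>i<Suc n. e * (\<rho> (p (Suc i)) - \<rho> (p i)))"
      using step by (intro sum_mono) auto
    also have "\<dots> = e * (\<rho> t - \<rho> s)"
      unfolding sum_distrib_left[symmetric] sum_lessThan_telescope[of "\<lambda>i. \<rho> (p i)" "Suc n"] p ..
    finally show ?thesis .
  qed
  show ?thesis
  proof (rule ccontr)
    assume ne: "D t \<noteq> D s"
    define k where "k = \<bar>\<rho> t - \<rho> s\<bar> + 1"
    have k: "k > 0" unfolding k_def by linarith
    \<comment> \<open>This e makes the bound at most half of the quantity it bounds.\<close>
    have "\<bar>D t - D s\<bar> \<le> \<bar>D t - D s\<bar> / (2 * k) * (\<rho> t - \<rho> s)" using ne k by (intro le divide_pos_pos) auto
    also have "\<dots> \<le> \<bar>D t - D s\<bar> / (2 * k) * k"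
      by (intro mult_left_mono) (auto simp: k_def)
    also have "\<dots> = \<bar>D t - D s\<bar> / 2" using k by simp
    finally show False using ne by simp
  qed
qed

text \<open>On a short interval the increment of B(F, G) differs from the integral of its formal
  derivative by terms containing oscillations of F and G. Uniform continuity makes these small
  relative to the increment of \<rho>, the integral of norm r + norm q.\<close>

lemma product_rule_indef:
  fixes r :: "real \<Rightarrow> 'a::{banach, second_countable_topology}"
    and q :: "real \<Rightarrow> 'b::{banach, second_countable_topology}" and B :: "'a \<Rightarrow> 'b \<Rightarrow> real"
    and F0 :: 'a and G0 :: 'b
  assumes B: "bounded_bilinear B" and r: "integrable (timeM T) r" and q: "integrable (timeM T) q"
  defines "F \<equiv> \<lambda>t. F0 + indef T r t" and "G \<equiv> \<lambda>t. G0 + indef T q t"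
  shows "integrable (timeM T) (\<lambda>x. B (r x) (G x) + B (F x) (q x))"
    and "s \<le> t \<Longrightarrow> B (F t) (G t) - B (F s) (G s) =
      indef T (\<lambda>x. B (r x) (G x) + B (F x) (q x)) t - indef T (\<lambda>x. B (r x) (G x) + B (F x) (q x)) s"
proof -
  interpret B: bounded_bilinear B by fact
  let ?M = "timeM T"
  obtain K where K: "K > 0" "\<And>x y. \<bar>B x y\<bar> \<le> norm x * norm y * K"
    using B.pos_bounded by (auto simp: real_norm_def)
  have [measurable]: "r \<in> borel_measurable ?M" "q \<in> borel_measurable ?M"
    using r q by auto
  have cF: "continuous_on S F" and cG: "continuous_on S G" for S
    unfolding F_def G_def by (intro continuous_intros indef_continuous r q)+
  have [measurable]: "F \<in> borel_measurable ?M" "G \<in> borel_measurable ?M"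
    by (intro borel_measurable_timeM borel_measurable_continuous_onI cF cG)+
  have Bm: "(\<lambda>x. B (f x) (g x)) \<in> borel_measurable ?M"
    if [measurable]: "f \<in> borel_measurable ?M" "g \<in> borel_measurable ?M" for f g
  proof -
    have "case_prod B \<in> borel_measurable (borel \<Otimes>\<^sub>M borel)"
      unfolding borel_prod by (intro borel_measurable_continuous_onI)
        (simp add: case_prod_beta' B.continuous_on[OF continuous_on_fst continuous_on_snd, OF continuous_on_id continuous_on_id])
    from measurable_compose[OF measurable_Pair[OF that] this] show ?thesis by simp
  qed
  have bF: "norm (F x) \<le> norm F0 + (\<integral>x. norm (r x) \<partial>?M)" for x
    unfolding F_def using indef_norm_le[OF r, of x] norm_triangle_ineq[of F0 "indef T r x"] by linarith
  have bG: "norm (G x) \<le> norm G0 + (\<integral>x. norm (q x) \<partial>?M)" for x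
    unfolding G_def using indef_norm_le[OF q, of x] norm_triangle_ineq[of G0 "indef T q x"] by linarith
  have i1: "integrable ?M (\<lambda>x. B (r x) (g x))"
    if [measurable]: "g \<in> borel_measurable ?M" and bg: "\<And>x. norm (g x) \<le> b" for g b
  proof (rule Bochner_Integration.integrable_bound)
    show "integrable ?M (\<lambda>x. norm (r x) * (b * K))" using r by auto
    show "AE x in ?M. norm (B (r x) (g x)) \<le> norm (norm (r x) * (b * K))"
    proof (rule AE_I2)
      fix x
      have "norm (B (r x) (g x)) \<le> norm (r x) * norm (g x) * K" using K by simp
      also have "\<dots> \<le> norm (r x) * b * K" using K bg by (intro mult_right_mono mult_left_mono) auto
      finally show "norm (B (r x) (g x)) \<le> norm (norm (r x) * (b * K))" by (simp add: mult.assoc)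
    qed
  qed (intro Bm that borel_measurable_integrable r)
  have i2: "integrable ?M (\<lambda>x. B (f x) (q x))"
    if [measurable]: "f \<in> borel_measurable ?M" and bf: "\<And>x. norm (f x) \<le> b" for f b
  proof (rule Bochner_Integration.integrable_bound)
    show "integrable ?M (\<lambda>x. norm (q x) * (b * K))" using q by auto
    show "AE x in ?M. norm (B (f x) (q x)) \<le> norm (norm (q x) * (b * K))"
    proof (rule AE_I2)
      fix x
      have "norm (B (f x) (q x)) \<le> norm (f x) * norm (q x) * K" using K by simp
      also have "\<dots> \<le> b * norm (q x) * K" using K bf by (intro mult_right_mono) auto
      finally show "norm (B (f x) (q x)) \<le> norm (norm (q x) * (b * K))" by (simp add: mult_ac)
    qed
  qed (intro Bm that borel_measurable_integrable q)
  define w where "w x = B (r x) (G x) + B (F x) (q x)" for x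
  have w: "integrable ?M w"
    unfolding w_def by (intro Bochner_Integration.integrable_add i1[OF _ bG] i2[OF _ bF]) measurable
  then show "integrable ?M (\<lambda>x. B (r x) (G x) + B (F x) (q x))" by (simp add: w_def[abs_def])
  define \<rho> where "\<rho> = indef T (\<lambda>x. norm (r x) + norm (q x))"
  have rq: "integrable ?M (\<lambda>x. norm (r x) + norm (q x))" using r q by auto
  define D where "D t = B (F t) (G t) - indef T w t" for t
  have step: "\<bar>D y - D x\<bar> \<le> (e * K) * (\<rho> y - \<rho> x)"
    if xy: "x \<le> y" and eF: "\<And>z. x \<le> z \<Longrightarrow> z \<le> y \<Longrightarrow> norm (F x - F z) \<le> e"
      and eG: "\<And>z. x \<le> z \<Longrightarrow> z \<le> y \<Longrightarrow> norm (G y - G z) \<le> e" for x y e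
  proof -
    let ?I = "\<lambda>z. indicat_real {x<..y} z"
    have iw: "integrable ?M (\<lambda>z. ?I z *\<^sub>R w z)" and ir: "integrable ?M (\<lambda>z. ?I z *\<^sub>R r z)"
      and iq: "integrable ?M (\<lambda>z. ?I z *\<^sub>R q z)" and irq: "integrable ?M (\<lambda>z. ?I z *\<^sub>R (norm (r z) + norm (q z)))"
      by (intro indicator_integrable w r q rq; simp)+
    have ir': "integrable ?M (\<lambda>z. B (?I z *\<^sub>R r z) (G y))"
      by (rule integrable_bounded_linear[OF B.bounded_linear_left ir])
    have iq': "integrable ?M (\<lambda>z. B (F x) (?I z *\<^sub>R q z))"
      by (rule integrable_bounded_linear[OF B.bounded_linear_right iq])
    \<comment> \<open>The discrete product rule evaluates G at the right end and F at the left end;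
      the errors are therefore G y - G z and F x - F z.\<close>
    have "D y - D x = B (F y - F x) (G y) + B (F x) (G y - G x) - (indef T w y - indef T w x)"
      by (simp add: D_def B.diff_left B.diff_right)
    also have "F y - F x = (\<integral>z. ?I z *\<^sub>R r z \<partial>?M)" using indef_diff[OF r xy] by (simp add: F_def)
    also have "G y - G x = (\<integral>z. ?I z *\<^sub>R q z \<partial>?M)" using indef_diff[OF q xy] by (simp add: G_def)
    also have "B (\<integral>z. ?I z *\<^sub>R r z \<partial>?M) (G y) = (\<integral>z. B (?I z *\<^sub>R r z) (G y) \<partial>?M)"
      by (rule integral_bounded_linear[OF B.bounded_linear_left ir, symmetric])
    also have "B (F x) (\<integral>z. ?I z *\<^sub>R q z \<partial>?M) = (\<integral>z. B (F x) (?I z *\<^sub>R q z) \<partial>?M)"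
      by (rule integral_bounded_linear[OF B.bounded_linear_right iq, symmetric])
    also have "indef T w y - indef T w x = (\<integral>z. ?I z *\<^sub>R w z \<partial>?M)" by (rule indef_diff[OF w xy])
    also have "(\<integral>z. B (?I z *\<^sub>R r z) (G y) \<partial>?M) + (\<integral>z. B (F x) (?I z *\<^sub>R q z) \<partial>?M) - (\<integral>z. ?I z *\<^sub>R w z \<partial>?M)
        = (\<integral>z. B (?I z *\<^sub>R r z) (G y) + B (F x) (?I z *\<^sub>R q z) - ?I z *\<^sub>R w z \<partial>?M)"
      using ir' iq' iw by simp
    finally have eq: "D y - D x = (\<integral>z. B (?I z *\<^sub>R r z) (G y) + B (F x) (?I z *\<^sub>R q z) - ?I z *\<^sub>R w z \<partial>?M)" .
    have "\<bar>D y - D x\<bar> \<le> (\<integral>z. norm (B (?I z *\<^sub>R r z) (G y) + B (F x) (?I z *\<^sub>R q z) - ?I z *\<^sub>R w z) \<partial>?M)"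
      unfolding eq real_norm_def[symmetric] by (rule integral_norm_bound)
    also have "\<dots> \<le> (\<integral>z. (e * K) * (?I z *\<^sub>R (norm (r z) + norm (q z))) \<partial>?M)"
    proof (rule integral_mono)
      show "integrable ?M (\<lambda>z. norm (B (?I z *\<^sub>R r z) (G y) + B (F x) (?I z *\<^sub>R q z) - ?I z *\<^sub>R w z))"
        using ir' iq' iw by auto
      show "integrable ?M (\<lambda>z. (e * K) * (?I z *\<^sub>R (norm (r z) + norm (q z))))"
        using irq by (rule integrable_mult_right)
      fix z
      show "norm (B (?I z *\<^sub>R r z) (G y) + B (F x) (?I z *\<^sub>R q z) - ?I z *\<^sub>R w z)
        \<le> (e * K) * (?I z *\<^sub>R (norm (r z) + norm (q z)))"
      proof (cases "z \<in> {x<..y}")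
        case True
        then have "B (?I z *\<^sub>R r z) (G y) + B (F x) (?I z *\<^sub>R q z) - ?I z *\<^sub>R w z
            = B (r z) (G y - G z) + B (F x - F z) (q z)"
          by (simp add: w_def B.diff_left B.diff_right)
        also have "norm \<dots> \<le> norm (B (r z) (G y - G z)) + norm (B (F x - F z) (q z))"
          by (rule norm_triangle_ineq)
        also have "\<dots> \<le> norm (r z) * norm (G y - G z) * K + norm (F x - F z) * norm (q z) * K"
          using K by (intro add_mono) auto
        also have "\<dots> \<le> norm (r z) * e * K + e * norm (q z) * K"
          using K True by (intro add_mono mult_right_mono mult_left_mono eF eG) auto
        finally show ?thesis using True by (simp add: algebra_simps)
      qed (simp add: B.zero_left B.zero_right)
    qed
    also have "\<dots> = (e * K) * (\<rho> y - \<rho> x)"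
      unfolding \<rho>_def indef_diff[OF rq xy] by simp
    finally show ?thesis .
  qed
  show "B (F t) (G t) - B (F s) (G s) =
      indef T (\<lambda>x. B (r x) (G x) + B (F x) (q x)) t - indef T (\<lambda>x. B (r x) (G x) + B (F x) (q x)) s"
    if st: "s \<le> t"
  proof -
    have "D t = D s"
    proof (rule constant_of_small_increments[OF st, where \<rho> = \<rho>])
      fix e :: real assume e: "e > 0"
      have "uniformly_continuous_on {s..t} F" "uniformly_continuous_on {s..t} G"
        by (intro compact_uniformly_continuous cF cG compact_Icc)+
      then obtain \<delta>1 \<delta>2 where \<delta>1: "\<delta>1 > 0" "\<And>x y. x \<in> {s..t} \<Longrightarrow> y \<in> {s..t} \<Longrightarrow> dist y x < \<delta>1 \<Longrightarrow> dist (F y) (F x) < e / K"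
        and \<delta>2: "\<delta>2 > 0" "\<And>x y. x \<in> {s..t} \<Longrightarrow> y \<in> {s..t} \<Longrightarrow> dist y x < \<delta>2 \<Longrightarrow> dist (G y) (G x) < e / K"
        unfolding uniformly_continuous_on_def using divide_pos_pos[OF e K(1)] by metis
      have "\<bar>D y - D x\<bar> \<le> e * (\<rho> y - \<rho> x)" if "s \<le> x" "x \<le> y" "y \<le> t" "y - x < min \<delta>1 \<delta>2" for x y
      proof -
        have "\<bar>D y - D x\<bar> \<le> (e / K * K) * (\<rho> y - \<rho> x)"
        proof (rule step[OF that(2)])
          fix z assume "x \<le> z" "z \<le> y"
          then show "norm (F x - F z) \<le> e / K" "norm (G y - G z) \<le> e / K"
            using that \<delta>1(2)[of z x] \<delta>2(2)[of z y] by (auto simp: dist_norm)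
        qed
        then show ?thesis using K by simp
      qed
      then show "\<exists>\<delta>>0. \<forall>x y. s \<le> x \<longrightarrow> x \<le> y \<longrightarrow> y \<le> t \<longrightarrow> y - x < \<delta> \<longrightarrow> \<bar>D y - D x\<bar> \<le> e * (\<rho> y - \<rho> x)"
        using \<delta>1(1) \<delta>2(1) by (intro exI[of _ "min \<delta>1 \<delta>2"]) auto
    qed
    then show ?thesis by (simp add: D_def w_def[abs_def])
  qed
qed

section \<open>Smooth functions with compact support\<close>

text \<open>The classical smooth function exp (- e / x), divided by powers of x so that the family
  is closed under differentiation up to linear combinations. As e tends to 0 the member with k = 0
  tends to the indicator of the positive half-line.\<close>

definition flat :: "real \<Rightarrow> nat \<Rightarrow> real \<Rightarrow> real" where
  "flat e k x = (if x > 0 then exp (- e / x) / x ^ k else 0)"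

lemma flat_tendsto_0:
  assumes e: "e > 0" shows "(flat e k \<longlongrightarrow> 0) (at 0)"
proof (rule filterlim_split_at)
  show "(flat e k \<longlongrightarrow> 0) (at_left 0)"
    by (rule tendsto_eventually) (auto simp: eventually_at_filter flat_def)
  have lim: "filterlim (\<lambda>x. e / x) at_top (at_right 0)"
    using filterlim_tendsto_pos_mult_at_top[OF tendsto_const e filterlim_inverse_at_top_right]
    by (simp add: divide_inverse)
  \<comment> \<open>In the variable e / x this is a power divided by an exponential at
    infinity.\<close>
  have "((\<lambda>x. (1 / e ^ k) * ((e / x) ^ k / exp (e / x))) \<longlongrightarrow> 0) (at_right 0)"
    by (intro tendsto_mult_right_zero filterlim_compose[OF tendsto_power_div_exp_0 lim])
  then show "(flat e k \<longlongrightarrow> 0) (at_right 0)"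
  proof (rule Lim_transform_eventually)
    show "\<forall>\<^sub>F x in at_right 0. 1 / e ^ k * ((e / x) ^ k / exp (e / x)) = flat e k x"
      using eventually_at_right_less[of "0::real"]
      by eventually_elim (use e in \<open>auto simp: flat_def exp_minus field_simps\<close>)
  qed
qed

lemma flat_deriv:
  assumes e: "e > 0"
  shows "(flat e k has_real_derivative (e * flat e (k + 2) x - k * flat e (k + 1) x)) (at x)"
proof -
  consider "x < 0" | "x = 0" | "x > 0" by linarith
  then show ?thesis
  proof cases
    case 1
    have "((\<lambda>x. 0) has_real_derivative 0) (at x)" by simp
    then have "(flat e k has_real_derivative 0) (at x)"
      by (rule has_field_derivative_transform_within_open[of _ _ _ "{..<0}"]) (use 1 in \<open>auto simp: flat_def\<close>)
    then show ?thesis using 1 by (simp add: flat_def)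
  next
    case 2
    have "((\<lambda>h. (flat e k (0 + h) - flat e k 0) / h) \<longlongrightarrow> 0) (at 0)"
    \<comment> \<open>At 0 the difference quotient of \<open>flat e k\<close> is
      \<open>flat e (k + 1)\<close>.\<close>
    proof (rule Lim_transform_eventually[OF flat_tendsto_0[OF e, of "k + 1"]])
      show "\<forall>\<^sub>F x in at 0. flat e (k + 1) x = (flat e k (0 + x) - flat e k 0) / x"
        by (auto simp: eventually_at_filter flat_def)
    qed
    then show ?thesis using 2 by (simp add: DERIV_def flat_def)
  next
    case 3
    have "((\<lambda>x. exp (- e / x) / x ^ k) has_real_derivative
       (e * (exp (- e / x) / x ^ (k + 2)) - k * (exp (- e / x) / x ^ (k + 1)))) (at x)"
    proof (cases k)
      case 0
      then show ?thesis using 3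
        by (auto intro!: derivative_eq_intros simp: field_simps power2_eq_square)
    next
      case (Suc n)
      then show ?thesis using 3
        by (auto intro!: derivative_eq_intros simp: field_simps power2_eq_square)
          (metis power_minus_mult mult.commute One_nat_def gr0I)
    qed
    then have "(flat e k has_real_derivative
       (e * (exp (- e / x) / x ^ (k + 2)) - k * (exp (- e / x) / x ^ (k + 1)))) (at x)"
      by (rule has_field_derivative_transform_within_open[of _ _ _ "{0<..}"]) (use 3 in \<open>auto simp: flat_def\<close>)
    then show ?thesis using 3 by (simp add: flat_def)
  qed
qed

definition bump :: "real \<Rightarrow> real \<Rightarrow> real \<Rightarrow> nat \<Rightarrow> nat \<Rightarrow> real \<Rightarrow> real" where
  "bump e s t k l x = flat e k (x - s) * flat e l (t - x)"

lemma bump_deriv: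
  assumes e: "e > 0"
  shows "(bump e s t k l has_real_derivative
    (e *\<^sub>R bump e s t (k + 2) l - real k *\<^sub>R bump e s t (k + 1) l
     - e *\<^sub>R bump e s t k (l + 2) + real l *\<^sub>R bump e s t k (l + 1)) x) (at x)"
proof -
  have 1: "((\<lambda>x. flat e k (x - s)) has_real_derivative
      (e * flat e (k + 2) (x - s) - k * flat e (k + 1) (x - s)) * 1) (at x)"
    by (rule DERIV_chain2[OF flat_deriv[OF e]]) (auto intro!: derivative_eq_intros)
  have 2: "((\<lambda>x. flat e l (t - x)) has_real_derivative
      (e * flat e (l + 2) (t - x) - l * flat e (l + 1) (t - x)) * (-1)) (at x)"
    by (rule DERIV_chain2[OF flat_deriv[OF e]]) (auto intro!: derivative_eq_intros)
  show ?thesis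
    unfolding bump_def[abs_def] using DERIV_mult[OF 1 2]
    by (rule back_subst[where P = "\<lambda>d. (_ has_real_derivative d) (at x)"]) (simp add: algebra_simps)
qed

text \<open>A span closed under differentiation, so smoothness follows by induction without formulas
  for higher derivatives; p and q confine all supports.\<close>

definition bumps :: "real \<Rightarrow> real \<Rightarrow> real \<Rightarrow> (real \<Rightarrow> real) set" where
  "bumps e p q = span {bump e s t k l |s t k l. p \<le> s \<and> t \<le> q}"

lemma bumps_base: "p \<le> s \<Longrightarrow> t \<le> q \<Longrightarrow> bump e s t k l \<in> bumps e p q"
  unfolding bumps_def by (rule span_base) blast

lemma bumps_deriv:
  assumes e: "e > 0" and f: "f \<in> bumps e p q"
  shows "\<exists>f'\<in>bumps e p q. \<forall>x. (f has_real_derivative f' x) (at x)"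
  using f unfolding bumps_def
proof (induction rule: span_induct_alt)
  case base
  show ?case by (intro bexI[of _ 0] span_zero) (simp add: zero_fun_def)
next
  case (step c f g)
  then obtain s t k l g' where f: "f = bump e s t k l" and st: "p \<le> s" "t \<le> q"
    and g': "g' \<in> bumps e p q" "\<And>x. (g has_real_derivative g' x) (at x)"
    unfolding bumps_def by blast
  let ?f' = "e *\<^sub>R bump e s t (k + 2) l - real k *\<^sub>R bump e s t (k + 1) l
     - e *\<^sub>R bump e s t k (l + 2) + real l *\<^sub>R bump e s t k (l + 1)"
  have "c *\<^sub>R ?f' + g' \<in> bumps e p q"
    using g'(1) bumps_base[OF st] unfolding bumps_def
    by (intro span_add span_scale span_diff) auto
  moreover have "(c *\<^sub>R f + g has_real_derivative (c *\<^sub>R ?f' + g') x) (at x)" for x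
    using DERIV_add[OF DERIV_cmult[OF bump_deriv[OF e, of s t k l x], of c] g'(2)[of x]]
    by (simp add: f plus_fun_def scaleR_fun_def)
  ultimately show ?case unfolding bumps_def by blast
qed

lemma bumps_support:
  assumes "f \<in> bumps e p q" "x \<le> p \<or> q \<le> x" shows "f x = 0"
  using assms(1) unfolding bumps_def
proof (induction rule: span_induct_alt)
  case (step c f g)
  then show ?case using assms(2) by (auto simp: bump_def flat_def)
qed simp

lemma bumps_smooth:
  assumes e: "e > 0" and f: "f \<in> bumps e p q"
  shows "(deriv ^^ k) f \<in> bumps e p q"
proof (induction k)
  case (Suc k)
  then obtain f' where f': "f' \<in> bumps e p q" "\<And>x. ((deriv ^^ k) f has_real_derivative f' x) (at x)"
    using bumps_deriv[OF e] by blast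
  then have "deriv ((deriv ^^ k) f) = f'" by (auto simp: fun_eq_iff intro: DERIV_imp_deriv)
  then show ?case using f' by simp
qed (use f in simp)

lemma bumps_continuous: "e > 0 \<Longrightarrow> f \<in> bumps e p q \<Longrightarrow> continuous_on S f"
  using bumps_deriv by (meson DERIV_isCont continuous_at_imp_continuous_on)

lemma bumps_antiderivative:
  assumes e: "e > 0" and f: "f \<in> bumps e p q"
  shows "\<exists>F. \<forall>x. (F has_real_derivative f x) (at x)"
proof -
  have "isCont f x" for x using bumps_continuous[OF e f, of UNIV] by (simp add: continuous_on_eq_continuous_at)
  then obtain F where "\<forall>x. -\<infinity> < ereal x \<longrightarrow> ereal x < \<infinity> \<longrightarrow> (F has_vector_derivative f x) (at x)"
    using einterval_antiderivative[of "-\<infinity>" \<infinity> f] by auto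
  then show ?thesis by (auto simp: has_real_derivative_iff_has_vector_derivative)
qed

lemma timeM_integrable_continuous:
  fixes f :: "real \<Rightarrow> real"
  assumes "continuous_on {0..T} f" shows "integrable (timeM T) f"
proof -
  have "integrable (lebesgue_on {0..T}) f"
    using assms by (rule continuous_imp_integrable_real)
  then have "set_integrable lebesgue {0..T} f" by (simp add: integrable_restrict_space set_integrable_def)
  then have "set_integrable lebesgue {0<..<T} f"
    by (rule set_integrable_subset) auto
  then show ?thesis by (simp add: integrable_restrict_space set_integrable_def)
qed

lemma timeM_FTC:
  fixes f F :: "real \<Rightarrow> real"
  assumes T: "0 \<le> T" and F: "\<And>x. (F has_real_derivative f x) (at x)" and f: "continuous_on {0..T} f"
  shows "(\<integral>x. f x \<partial>timeM T) = F T - F 0"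
proof -
  have "(\<integral>x. f x \<partial>timeM T) = integral {0<..<T} f"
    using timeM_integrable_continuous[OF f] by (intro lebesgue_integral_eq_integral) auto
  also have "\<dots> = integral {0..T} f" by (simp add: integral_open_interval_real)
  also have "\<dots> = F T - F 0"
    using F T by (intro integral_unique fundamental_theorem_of_calculus)
      (auto simp: has_real_derivative_iff_has_vector_derivative[symmetric] intro: has_field_derivative_at_within)
  finally show ?thesis .
qed

lemma timeM_indef_FTC:
  fixes f F :: "real \<Rightarrow> real"
  assumes t: "0 \<le> t" "t \<le> T" and F: "\<And>x. (F has_real_derivative f x) (at x)" and f: "continuous_on UNIV f"
  shows "indef T f t = F t - F 0"
proof -
  have "indef T f t = (\<integral>x. f x \<partial>timeM t)"
  proof -
    have "indef T f t = (\<integral>x. indicator {0<..<T} x * (indicator {..t} x * f x) \<partial>lebesgue)"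
      by (simp add: indef_def integral_restrict_space)
    also have "\<dots> = (\<integral>x. indicator {0<..<t} x * f x \<partial>lebesgue)"
    proof (rule integral_cong_AE)
      have fm: "f \<in> borel_measurable lebesgue"
        using borel_measurable_continuous_onI[OF f] by (intro measurable_completion) simp
      have im: "indicat_real A \<in> borel_measurable lebesgue" if "A \<in> sets borel" for A
        using that by (intro borel_measurable_indicator) simp
      show "(\<lambda>x. indicator {0<..<T} x * (indicator {..t} x * f x)) \<in> borel_measurable lebesgue"
        "(\<lambda>x. indicator {0<..<t} x * f x) \<in> borel_measurable lebesgue"
        by (intro borel_measurable_times fm im; simp)+
      have "AE x in lebesgue. x \<noteq> t" by (rule AE_completion) (rule AE_lborel_singleton)
      moreover have "AE x in lebesgue. x \<noteq> T" by (rule AE_completion) (rule AE_lborel_singleton)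
      ultimately show "AE x in lebesgue. indicator {0<..<T} x * (indicator {..t} x * f x) = indicator {0<..<t} x * f x"
        by eventually_elim (use t in \<open>auto split: split_indicator\<close>)
    qed
    also have "\<dots> = (\<integral>x. f x \<partial>timeM t)" by (simp add: integral_restrict_space)
    finally show ?thesis .
  qed
  also have "\<dots> = F t - F 0"
    using t f by (intro timeM_FTC F) (auto intro: continuous_on_subset)
  finally show ?thesis .
qed

section \<open>Vanishing integrals and the fundamental lemma\<close>

text \<open>The positive and negative parts of g, taken as densities, induce finite Borel measures
  that agree on all half-lines and hence coincide; densities of the same finite measure are equal
  almost everywhere.\<close>

lemma AE_eq_0_of_indef_eq_0:
  fixes g :: "real \<Rightarrow> real"
  assumes g: "integrable (timeM T) g" and 0: "\<And>t. indef T g t = 0"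
  shows "AE x in timeM T. g x = 0"
proof -
  let ?M = "timeM T"
  have [measurable]: "g \<in> borel_measurable ?M" using g by auto
  define gp gn where "gp x = max 0 (g x)" and "gn x = max 0 (- g x)" for x
  have [measurable]: "gp \<in> borel_measurable ?M" "gn \<in> borel_measurable ?M"
    unfolding gp_def gn_def by measurable
  have int: "integrable ?M gp" "integrable ?M gn" using g by (auto simp: gp_def[abs_def] gn_def[abs_def])
  have g_eq: "g x = gp x - gn x" for x by (auto simp: gp_def gn_def)
  have idm: "(\<lambda>x. x) \<in> measurable ?M borel" by (intro borel_measurable_timeM) simp
  define P where "P f = distr (density ?M (\<lambda>x. ennreal (f x))) borel (\<lambda>x. x)" for f :: "real \<Rightarrow> real"
  have P: "emeasure (P f) A = ennreal (\<integral>x. indicator A x *\<^sub>R f x \<partial>?M)"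
    if A: "A \<in> sets borel" and f: "integrable ?M f" "\<And>x. 0 \<le> f x" for A f
  proof -
    have Am: "A \<inter> space ?M \<in> sets ?M" using measurable_sets[OF idm A] by (simp add: vimage_def Int_def)
    have "emeasure (P f) A = emeasure (density ?M (\<lambda>x. ennreal (f x))) (A \<inter> space ?M)"
      unfolding P_def using A idm by (subst emeasure_distr) auto
    also have "\<dots> = (\<integral>\<^sup>+x. ennreal (f x) * indicator (A \<inter> space ?M) x \<partial>?M)"
      using f by (intro emeasure_density Am) auto
    also have "\<dots> = (\<integral>\<^sup>+x. ennreal (indicator A x *\<^sub>R f x) \<partial>?M)"
      by (intro nn_integral_cong) (auto split: split_indicator)
    also have "\<dots> = ennreal (\<integral>x. indicator A x *\<^sub>R f x \<partial>?M)"
      using indicator_integrable[OF f(1) A] f(2) by (intro nn_integral_eq_integral) auto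
    finally show ?thesis .
  qed
  have pn: "0 \<le> gp x" "0 \<le> gn x" for x by (auto simp: gp_def gn_def)
  have tail: "(\<integral>x. indicator {t<..} x *\<^sub>R gp x \<partial>?M) = (\<integral>x. indicator {t<..} x *\<^sub>R gn x \<partial>?M)" for t
  proof -
    have "(\<integral>x. indicator {t<..} x *\<^sub>R gp x \<partial>?M) - (\<integral>x. indicator {t<..} x *\<^sub>R gn x \<partial>?M)
      = (\<integral>x. indicator {t<..} x *\<^sub>R gp x - indicator {t<..} x *\<^sub>R gn x \<partial>?M)"
      by (intro Bochner_Integration.integral_diff[symmetric] indicator_integrable int) auto
    also have "\<dots> = (\<integral>x. g x - indicator {..t} x *\<^sub>R g x \<partial>?M)"
      by (intro Bochner_Integration.integral_cong) (auto simp: g_eq split: split_indicator)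
    also have "\<dots> = (\<integral>x. g x \<partial>?M) - indef T g t"
      unfolding indef_def by (intro Bochner_Integration.integral_diff indicator_integrable g) auto
    also have "\<dots> = 0" using 0[of T] 0[of t] indef_T[of T T g] by simp
    finally show ?thesis by simp
  qed
  have "P gp = P gn"
  proof (rule measure_eqI_lessThan)
    show "sets (P gp) = sets borel" "sets (P gn) = sets borel" by (auto simp: P_def)
    show "emeasure (P gp) {x<..} < \<infinity>" for x using P[OF _ int(1) pn(1), of "{x<..}"] by simp
    show "emeasure (P gp) {x<..} = emeasure (P gn) {x<..}" for x
      using P[OF _ int(1) pn(1), of "{x<..}"] P[OF _ int(2) pn(2), of "{x<..}"] tail[of x] by simp
  qed
  then have PA: "ennreal (\<integral>x. indicator A x *\<^sub>R gp x \<partial>?M) = ennreal (\<integral>x. indicator A x *\<^sub>R gn x \<partial>?M)"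
    if "A \<in> sets borel" for A
    using P[OF that int(1) pn(1)] P[OF that int(2) pn(2)] by simp
  interpret finite_measure ?M by (rule finite_measure_timeM)
  have "AE x in ?M. ennreal (gp x) = ennreal (gn x)"
  proof (rule density_unique_finite_measure)
    fix A assume A: "A \<in> sets ?M"
    \<comment> \<open>The measures \<open>P gp\<close> and \<open>P gn\<close> are compared on Borel
      sets only, whereas A is Lebesgue measurable: it is replaced by a Borel set up to a null
      set.\<close>
    then have "A \<in> sets (completion lborel)" by (auto simp: sets_restrict_space_iff)
    then obtain S N N' where S: "A = S \<union> N" "N \<subseteq> N'" "N' \<in> null_sets lborel" "S \<in> sets lborel"
      by (rule sets_completionE)
    have "AE x in lebesgue. x \<notin> N'" using S(3) by (intro AE_completion AE_not_in)
    then have ae: "AE x in ?M. x \<notin> N'" by (subst AE_restrict_space_iff) auto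
    have eq: "(\<integral>\<^sup>+x. ennreal (f x) * indicator A x \<partial>?M) = ennreal (\<integral>x. indicator S x *\<^sub>R f x \<partial>?M)"
      if f: "integrable ?M f" "\<And>x. 0 \<le> f x" for f
    proof -
      have "(\<integral>\<^sup>+x. ennreal (f x) * indicator A x \<partial>?M) = (\<integral>\<^sup>+x. ennreal (indicator S x *\<^sub>R f x) \<partial>?M)"
        by (rule nn_integral_cong_AE, use ae in eventually_elim) (use S in \<open>auto split: split_indicator\<close>)
      also have "\<dots> = ennreal (\<integral>x. indicator S x *\<^sub>R f x \<partial>?M)"
        using indicator_integrable[OF f(1)] f(2) S(4) by (intro nn_integral_eq_integral) auto
      finally show ?thesis .
    qed
    show "(\<integral>\<^sup>+x. ennreal (gp x) * indicator A x \<partial>?M) = (\<integral>\<^sup>+x. ennreal (gn x) * indicator A x \<partial>?M)"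
      using eq[OF int(1) pn(1)] eq[OF int(2) pn(2)] PA[of S] S(4) by simp
  qed auto
  then show ?thesis
    by eventually_elim (use pn g_eq in \<open>auto simp: ennreal_inj\<close>)
qed

lemma bump_exp: "s < x \<Longrightarrow> x < t \<Longrightarrow> bump e s t 0 0 x = exp (- e / (x - s)) * exp (- e / (t - x))"
  by (simp add: bump_def flat_def)

lemma bump_outside: "x \<le> s \<or> t \<le> x \<Longrightarrow> bump e s t k l x = 0"
  by (auto simp: bump_def flat_def)

lemma bump_bounds:
  assumes "e > 0" shows "0 \<le> bump e s t 0 0 x \<and> bump e s t 0 0 x \<le> 1"
proof -
  have "0 \<le> flat e 0 y \<and> flat e 0 y \<le> 1" for y using assms by (simp add: flat_def)
  then show ?thesis unfolding bump_def by (auto intro!: mult_le_one)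
qed

lemma bump_continuous: "e > 0 \<Longrightarrow> continuous_on S (bump e s t k l)"
  by (rule bumps_continuous[OF _ bumps_base[OF order_refl order_refl]])

text \<open>A primitive of f is constant on either side of [p, q], and the zero integral makes both
  constants vanish. So f is the derivative of a test function; strict bounds on p and q keep the
  closed support inside the open interval.\<close>

lemma test_fun_primitive:
  assumes e: "e > 0" and pq: "0 < p" "p < q" "q < T" and f: "f \<in> bumps e p q"
    and int: "(\<integral>x. f x \<partial>timeM T) = 0"
  shows "\<exists>\<phi>. test_fun T \<phi> \<and> deriv \<phi> = f \<and> (\<forall>x. (\<phi> has_real_derivative f x) (at x)) \<and> \<phi> 0 = 0 \<and> \<phi> T = 0"
proof -
  obtain F where F: "\<And>x. (F has_real_derivative f x) (at x)"
    using bumps_antiderivative[OF e f] by blast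
  define \<phi> where "\<phi> x = F x - F 0" for x
  have \<phi>: "(\<phi> has_real_derivative f x) (at x)" for x
    unfolding \<phi>_def using F[of x] by (auto intro!: derivative_eq_intros)
  have deriv: "deriv \<phi> = f" using \<phi> by (auto simp: fun_eq_iff intro: DERIV_imp_deriv)
  have "\<phi> T = 0"
    using timeM_FTC[of T F f] F int pq bumps_continuous[OF e f] by (simp add: \<phi>_def)
  have const: "\<phi> x = \<phi> y" if "x < y" "\<And>z. x < z \<Longrightarrow> z < y \<Longrightarrow> f z = 0" for x y
  proof (rule DERIV_isconst_end[symmetric, OF that(1)])
    show "continuous_on {x..y} \<phi>"
      using \<phi> by (intro continuous_at_imp_continuous_on) (auto intro: DERIV_isCont)
    show "(\<phi> has_real_derivative 0) (at z)" if "x < z" "z < y" for z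
      using \<phi>[of z] \<open>\<And>z. x < z \<Longrightarrow> z < y \<Longrightarrow> f z = 0\<close>[OF that] by simp
  qed
  have left: "\<phi> x = 0" if "x \<le> p" for x
  proof -
    have "\<phi> x = \<phi> p"
      using const[of x p] bumps_support[OF f] that by (cases "x = p") auto
    moreover have "\<phi> 0 = \<phi> p" using const[of 0 p] bumps_support[OF f] pq by auto
    ultimately show ?thesis by (simp add: \<phi>_def)
  qed
  have right: "\<phi> x = 0" if "q \<le> x" for x
  proof -
    have "\<phi> x = \<phi> q"
      using const[of q x] bumps_support[OF f] that by (cases "x = q") auto
    moreover have "\<phi> q = \<phi> T" using const[of q T] bumps_support[OF f] pq by auto
    ultimately show ?thesis using \<open>\<phi> T = 0\<close> by simp
  qed
  have "{x. \<phi> x \<noteq> 0} \<subseteq> {p..q}" using left right by auto (metis nle_le)+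
  then have "closure {x. \<phi> x \<noteq> 0} \<subseteq> {p..q}" by (intro closure_minimal) auto
  then have supp: "closure {x. \<phi> x \<noteq> 0} \<subseteq> {0<..<T}" using pq by auto
  have "((deriv ^^ k) \<phi>) field_differentiable (at t)" for k t
  proof (cases k)
    case 0
    then show ?thesis using \<phi> by (auto simp: field_differentiable_def)
  next
    case (Suc l)
    then have "(deriv ^^ k) \<phi> = (deriv ^^ l) f" by (simp add: funpow_swap1 deriv)
    then show ?thesis
      using bumps_deriv[OF e bumps_smooth[OF e f, of l]] by (auto simp: field_differentiable_def)
  qed
  then have "test_fun T \<phi>" using supp by (simp add: test_fun_def)
  then show ?thesis using \<phi> deriv \<open>\<phi> T = 0\<close> left[of 0] pq by auto
qed

lemma bump_mult_integrable:
  fixes g :: "real \<Rightarrow> real"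
  assumes e: "e > 0" and g: "integrable (timeM T) g"
  shows "integrable (timeM T) (\<lambda>x. bump e s t 0 0 x * g x)"
proof (rule Bochner_Integration.integrable_bound[OF g])
  have "bump e s t 0 0 \<in> borel_measurable (timeM T)"
    by (intro borel_measurable_timeM borel_measurable_continuous_onI bump_continuous e)
  then show "(\<lambda>x. bump e s t 0 0 x * g x) \<in> borel_measurable (timeM T)"
    using borel_measurable_integrable[OF g] by measurable
  show "AE x in timeM T. norm (bump e s t 0 0 x * g x) \<le> norm (g x)"
    using bump_bounds[OF e] by (auto simp: abs_mult intro!: AE_I2 mult_left_le_one_le)
qed

text \<open>The bumps lie between 0 and 1 and tend pointwise to the indicator of the open interval,
  also at its end points, so convergence is dominated by g.\<close>

lemma bump_tendsto_indicator:
  fixes g :: "real \<Rightarrow> real"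
  assumes g: "integrable (timeM T) g"
  shows "(\<lambda>n. \<integral>x. bump (1 / Suc n) s t 0 0 x * g x \<partial>timeM T)
     \<longlonglongrightarrow> (\<integral>x. indicator {s<..<t} x *\<^sub>R g x \<partial>timeM T)"
proof (rule integral_dominated_convergence[where w = "\<lambda>x. norm (g x)"])
  show "AE x in timeM T. (\<lambda>n. bump (1 / Suc n) s t 0 0 x * g x) \<longlonglongrightarrow> indicator {s<..<t} x *\<^sub>R g x"
  proof (rule AE_I2)
    fix x
    have z: "(\<lambda>n. 1 / real (Suc n)) \<longlonglongrightarrow> 0"
      using LIMSEQ_inverse_real_of_nat by (simp add: inverse_eq_divide)
    have "(\<lambda>n. bump (1 / Suc n) s t 0 0 x) \<longlonglongrightarrow> indicator {s<..<t} x"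
    proof (cases "x \<in> {s<..<t}")
      case True
      have "(\<lambda>n. exp (- (1 / Suc n) / (x - s)) * exp (- (1 / Suc n) / (t - x))) \<longlonglongrightarrow>
          exp (- 0 / (x - s)) * exp (- 0 / (t - x))"
        using True by (intro tendsto_intros z) auto
      then show ?thesis using True by (simp add: bump_exp)
    next
      case False
      then show ?thesis by (auto simp: bump_outside not_less)
    qed
    then show "(\<lambda>n. bump (1 / Suc n) s t 0 0 x * g x) \<longlonglongrightarrow> indicator {s<..<t} x *\<^sub>R g x"
      by (simp add: tendsto_mult_right)
  qed
  show "(\<lambda>x. indicator {s<..<t} x *\<^sub>R g x) \<in> borel_measurable (timeM T)"
    by (intro borel_measurable_integrable indicator_integrable g) simp
  show "(\<lambda>x. bump (1 / Suc n) s t 0 0 x * g x) \<in> borel_measurable (timeM T)" for n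
    by (intro borel_measurable_integrable bump_mult_integrable g) simp
  show "AE x in timeM T. norm (bump (1 / Suc n) s t 0 0 x * g x) \<le> norm (g x)" for n
    using bump_bounds[of "1 / Suc n"] by (auto simp: abs_mult intro!: AE_I2 mult_left_le_one_le)
qed (use g in auto)

text \<open>Test functions reach only intervals strictly inside the time interval. There the
  indefinite integral is constant; continuity extends this to the closed interval, and its value at
  0 is 0.\<close>

lemma AE_eq_0_of_intervals:
  fixes g :: "real \<Rightarrow> real"
  assumes T: "T > 0" and g: "integrable (timeM T) g"
    and 0: "\<And>s t. \<lbrakk>0 < s; s < t; t < T\<rbrakk> \<Longrightarrow> (\<integral>x. indicator {s<..<t} x *\<^sub>R g x \<partial>timeM T) = 0"
  shows "AE x in timeM T. g x = 0"
proof (rule AE_eq_0_of_indef_eq_0[OF g])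
  have eq: "indef T g t = indef T g s" if st: "0 < s" "s < t" "t < T" for s t
  proof -
    have "indef T g t - indef T g s = (\<integral>x. indicator {s<..<t} x *\<^sub>R g x \<partial>timeM T)"
      unfolding indef_diff[OF g less_imp_le[OF st(2)]]
    proof (rule integral_cong_AE)
      show "AE x in timeM T. indicator {s<..t} x *\<^sub>R g x = indicator {s<..<t} x *\<^sub>R g x"
        using AE_timeM_neq[where t = t] by eventually_elim (auto split: split_indicator)
    qed (intro borel_measurable_integrable indicator_integrable g; simp)+
    then show ?thesis using 0[OF st] by simp
  qed
  define m where "m = T / 2"
  have m: "0 < m" "m < T" using T by (auto simp: m_def)
  have mid: "indef T g t = indef T g m" if "t \<in> {0<..<T}" for t
    using eq[of t m] eq[of m t] m that by (cases t m rule: linorder_cases) auto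
  have all: "indef T g t = indef T g m" if "t \<in> {0..T}" for t
  proof -
    have "closure {0<..<T} = {0..T}" using T by simp
    then show ?thesis
      using continuous_constant_on_closure[of "{0<..<T}" "indef T g" "indef T g m" t]
        indef_continuous[OF g] mid that by auto
  qed
  have "indef T g m = 0" using all[of 0] indef_0[of 0 T g] T by simp
  then show "indef T g t = 0" for t
    using all[of t] all[of T] indef_0[of t T g] indef_T[of T t g] indef_T[of T T g] T
    by (cases "t < 0"; cases "t \<le> T") auto
qed

text \<open>The difference g of f and the primitive of h is orthogonal to every derivative of a test
  function, in particular to bump combinations with integral zero. Letting the bumps tend to
  indicators shows that g has the same mean over any two intervals.\<close>

theorem du_Bois_Reymond:
  fixes f h :: "real \<Rightarrow> real"
  assumes T: "T > 0" and f: "integrable (timeM T) f" and h: "integrable (timeM T) h"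
    and weak: "\<And>\<phi>. test_fun T \<phi> \<Longrightarrow> (\<integral>t. deriv \<phi> t * f t \<partial>timeM T) = - (\<integral>t. \<phi> t * h t \<partial>timeM T)"
  shows "\<exists>C. AE t in timeM T. f t = C + indef T h t"
proof -
  let ?M = "timeM T"
  define g where "g t = f t - indef T h t" for t
  have ih: "integrable ?M (indef T h)"
    by (intro timeM_integrable_continuous indef_continuous h)
  have g: "integrable ?M g" unfolding g_def using f ih by auto
  have cb: "continuous_on S (bump e s t 0 0)" if "e > 0" for e s t S
    by (rule bump_continuous[OF that])
  have bint: "integrable ?M (bump e s t 0 0)" if "e > 0" for e s t
    by (intro timeM_integrable_continuous cb that)
  have ortho: "(\<integral>x. \<psi> x * g x \<partial>?M) = 0"
    if e: "e > 0" and pq: "0 < p" "p < q" "q < T" and \<psi>: "\<psi> \<in> bumps e p q" and z: "(\<integral>x. \<psi> x \<partial>?M) = 0"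
    for e p q \<psi>
  proof -
    obtain \<phi> where \<phi>: "test_fun T \<phi>" "deriv \<phi> = \<psi>" "\<And>x. (\<phi> has_real_derivative \<psi> x) (at x)" "\<phi> 0 = 0" "\<phi> T = 0"
      using test_fun_primitive[OF e pq \<psi> z] by blast
    have c\<psi>: "continuous_on S \<psi>" for S by (rule bumps_continuous[OF e \<psi>])
    have i\<psi>: "integrable ?M \<psi>" by (intro timeM_integrable_continuous c\<psi>)
    have \<phi>_eq: "indef T \<psi> x = \<phi> x" if "x \<in> {0..T}" for x
      using timeM_indef_FTC[of x T \<phi> \<psi>] \<phi> c\<psi> that by auto
    \<comment> \<open>Integration by parts of \<phi> against the primitive of h; the boundary terms
      vanish because \<phi> does at both ends.\<close>
    note pr = product_rule_indef[OF bounded_bilinear_mult i\<psi> h, where ?F0.0 = 0 and ?G0.0 = 0, simplified]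
    have "(\<integral>x. \<psi> x * indef T h x + indef T \<psi> x * h x \<partial>?M) = indef T \<psi> T * indef T h T - indef T \<psi> 0 * indef T h 0"
      using pr(2)[of 0 T] T by (simp add: indef_T indef_0)
    also have "\<dots> = 0" using \<phi>_eq[of T] T \<phi> indef_0[of 0 T \<psi>] by simp
    finally have sum0: "(\<integral>x. \<psi> x * indef T h x + indef T \<psi> x * h x \<partial>?M) = 0" .
    have i1: "integrable ?M (\<lambda>x. \<psi> x * indef T h x)"
      by (intro timeM_integrable_continuous continuous_intros c\<psi> indef_continuous h)
    have "integrable ?M (\<lambda>x. (\<psi> x * indef T h x + indef T \<psi> x * h x) - \<psi> x * indef T h x)"
      by (intro Bochner_Integration.integrable_diff pr(1) i1)
    then have i2: "integrable ?M (\<lambda>x. indef T \<psi> x * h x)" by simp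
    have "(\<integral>x. \<psi> x * f x \<partial>?M) = - (\<integral>x. \<phi> x * h x \<partial>?M)" using weak[OF \<phi>(1)] \<phi>(2) by simp
    also have "(\<integral>x. \<phi> x * h x \<partial>?M) = (\<integral>x. indef T \<psi> x * h x \<partial>?M)"
      by (intro Bochner_Integration.integral_cong) (auto simp: \<phi>_eq)
    also have "- \<dots> = (\<integral>x. \<psi> x * indef T h x \<partial>?M)"
      using sum0 i1 i2 by simp
    finally have eq: "(\<integral>x. \<psi> x * f x \<partial>?M) = (\<integral>x. \<psi> x * indef T h x \<partial>?M)" .
    have "integrable ?M (\<lambda>x. \<psi> x * f x)"
    proof -
      obtain b where b: "\<And>x. x \<in> {0..T} \<Longrightarrow> norm (\<psi> x) \<le> b"
        using compact_imp_bounded[OF compact_continuous_image[OF c\<psi> compact_Icc, of 0 T]]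
        unfolding bounded_iff by (metis image_eqI)
      show ?thesis
      proof (rule Bochner_Integration.integrable_bound)
        show "integrable ?M (\<lambda>x. b * f x)" using f by simp
        show "(\<lambda>x. \<psi> x * f x) \<in> borel_measurable ?M"
          using borel_measurable_integrable[OF i\<psi>] borel_measurable_integrable[OF f] by measurable
        show "AE x in ?M. norm (\<psi> x * f x) \<le> norm (b * f x)"
        proof (rule AE_I2)
          fix x assume "x \<in> space ?M"
          then have "\<bar>\<psi> x\<bar> \<le> \<bar>b\<bar>" using b[of x] by auto
          then show "norm (\<psi> x * f x) \<le> norm (b * f x)" by (simp add: abs_mult mult_right_mono)
        qed
      qed
    qed
    then show ?thesis using eq i1 by (simp add: g_def right_diff_distrib)
  qed
  have exch: "(\<integral>x. bump e p q 0 0 x \<partial>?M) * (\<integral>x. bump e s t 0 0 x * g x \<partial>?M) =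
      (\<integral>x. bump e s t 0 0 x \<partial>?M) * (\<integral>x. bump e p q 0 0 x * g x \<partial>?M)"
    if e: "e > 0" and st: "0 < s" "s < t" "t < T" and pq: "0 < p" "p < q" "q < T" for e s t p q
  proof -
    define a b where "a = (\<integral>x. bump e p q 0 0 x \<partial>?M)" and "b = (\<integral>x. bump e s t 0 0 x \<partial>?M)"
    \<comment> \<open>Each bump is weighted with the integral of the other, so the combination has
      integral zero.\<close>
    let ?\<psi> = "a *\<^sub>R bump e s t 0 0 - b *\<^sub>R bump e p q 0 0"
    have mem: "?\<psi> \<in> bumps e (min p s) (max q t)"
      unfolding bumps_def by (intro span_diff span_scale bumps_base[unfolded bumps_def]) auto
    have z: "(\<integral>x. ?\<psi> x \<partial>?M) = 0"
      using bint[OF e] by (simp add: a_def b_def)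
    have "0 < min p s" "min p s < max q t" "max q t < T" using pq st by auto
    from ortho[OF e this mem z] have "(\<integral>x. ?\<psi> x * g x \<partial>?M) = 0" .
    then have "(\<integral>x. a * (bump e s t 0 0 x * g x) - b * (bump e p q 0 0 x * g x) \<partial>?M) = 0"
      by (simp add: algebra_simps)
    then show ?thesis using bump_mult_integrable[OF e g] by (simp add: a_def b_def)
  qed
  have one: "integrable ?M (\<lambda>x. 1 :: real)"
    using finite_measure.integrable_const[OF finite_measure_timeM] .
  have len: "(\<integral>x. indicator {s<..<t} x *\<^sub>R (1::real) \<partial>?M) = t - s" if "0 < s" "s < t" "t < T" for s t
  proof -
    have "measure ?M {s<..<t} = measure lebesgue {s<..<t}"
      using that by (intro measure_restrict_space) auto
    moreover have "{s<..<t} \<inter> {0<..<T} = {s<..<t}" using that by auto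
    ultimately show ?thesis using that by simp
  qed
  have swap: "(q - p) * (\<integral>x. indicator {s<..<t} x *\<^sub>R g x \<partial>?M) = (t - s) * (\<integral>x. indicator {p<..<q} x *\<^sub>R g x \<partial>?M)"
    if st: "0 < s" "s < t" "t < T" and pq: "0 < p" "p < q" "q < T" for s t p q
  proof -
    have "(\<lambda>n. (\<integral>x. bump (1 / Suc n) p q 0 0 x * 1 \<partial>?M) * (\<integral>x. bump (1 / Suc n) s t 0 0 x * g x \<partial>?M))
        \<longlonglongrightarrow> (q - p) * (\<integral>x. indicator {s<..<t} x *\<^sub>R g x \<partial>?M)"
      unfolding len[OF pq, symmetric] by (intro tendsto_mult bump_tendsto_indicator one g)
    moreover have "(\<lambda>n. (\<integral>x. bump (1 / Suc n) s t 0 0 x * 1 \<partial>?M) * (\<integral>x. bump (1 / Suc n) p q 0 0 x * g x \<partial>?M))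
        \<longlonglongrightarrow> (t - s) * (\<integral>x. indicator {p<..<q} x *\<^sub>R g x \<partial>?M)"
      unfolding len[OF st, symmetric] by (intro tendsto_mult bump_tendsto_indicator one g)
    moreover have "(\<integral>x. bump (1 / Suc n) p q 0 0 x * 1 \<partial>?M) * (\<integral>x. bump (1 / Suc n) s t 0 0 x * g x \<partial>?M)
        = (\<integral>x. bump (1 / Suc n) s t 0 0 x * 1 \<partial>?M) * (\<integral>x. bump (1 / Suc n) p q 0 0 x * g x \<partial>?M)" for n
      using exch[of "1 / Suc n" s t p q] st pq by simp
    ultimately show ?thesis using LIMSEQ_unique by simp
  qed
  \<comment> \<open>Any fixed interior interval would serve; C is the mean of g over it.\<close>
  define p q where "p = T / 3" and "q = 2 * T / 3"
  have pq: "0 < p" "p < q" "q < T" using T by (auto simp: p_def q_def)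
  define C where "C = (\<integral>x. indicator {p<..<q} x *\<^sub>R g x \<partial>?M) / (q - p)"
  have "AE x in ?M. g x - C = 0"
  proof (rule AE_eq_0_of_intervals[OF T])
    show "integrable ?M (\<lambda>x. g x - C)" 
      by (intro Bochner_Integration.integrable_diff g finite_measure.integrable_const[OF finite_measure_timeM])
    fix s t assume st: "0 < s" "s < t" "t < T"
    have "(\<integral>x. indicator {s<..<t} x *\<^sub>R (g x - C) \<partial>?M) =
        (\<integral>x. indicator {s<..<t} x *\<^sub>R g x - C * (indicator {s<..<t} x *\<^sub>R 1) \<partial>?M)"
      by (simp add: algebra_simps)
    also have "\<dots> = (\<integral>x. indicator {s<..<t} x *\<^sub>R g x \<partial>?M) - C * (t - s)"
      unfolding len[OF st, symmetric]
      by (subst Bochner_Integration.integral_diff[OF indicator_integrable[OF g]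
            integrable_mult_right[OF indicator_integrable[OF one]]]; (subst integral_mult_right_zero)?) auto
    also have "\<dots> = 0" using swap[OF st pq] pq by (simp add: C_def field_simps)
    finally show "(\<integral>x. indicator {s<..<t} x *\<^sub>R (g x - C) \<partial>?M) = 0" .
  qed
  then have "AE t in ?M. f t = C + indef T h t"
    by eventually_elim (simp add: g_def)
  then show ?thesis by blast
qed

section \<open>Weak derivatives and traces\<close>

lemma semi_inner_inner: "semi_inner (UNIV :: 'v::real_inner set) (\<bullet>)"
proof
  show "x \<bullet> y = y \<bullet> x" for x y :: 'v by (rule inner_commute)
qed (auto simp: inner_add_left)

lemma seq_complete_inner:
  "semi_inner.seq_complete (UNIV :: 'v::{real_inner, banach} set) (\<bullet>)"
proof -
  interpret semi_inner "UNIV :: 'v set" "(\<bullet>)"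
    by (rule semi_inner_inner)
  have N: "N x = norm x" for x :: 'v by (simp add: N_def norm_eq_sqrt_inner)
  show ?thesis
    unfolding seq_complete_def N
  proof (intro allI impI)
    fix f :: "nat \<Rightarrow> 'v"
    assume "\<forall>e>0. \<exists>n0. \<forall>m\<ge>n0. \<forall>n\<ge>n0. norm (f m - f n) < e"
    then have "Cauchy f" by (simp add: Cauchy_def dist_norm)
    then obtain x where "f \<longlonglongrightarrow> x" using Cauchy_convergent convergent_def by blast
    then have "(\<lambda>n. norm (f n - x)) \<longlonglongrightarrow> 0" by (simp add: LIM_zero tendsto_norm_zero)
    then show "\<exists>x\<in>UNIV. (\<lambda>n. norm (f n - x)) \<longlonglongrightarrow> 0" by blast
  qed
qed

text \<open>The Riesz isomorphism from V' to V. Derivatives with values in V' become functions into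
  V, to which the inner product of L2 applies.\<close>

definition rrep :: "('v::real_inner \<Rightarrow>\<^sub>L real) \<Rightarrow> 'v" where
  "rrep z = (SOME x. \<forall>v. x \<bullet> v = blinfun_apply z v)"

lemma inner_rrep: "rrep z \<bullet> v = blinfun_apply z v" for z :: "'v::{real_inner, banach} \<Rightarrow>\<^sub>L real"
proof -
  interpret semi_inner "UNIV :: 'v set" "(\<bullet>)"
    by (rule semi_inner_inner)
  have N: "N x = norm x" for x :: 'v by (simp add: N_def norm_eq_sqrt_inner)
  have "bounded_functional (blinfun_apply z)"
    by (rule bounded_functionalI[where K = "norm z"])
      (auto simp: blinfun.add_right blinfun.scaleR_right N norm_blinfun[of z, simplified real_norm_def])
  then have "\<exists>x. \<forall>v. x \<bullet> v = blinfun_apply z v"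
    using Riesz[OF seq_complete_inner] by auto
  from someI_ex[OF this] show ?thesis unfolding rrep_def by blast
qed

lemma inner_eqI: "(\<And>v. x \<bullet> v = y \<bullet> v) \<Longrightarrow> x = y" for x y :: "'v::real_inner"
  by (metis inner_diff_left inner_eq_zero_iff eq_iff_diff_eq_0)

lemma inner_dense_eq_0:
  fixes x :: "'v::real_inner"
  assumes dense: "\<And>X. open X \<Longrightarrow> X \<noteq> {} \<Longrightarrow> \<exists>d\<in>D. d \<in> X" and zero: "\<And>d. d \<in> D \<Longrightarrow> x \<bullet> d = 0"
  shows "x = 0"
proof (rule ccontr)
  assume "x \<noteq> 0"
  then have "x \<in> {y. x \<bullet> y > 0}" by simp
  moreover have "open {y. x \<bullet> y > 0}" by (intro open_Collect_less continuous_intros)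
  ultimately obtain d where "d \<in> D" "x \<bullet> d > 0" using dense by blast
  then show False using zero by simp
qed

text \<open>The exceptional set may depend on \<eta>; a countable dense set of \<eta> gives a common
  one.\<close>

lemma AE_eq_0_of_inner:
  fixes f :: "real \<Rightarrow> 'v::{real_inner, second_countable_topology}"
  assumes "\<And>\<eta>. AE t in M. f t \<bullet> \<eta> = 0" shows "AE t in M. f t = 0"
proof -
  obtain D :: "'v set" where D: "countable D" "\<And>X. open X \<Longrightarrow> X \<noteq> {} \<Longrightarrow> \<exists>d\<in>D. d \<in> X"
    using countable_dense_setE by blast
  have "AE t in M. \<forall>\<eta>\<in>D. f t \<bullet> \<eta> = 0" using D(1) assms by (simp add: AE_ball_countable)
  then show ?thesis by eventually_elim (blast intro: inner_dense_eq_0[OF D(2)])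
qed

lemma norm_rrep: "norm (rrep z) = norm z" for z :: "'v::{real_inner, banach} \<Rightarrow>\<^sub>L real"
proof (rule antisym)
  have "norm (rrep z) * norm (rrep z) \<le> norm z * norm (rrep z)"
    using inner_rrep[of z "rrep z"] norm_blinfun[of z "rrep z"]
    by (simp add: dot_square_norm power2_eq_square)
  then show "norm (rrep z) \<le> norm z" by (cases "rrep z = 0") auto
  show "norm z \<le> norm (rrep z)"
    using Cauchy_Schwarz_ineq2[of "rrep z"] by (intro norm_blinfun_bound) (auto simp: inner_rrep)
qed

lemma bounded_linear_rrep: "bounded_linear (rrep :: ('v::{real_inner, banach} \<Rightarrow>\<^sub>L real) \<Rightarrow> 'v)"
proof (rule bounded_linear_intro[where K = 1])
  fix x y :: "'v \<Rightarrow>\<^sub>L real" and r :: real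
  show "rrep (x + y) = rrep x + rrep y"
    by (rule inner_eqI) (simp add: inner_rrep inner_add_left blinfun.add_left)
  show "rrep (r *\<^sub>R x) = r *\<^sub>R rrep x"
    by (rule inner_eqI) (simp add: inner_rrep blinfun.scaleR_left)
qed (simp add: norm_rrep)

lemma rrep_blinfun_inner: "rrep (blinfun_inner_left x) = x" for x :: "'v::{real_inner, banach}"
  by (rule inner_eqI) (simp add: inner_rrep inner_commute[of x])

lemma AE_timeM_ex:
  assumes "T > 0" "AE t in timeM T. P t" shows "\<exists>t\<in>{0<..<T}. P t"
proof (rule ccontr)
  assume "\<not> ?thesis"
  then have "AE t in timeM T. False"
    by - (rule AE_mp[OF assms(2)], rule AE_I2, auto)
  then have "AE t in timeM T. t \<notin> space (timeM T)" by eventually_elim simp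
  then have "space (timeM T) \<in> null_sets (timeM T)"
    by (rule AE_iff_null_sets[OF sets.top, THEN iffD2])
  then have "emeasure (timeM T) (space (timeM T)) = 0" by (rule null_setsD1)
  then show False using assms(1) by (simp add: emeasure_restrict_space)
qed

text \<open>Inside the interval the set of disagreement is open and negligible, hence empty;
  continuity adds the end points, where the traces are taken.\<close>

lemma continuous_AE_eq_timeM:
  fixes f g :: "real \<Rightarrow> 'b::real_normed_vector"
  assumes T: "T > 0" and f: "continuous_on {0..T} f" and g: "continuous_on {0..T} g"
    and ae: "AE t in timeM T. f t = g t" and t: "t \<in> {0..T}"
  shows "f t = g t"
proof -
  define A where "A = {0<..<T} \<inter> (\<lambda>t. f t - g t) -` (- {0})"
  have "continuous_on {0<..<T} (\<lambda>t. f t - g t)"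
    by (intro continuous_intros continuous_on_subset[OF f] continuous_on_subset[OF g]) auto
  then have "open A" unfolding A_def by (intro continuous_open_preimage) auto
  have "AE t in lebesgue. t \<in> {0<..<T} \<longrightarrow> f t = g t" using ae by (subst (asm) AE_restrict_space_iff) auto
  then have "AE t in lebesgue. t \<notin> A" by eventually_elim (auto simp: A_def)
  moreover have "A \<in> sets lebesgue" using \<open>open A\<close> by simp
  ultimately have "A \<in> null_sets lebesgue" using AE_iff_null_sets[of A lebesgue] by simp
  then have "A = {}"
    using \<open>open A\<close> open_not_negligible by (auto simp: negligible_iff_null_sets)
  then have zero: "f s - g s = 0" if "s \<in> {0<..<T}" for s using that by (auto simp: A_def)
  have cl: "closure {0<..<T} = {0..T}" using T by simp
  have "continuous_on (closure {0<..<T}) (\<lambda>t. f t - g t)"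
    unfolding cl by (rule continuous_on_diff[OF f g])
  from continuous_constant_on_closure[OF this zero] have "f t - g t = 0" using t cl by blast
  then show ?thesis by simp
qed

section \<open>The embedding operator and its Neumann series\<close>

locale hilbert_embedding =
  fixes j :: "'v::{real_inner, banach, second_countable_topology} \<Rightarrow> 'h::{real_inner, banach, second_countable_topology}"
  assumes bl: "bounded_linear j" and inj: "inj j"
begin

interpretation j: bounded_linear j by (rule bl)

definition S :: "'v \<Rightarrow> 'v" where "S v = rrep (Blinfun (\<lambda>w. j v \<bullet> j w))"

lemma inner_S: "S v \<bullet> w = j v \<bullet> j w"
proof -
  have "bounded_linear (\<lambda>w. j v \<bullet> j w)"
    by (rule bounded_linear_compose[OF bounded_linear_inner_right bl])
  then show ?thesis by (simp add: S_def inner_rrep bounded_linear_Blinfun_apply)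
qed

text \<open>The summand 1 keeps the bound positive, so that it can be divided by.\<close>

definition b where "b = onorm j + 1"

lemma b: "b > 0" "norm (j v) \<le> b * norm v"
proof -
  have "0 \<le> onorm j" by (rule onorm_pos_le[OF bl])
  then show "b > 0" by (simp add: b_def)
  have "norm (j v) \<le> onorm j * norm v" by (rule onorm[OF bl])
  also have "\<dots> \<le> b * norm v" by (simp add: b_def mult_right_mono)
  finally show "norm (j v) \<le> b * norm v" .
qed

lemma S_sym: "S v \<bullet> w = v \<bullet> S w"
  by (metis inner_S inner_commute)

lemma S_linear: "bounded_linear S"
proof (rule bounded_linear_intro[where K = "b * b"])
  fix x y :: 'v and r :: real
  show "S (x + y) = S x + S y"
    by (rule inner_eqI) (simp add: inner_S inner_add_left j.add)
  show "S (r *\<^sub>R x) = r *\<^sub>R S x"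
    by (rule inner_eqI) (simp add: inner_S j.scaleR)
  have "norm (S x) * norm (S x) = j x \<bullet> j (S x)"
    using inner_S[of x "S x"] by (simp add: dot_square_norm power2_eq_square)
  also have "\<dots> \<le> norm (j x) * norm (j (S x))" by (rule norm_cauchy_schwarz)
  also have "\<dots> \<le> (b * norm x) * (b * norm (S x))" using b by (intro mult_mono) auto
  finally have "norm (S x) * norm (S x) \<le> (norm x * (b * b)) * norm (S x)" by (simp add: mult_ac)
  then show "norm (S x) \<le> norm x * (b * b)" using b(1) by (cases "S x = 0") auto
qed

interpretation S: bounded_linear S by (rule S_linear)

text \<open>This scaling puts \<kappa> S, and therefore also \<open>E\<close>, between 0 and the
  identity.\<close>

definition \<kappa> where "\<kappa> = 1 / b\<^sup>2"
definition E where "E v = v - \<kappa> *\<^sub>R S v"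

lemma \<kappa>: "\<kappa> > 0" using b by (simp add: \<kappa>_def)

lemma E_linear: "bounded_linear E"
  unfolding E_def[abs_def]
  by (intro bounded_linear_sub bounded_linear_ident bounded_linear_scaleR_right[THEN bounded_linear_compose] S_linear)

interpretation E: bounded_linear E by (rule E_linear)

lemma E_sym: "E v \<bullet> w = v \<bullet> E w"
  by (simp add: E_def inner_diff_left inner_diff_right S_sym)

lemma E_pos: "0 \<le> E v \<bullet> v"
proof -
  have "\<kappa> * (norm (j v))\<^sup>2 \<le> \<kappa> * (b * norm v)\<^sup>2" using \<kappa> b by (intro mult_left_mono power_mono) auto
  also have "\<dots> = (norm v)\<^sup>2" using b by (simp add: \<kappa>_def power_mult_distrib)
  finally show ?thesis by (simp add: E_def inner_diff_left inner_S dot_square_norm)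
qed

lemma E_le: "E v \<bullet> v \<le> v \<bullet> v"
  using \<kappa> by (simp add: E_def inner_diff_left inner_S)

sublocale EE: semi_inner UNIV "\<lambda>v w. E v \<bullet> w"
proof
  show "E x \<bullet> y = E y \<bullet> x" for x y by (metis E_sym inner_commute)
qed (simp_all add: E.add E.scaleR inner_add_left E_pos)

text \<open>For an operator between 0 and the identity, E^2 \<le> E: Cauchy-Schwarz for the form of
  \<open>E\<close>, applied to v and \<open>E v\<close>.\<close>

lemma E_E_le: "E v \<bullet> E v \<le> E v \<bullet> v"
proof (cases "E v = 0")
  case False
  then have pos: "E v \<bullet> E v > 0" by simp
  have "(E v \<bullet> E v)\<^sup>2 \<le> (EE.N v * EE.N (E v))\<^sup>2"
    using EE.Cauchy_Schwarz[of v "E v"] pos by (intro power_mono) auto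
  also have "\<dots> = (E v \<bullet> v) * (E (E v) \<bullet> E v)" by (simp add: power_mult_distrib EE.N_sq)
  also have "\<dots> \<le> (E v \<bullet> v) * (E v \<bullet> E v)" using E_le[of "E v"] E_pos by (intro mult_left_mono)
  finally show ?thesis using pos by (simp add: power2_eq_square)
qed (simp add: E_pos)

lemma E_norm_le: "norm (E v) \<le> norm v"
  using E_E_le[of v] E_le[of v] by (simp add: norm_le)

lemma Epow_linear: "bounded_linear (E ^^ n)"
proof (induction n)
  case (Suc n)
  then show ?case using bounded_linear_compose[OF E_linear Suc] by (simp add: o_def)
qed (simp add: bounded_linear_ident[unfolded id_def[symmetric]] id_def)

lemma Epow_sym: "(E ^^ n) v \<bullet> w = v \<bullet> (E ^^ n) w"
proof (induction n arbitrary: v w)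
  case (Suc n)
  have "(E ^^ Suc n) v \<bullet> w = (E ^^ n) v \<bullet> E w" by (simp add: E_sym)
  also have "\<dots> = v \<bullet> (E ^^ n) (E w)" by (rule Suc)
  finally show ?case by (simp add: funpow_swap1)
qed simp

lemma Epow_norm_le: "norm ((E ^^ n) v) \<le> norm v"
  by (induction n) (auto intro: order_trans[OF E_norm_le])

text \<open>
  The numbers \<open>\<langle>E\<^sup>k v, v\<rangle>\<close> decrease, so \<open>E\<^sup>n v\<close> is a Cauchy sequence; its limit is a fixed point of
  \<open>E\<close>, that is, an element of the kernel of \<open>S\<close>.
\<close>

lemma Epow_tendsto_0: "(\<lambda>n. (E ^^ n) v) \<longlonglongrightarrow> 0"
proof -
  define q where "q k = (E ^^ k) v \<bullet> v" for k
  have q_add: "q (m + n) = (E ^^ m) v \<bullet> (E ^^ n) v" for m n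
    by (simp add: q_def funpow_add Epow_sym[of m] inner_commute)
  \<comment> \<open>For even k the step is E \<le> I at a power of \<open>E\<close> applied to v;
    for odd k it is E^2 \<le> E.\<close>
  have dec: "q (Suc k) \<le> q k" for k
  proof (cases "even k")
    case True
    then obtain m where k: "k = m + m" by (metis evenE mult_2)
    show ?thesis using q_add[of "Suc m" m] q_add[of m m] E_le[of "(E ^^ m) v"] by (simp add: k)
  next
    case False
    then obtain m where k: "k = Suc (m + m)" by (metis oddE mult_2 Suc_eq_plus1)
    show ?thesis using q_add[of "Suc m" "Suc m"] q_add[of "Suc m" m] E_E_le[of "(E ^^ m) v"] by (simp add: k)
  qed
  have nonneg: "0 \<le> q k" for k
  proof (cases "even k")
    case True
    then obtain m where k: "k = m + m" by (metis evenE mult_2)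
    show ?thesis using q_add[of m m] by (simp add: k)
  next
    case False
    then obtain m where k: "k = Suc (m + m)" by (metis oddE mult_2 Suc_eq_plus1)
    show ?thesis using q_add[of "Suc m" m] E_pos[of "(E ^^ m) v"] by (simp add: k)
  qed
  have "decseq q" using dec by (rule decseq_SucI)
  from decseq_convergent[OF this allI, OF nonneg] obtain l where l: "q \<longlonglongrightarrow> l" by blast
  have "Cauchy (\<lambda>n. (E ^^ n) v)"
    unfolding Cauchy_def dist_norm
  proof (intro allI impI)
    fix e :: real assume e: "e > 0"
    then obtain n0 where n0: "\<And>n. n \<ge> n0 \<Longrightarrow> \<bar>q n - l\<bar> < e\<^sup>2 / 4"
      using LIMSEQ_D[OF l, of "e\<^sup>2 / 4"] by auto
    have "norm ((E ^^ m) v - (E ^^ n) v) < e" if "m \<ge> n0" "n \<ge> n0" for m n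
    proof -
      \<comment> \<open>All three values of q are close to the limit l, and the coefficients 1, -2,
        1 cancel it.\<close>
      have "(norm ((E ^^ m) v - (E ^^ n) v))\<^sup>2 = q (m + m) - 2 * q (m + n) + q (n + n)"
        unfolding q_add dot_square_norm[symmetric]
        by (simp add: inner_diff_left inner_diff_right inner_commute)
      also have "\<dots> < e\<^sup>2"
        using n0[of "m + m"] n0[of "m + n"] n0[of "n + n"] that unfolding abs_less_iff by linarith
      finally show ?thesis using e by (simp add: power2_less_imp_less)
    qed
    then show "\<exists>M. \<forall>m\<ge>M. \<forall>n\<ge>M. norm ((E ^^ m) v - (E ^^ n) v) < e" by blast
  qed
  then obtain x where x: "(\<lambda>n. (E ^^ n) v) \<longlonglongrightarrow> x" using Cauchy_convergent convergent_def by blast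
  have "(\<lambda>n. (E ^^ Suc n) v) \<longlonglongrightarrow> E x" using E.tendsto[OF x] by simp
  moreover have "(\<lambda>n. (E ^^ Suc n) v) \<longlonglongrightarrow> x" by (rule LIMSEQ_Suc[OF x])
  ultimately have "E x = x" by (rule LIMSEQ_unique)
  then have "S x = 0" using \<kappa> by (simp add: E_def)
  then have "j x = 0" using inner_S[of x x] by simp
  then have "x = 0" using inj j.zero by (metis injD)
  then show ?thesis using x by simp
qed

text \<open>A truncated Neumann series for the inverse of \<open>S\<close>: since \<kappa> S = I -
  E, applying it to \<open>S v\<close> telescopes to v minus the n-th power of \<open>E\<close> at
  v.\<close>

definition Q where "Q n v = (\<Sum>k<n. \<kappa> *\<^sub>R (E ^^ k) v)"

lemma Q_linear: "bounded_linear (Q n)"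
  unfolding Q_def[abs_def]
  by (intro bounded_linear_sum bounded_linear_scaleR_right[THEN bounded_linear_compose] Epow_linear)

lemma ES: "E (S v) = S (E v)"
  by (simp add: E_def S.diff S.scaleR)

lemma Epow_S: "(E ^^ n) (S v) = S ((E ^^ n) v)"
  by (induction n) (simp_all add: ES)

lemma Q_sym: "Q n v \<bullet> w = v \<bullet> Q n w"
  by (simp add: Q_def inner_sum_left inner_sum_right Epow_sym)

lemma Q_S: "Q n (S v) = S (Q n v)"
  by (simp add: Q_def S.sum S.scaleR Epow_S)

lemma QS_eq: "Q n (S v) = v - (E ^^ n) v"
proof -
  interpret P: bounded_linear "E ^^ k" for k by (rule Epow_linear)
  have "\<kappa> *\<^sub>R (E ^^ k) (S v) = (E ^^ k) v - (E ^^ Suc k) v" for k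
  proof -
    have "(E ^^ Suc k) v = (E ^^ k) (v - \<kappa> *\<^sub>R S v)" by (simp add: funpow_swap1 E_def)
    then show ?thesis by (simp add: P.diff P.scaleR)
  qed
  then have "Q n (S v) = (\<Sum>k<n. (E ^^ k) v - (E ^^ Suc k) v)" by (simp add: Q_def)
  also have "\<dots> = v - (E ^^ n) v" using sum_lessThan_telescope'[of "\<lambda>k. (E ^^ k) v" n] by simp
  finally show ?thesis .
qed

section \<open>Weak derivatives as indefinite integrals; the continuous representative\<close>

definition weak :: "real \<Rightarrow> (real \<Rightarrow> 'v) \<Rightarrow> (real \<Rightarrow> 'v) \<Rightarrow> bool" where
  "weak T u r \<longleftrightarrow> u \<in> L2 T \<and> r \<in> L2 T \<and> (\<forall>\<phi> \<eta>. test_fun T \<phi> \<longrightarrow>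
     (\<integral>t. deriv \<phi> t * (j (u t) \<bullet> j \<eta>) \<partial>timeM T) = - (\<integral>t. \<phi> t * (r t \<bullet> \<eta>) \<partial>timeM T))"

text \<open>Testing with a single \<eta> gives a scalar statement, to which
  \<open>du_Bois_Reymond\<close> applies, with a constant and a null set depending on \<eta>.
  Countably many \<eta> suffice, and one common good time supplies a constant in V for all of
  them.\<close>

lemma weak_indef:
  assumes T: "T > 0" and w: "weak T u r"
  shows "\<exists>C. AE t in timeM T. S (u t) = C + indef T r t"
proof -
  let ?M = "timeM T"
  have u: "u \<in> L2 T" and r: "r \<in> L2 T" using w by (auto simp: weak_def)
  have ir: "integrable ?M r" and iu: "integrable ?M u" using u r L2_integrable by auto
  have comp: "\<exists>C. AE t in ?M. S (u t) \<bullet> \<eta> = C + indef T r t \<bullet> \<eta>" for \<eta>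
  proof -
    have "integrable ?M (\<lambda>t. S (u t) \<bullet> \<eta>)"
      by (intro integrable_inner_left integrable_bounded_linear[OF S_linear] iu)
    moreover have "integrable ?M (\<lambda>t. r t \<bullet> \<eta>)" by (intro integrable_inner_left ir)
    moreover have "(\<integral>t. deriv \<phi> t * (S (u t) \<bullet> \<eta>) \<partial>?M) = - (\<integral>t. \<phi> t * (r t \<bullet> \<eta>) \<partial>?M)"
      if "test_fun T \<phi>" for \<phi>
      using w that by (simp add: weak_def inner_S)
    ultimately obtain C where "AE t in ?M. S (u t) \<bullet> \<eta> = C + indef T (\<lambda>t. r t \<bullet> \<eta>) t"
      using du_Bois_Reymond[OF T] by blast
    then show ?thesis by (auto simp: indef_inner[OF ir])
  qed
  then obtain C where C: "\<And>\<eta>. AE t in ?M. S (u t) \<bullet> \<eta> = C \<eta> + indef T r t \<bullet> \<eta>" by metis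
  obtain D :: "'v set" where D: "countable D" "\<And>X. open X \<Longrightarrow> X \<noteq> {} \<Longrightarrow> \<exists>d\<in>D. d \<in> X"
    using countable_dense_setE by blast
  have ae: "AE t in ?M. \<forall>\<eta>\<in>D. S (u t) \<bullet> \<eta> = C \<eta> + indef T r t \<bullet> \<eta>"
    using D(1) C by (simp add: AE_ball_countable)
  obtain t0 where t0: "\<forall>\<eta>\<in>D. S (u t0) \<bullet> \<eta> = C \<eta> + indef T r t0 \<bullet> \<eta>"
    using AE_timeM_ex[OF T ae] by blast
  define c where "c = S (u t0) - indef T r t0"
  have "AE t in ?M. S (u t) = c + indef T r t"
    using ae
  proof eventually_elim
    case (elim t)
    have "S (u t) - (c + indef T r t) = 0"
      by (rule inner_dense_eq_0[OF D(2)])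
        (use elim t0 in \<open>auto simp: c_def inner_diff_left inner_add_left\<close>)
    then show ?case by simp
  qed
  then show ?thesis by blast
qed

text \<open>The function \<open>W\<close> is an indefinite integral in V, so the product rule
  applies to the squared norm of j G W. As \<open>W\<close> equals S u almost everywhere, the
  definition of \<open>S\<close> rewrites the derivative in terms of G S r and G S u; for the
  truncated Neumann series these contain only powers of \<open>E\<close>.\<close>

lemma filtered_energy:
  assumes ir: "integrable (timeM T) r" and ae: "AE t in timeM T. S (u t) = C + indef T r t"
    and G: "bounded_linear G" and sym: "\<And>v w. G v \<bullet> w = v \<bullet> G w" and GS: "\<And>v. G (S v) = S (G v)"
  defines "W \<equiv> \<lambda>t. C + indef T r t"
  assumes st: "s \<le> t"
  shows "(norm (j (G (W t))))\<^sup>2 - (norm (j (G (W s))))\<^sup>2 =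
    (\<integral>x. indicator {s<..t} x *\<^sub>R (2 * (G (S (r x)) \<bullet> G (S (u x)))) \<partial>timeM T)"
    "integrable (timeM T) (\<lambda>x. G (S (r x)) \<bullet> G (S (u x)))"
proof -
  let ?M = "timeM T"
  interpret G: bounded_linear G by fact
  define B where "B x y = j (G x) \<bullet> j (G y)" for x y
  have jG: "bounded_linear (\<lambda>x. j (G x))" by (rule bounded_linear_compose[OF bl G])
  have B: "bounded_bilinear B"
    unfolding B_def by (rule bounded_bilinear.comp[OF bounded_bilinear_inner jG jG])
  have B_eq: "B x (S y) = G (S x) \<bullet> G (S y)" for x y
    by (simp add: B_def inner_S[symmetric] GS)
  have B_sym: "B x y = B y x" for x y by (simp add: B_def inner_commute)
  let ?w = "\<lambda>x. B (r x) (W x) + B (W x) (r x)"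
  have W_eq: "C + indef T r t = W t" for t by (simp add: W_def)
  note pr = product_rule_indef[OF B ir ir, where ?F0.0 = C and ?G0.0 = C, unfolded W_eq]
  have ae': "AE x in ?M. ?w x = 2 * (G (S (r x)) \<bullet> G (S (u x)))"
    using ae
  proof eventually_elim
    case (elim x)
    then have "W x = S (u x)" by (simp add: W_def)
    then show ?case by (simp add: B_sym[of "S (u x)"] B_eq)
  qed
  have meas: "(\<lambda>x. 2 * (G (S (r x)) \<bullet> G (S (u x)))) \<in> borel_measurable ?M"
    by (rule borel_measurable_timeM_AE[OF borel_measurable_integrable[OF pr(1)] ae'])
  have int2: "integrable ?M (\<lambda>x. 2 * (G (S (r x)) \<bullet> G (S (u x))))"
    using integrable_cong_AE[OF borel_measurable_integrable[OF pr(1)] meas ae'] pr(1) by simp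
  then show "integrable ?M (\<lambda>x. G (S (r x)) \<bullet> G (S (u x)))" by simp
  have "(norm (j (G (W t))))\<^sup>2 - (norm (j (G (W s))))\<^sup>2 = B (W t) (W t) - B (W s) (W s)"
    by (simp add: B_def dot_square_norm)
  also have "\<dots> = indef T ?w t - indef T ?w s" by (rule pr(2)[OF st])
  also have "\<dots> = (\<integral>x. indicator {s<..t} x *\<^sub>R ?w x \<partial>?M)" by (rule indef_diff[OF pr(1) st])
  also have "\<dots> = (\<integral>x. indicator {s<..t} x *\<^sub>R (2 * (G (S (r x)) \<bullet> G (S (u x)))) \<partial>?M)"
  proof (rule integral_cong_AE)
    show "AE x in ?M. indicator {s<..t} x *\<^sub>R ?w x = indicator {s<..t} x *\<^sub>R (2 * (G (S (r x)) \<bullet> G (S (u x))))"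
      using ae' by eventually_elim simp
  qed (intro borel_measurable_integrable indicator_integrable pr(1) int2; simp)+
  finally show "(norm (j (G (W t))))\<^sup>2 - (norm (j (G (W s))))\<^sup>2 =
    (\<integral>x. indicator {s<..t} x *\<^sub>R (2 * (G (S (r x)) \<bullet> G (S (u x)))) \<partial>?M)" .
qed

lemma Epow_L2: "r \<in> L2 T \<Longrightarrow> (\<lambda>t. (E ^^ n) (r t)) \<in> L2 T"
  by (rule L2_bounded_linear[OF Epow_linear])

lemma Epow_L2_tendsto_0:
  assumes r: "r \<in> L2 T" shows "(\<lambda>n. L2.N T (\<lambda>t. (E ^^ n) (r t))) \<longlonglongrightarrow> 0"
proof -
  have "(\<lambda>n. \<integral>t. (norm ((E ^^ n) (r t)))\<^sup>2 \<partial>timeM T) \<longlonglongrightarrow> (\<integral>t. 0 \<partial>timeM T)"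
  proof (rule integral_dominated_convergence[where w = "\<lambda>t. (norm (r t))\<^sup>2"])
    show "integrable (timeM T) (\<lambda>t. (norm (r t))\<^sup>2)" using r by (simp add: L2_def)
    show "AE t in timeM T. (\<lambda>n. (norm ((E ^^ n) (r t)))\<^sup>2) \<longlonglongrightarrow> 0"
    proof (rule AE_I2)
      fix t
      have "(\<lambda>n. (norm ((E ^^ n) (r t)))\<^sup>2) \<longlonglongrightarrow> (norm (0::'v))\<^sup>2"
        by (intro tendsto_intros Epow_tendsto_0)
      then show "(\<lambda>n. (norm ((E ^^ n) (r t)))\<^sup>2) \<longlonglongrightarrow> 0" by simp
    qed
    show "(\<lambda>t. (norm ((E ^^ n) (r t)))\<^sup>2) \<in> borel_measurable (timeM T)" for n
      using Epow_L2[OF r, of n] by (auto simp: L2_def)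
    show "AE t in timeM T. norm ((norm ((E ^^ n) (r t)))\<^sup>2) \<le> (norm (r t))\<^sup>2" for n
      using Epow_norm_le by (auto intro!: AE_I2 power_mono)
  qed auto
  then have "(\<lambda>n. sqrt ((L2.N T (\<lambda>t. (E ^^ n) (r t)))\<^sup>2)) \<longlonglongrightarrow> sqrt 0"
    unfolding L2_N_sq by (intro tendsto_real_sqrt) simp
  then show ?thesis using L2.N_nonneg[OF Epow_L2[OF r]] by simp
qed

text \<open>
  The continuous representative is the uniform limit of \<open>j (Q\<^sub>n W)\<close>, where \<open>W = S u\<close> is an indefinite
  integral: \<open>Q\<^sub>n W = u - E\<^sup>n u\<close> a.e., and the energy identity of \<open>(Q\<^sub>n - Q\<^sub>m) W\<close> bounds the differences
  uniformly in time.
\<close>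

theorem continuous_representative:
  assumes T: "T > 0" and w: "weak T u r"
  obtains U where "continuous_on {0..T} U" "AE t in timeM T. U t = j (u t)"
    "\<And>s t. s \<le> t \<Longrightarrow> (norm (U t))\<^sup>2 - (norm (U s))\<^sup>2 = (\<integral>x. indicator {s<..t} x *\<^sub>R (2 * (r x \<bullet> u x)) \<partial>timeM T)"
proof -
  let ?M = "timeM T"
  have u: "u \<in> L2 T" and r: "r \<in> L2 T" using w by (auto simp: weak_def)
  have ir: "integrable ?M r" using r L2_integrable by auto
  obtain C where ae: "AE t in ?M. S (u t) = C + indef T r t" using weak_indef[OF T w] by blast
  define W where "W t = C + indef T r t" for t
  define V where "V n t = j (Q n (W t))" for n t
  \<comment> \<open>The energy identity controls only changes in time; this time anchors it.\<close>
  obtain t0 where t0: "S (u t0) = W t0" using AE_timeM_ex[OF T ae] by (auto simp: W_def)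
  have diff_lin: "bounded_linear (\<lambda>v. Q n v - Q m v)" for n m
    by (intro bounded_linear_sub Q_linear)
  define e1 e2 e3 where "e1 n = norm ((E ^^ n) (u t0))" and "e2 n = L2.N T (\<lambda>t. (E ^^ n) (r t))"
    and "e3 n = L2.N T (\<lambda>t. (E ^^ n) (u t))" for n
  have e_lim: "e1 \<longlonglongrightarrow> 0" "e2 \<longlonglongrightarrow> 0" "e3 \<longlonglongrightarrow> 0"
    unfolding e1_def[abs_def] e2_def[abs_def] e3_def[abs_def]
    using tendsto_norm_zero[OF Epow_tendsto_0] Epow_L2_tendsto_0[OF r] Epow_L2_tendsto_0[OF u] by auto
  have e_nn: "0 \<le> e1 n" "0 \<le> e2 n" "0 \<le> e3 n" for n
    using L2.N_nonneg[OF Epow_L2[OF r]] L2.N_nonneg[OF Epow_L2[OF u]]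
    by (auto simp: e1_def e2_def e3_def)
  \<comment> \<open>Composed with \<open>S\<close>, the difference of two Neumann sums is a
    difference of two powers of \<open>E\<close>, so the value at \<open>t0\<close> and the
    integrand are both small, with bounds independent of t.\<close>
  have main: "(norm (V n t - V m t))\<^sup>2 \<le> (b * (e1 m + e1 n))\<^sup>2 + 2 * ((e2 m + e2 n) * (e3 m + e3 n))" for n m t
  proof -
    define G where "G v = Q n v - Q m v" for v
    have GS_eq: "G (S v) = (E ^^ m) v - (E ^^ n) v" for v by (simp add: G_def QS_eq)
    have Vd: "V n t - V m t = j (G (W t))" for t by (simp add: V_def G_def j.diff)
    have Gl: "bounded_linear G" using diff_lin unfolding G_def[abs_def] .
    have Gsym: "G v \<bullet> w = v \<bullet> G w" for v w by (simp add: G_def inner_diff_left inner_diff_right Q_sym)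
    have GS: "G (S v) = S (G v)" for v by (simp add: G_def Q_S S.diff)
    note en = filtered_energy[OF ir ae Gl Gsym GS, folded W_def]
    define z where "z x = G (S (r x)) \<bullet> G (S (u x))" for x
    have iz: "integrable ?M z" using en(2)[OF order_refl] by (simp add: z_def[abs_def])
    define rd ud where "rd = (\<lambda>t. (E ^^ m) (r t)) - (\<lambda>t. (E ^^ n) (r t))"
      and "ud = (\<lambda>t. (E ^^ m) (u t)) - (\<lambda>t. (E ^^ n) (u t))"
    have rd: "rd \<in> L2 T" and ud: "ud \<in> L2 T"
      unfolding rd_def ud_def by (intro L2_diff Epow_L2 r u)+
    have "L2.N T rd \<le> e2 m + e2 n"
      using L2.triangle_diff[OF Epow_L2[OF r] L2.mem(4) Epow_L2[OF r], of m n]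
        L2.N_scale[OF Epow_L2[OF r], of "-1" n] by (simp add: rd_def e2_def)
    moreover have "L2.N T ud \<le> e3 m + e3 n"
      using L2.triangle_diff[OF Epow_L2[OF u] L2.mem(4) Epow_L2[OF u], of m n]
        L2.N_scale[OF Epow_L2[OF u], of "-1" n] by (simp add: ud_def e3_def)
    ultimately have nn: "L2.N T rd * L2.N T ud \<le> (e2 m + e2 n) * (e3 m + e3 n)"
      using rd ud e_nn by (intro mult_mono) (auto intro: add_nonneg_nonneg)
    have "(\<integral>x. \<bar>z x\<bar> \<partial>?M) \<le> (\<integral>x. norm (rd x) * norm (ud x) \<partial>?M)"
      by (intro integral_mono integrable_abs iz L2_norm_mult_integrable[OF rd ud])
        (simp add: z_def GS_eq rd_def ud_def Cauchy_Schwarz_ineq2)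
    also have "\<dots> \<le> L2.N T rd * L2.N T ud" by (rule L2_integral_norm_mult_le[OF rd ud])
    finally have zb: "(\<integral>x. \<bar>z x\<bar> \<partial>?M) \<le> (e2 m + e2 n) * (e3 m + e3 n)" using nn by simp
    have ind: "\<bar>\<integral>x. indicator {p<..q} x *\<^sub>R (2 * z x) \<partial>?M\<bar> \<le> 2 * ((e2 m + e2 n) * (e3 m + e3 n))" for p q
      using abs_indicator_integral_le[OF integrable_mult_right[OF iz], of "{p<..q}" 2] zb
      by (simp add: abs_mult)
    have "\<bar>(norm (j (G (W t))))\<^sup>2 - (norm (j (G (W t0))))\<^sup>2\<bar> \<le> 2 * ((e2 m + e2 n) * (e3 m + e3 n))"
    proof (cases "t0 \<le> t")
      case True
      show ?thesis using en(1)[OF True] ind[of t0 t] by (simp add: z_def)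
    next
      case False
      then have "t \<le> t0" by simp
      from en(1)[OF this] ind[of t t0] show ?thesis by (simp add: z_def abs_minus_commute)
    qed
    moreover have "(norm (j (G (W t0))))\<^sup>2 \<le> (b * (e1 m + e1 n))\<^sup>2"
    proof (rule power_mono)
      have "norm (j (G (W t0))) \<le> b * norm (G (W t0))" by (rule b(2))
      also have "\<dots> \<le> b * (e1 m + e1 n)"
        using b(1) norm_triangle_ineq4[of "(E ^^ m) (u t0)" "(E ^^ n) (u t0)"]
        unfolding t0[symmetric] GS_eq by (intro mult_left_mono) (auto simp: e1_def)
      finally show "norm (j (G (W t0))) \<le> b * (e1 m + e1 n)" .
    qed simp
    ultimately show ?thesis unfolding Vd by linarith
  qed
  have "uniformly_Cauchy_on UNIV V"
    unfolding uniformly_Cauchy_on_def dist_norm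
  proof (intro allI impI)
    fix e :: real assume e: "e > 0"
    \<comment> \<open>With these thresholds the bound of \<open>main\<close> is at most 3/4 of
      e^2.\<close>
    have "\<forall>\<^sub>F n in sequentially. e1 n < e / (4 * b)" "\<forall>\<^sub>F n in sequentially. e2 n < e / 4"
      "\<forall>\<^sub>F n in sequentially. e3 n < e / 4"
      using e b(1) by (intro order_tendstoD(2)[OF e_lim(1)] order_tendstoD(2)[OF e_lim(2)]
          order_tendstoD(2)[OF e_lim(3)]; simp)+
    then have "\<forall>\<^sub>F n in sequentially. e1 n < e / (4 * b) \<and> e2 n < e / 4 \<and> e3 n < e / 4"
      by eventually_elim auto
    then obtain n0 where n0: "\<And>n. n \<ge> n0 \<Longrightarrow> e1 n < e / (4 * b) \<and> e2 n < e / 4 \<and> e3 n < e / 4"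
      by (auto simp: eventually_sequentially)
    have "norm (V m x - V n x) < e" if "m \<ge> n0" "n \<ge> n0" for x m n
    proof -
      have "b * (e1 n + e1 m) \<le> b * (e / (2 * b))"
        using n0[OF that(1)] n0[OF that(2)] b(1) by (intro mult_left_mono) (auto simp: field_simps)
      also have "\<dots> = e / 2" using b(1) by simp
      finally have "(b * (e1 n + e1 m))\<^sup>2 \<le> (e / 2)\<^sup>2"
        using b(1) e_nn by (intro power_mono) (auto intro!: mult_nonneg_nonneg add_nonneg_nonneg)
      moreover have "(e2 n + e2 m) * (e3 n + e3 m) \<le> (e / 2) * (e / 2)"
        using n0[OF that(1)] n0[OF that(2)] e_nn e by (intro mult_mono) (auto intro: add_nonneg_nonneg)
      ultimately have "(norm (V m x - V n x))\<^sup>2 \<le> (e / 2)\<^sup>2 + 2 * ((e / 2) * (e / 2))"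
        using main[of m x n] by linarith
      also have "\<dots> < e\<^sup>2" using e by (simp add: power2_eq_square)
      finally show ?thesis using e by (simp add: power2_less_imp_less)
    qed
    then show "\<exists>M. \<forall>x\<in>UNIV. \<forall>m\<ge>M. \<forall>n\<ge>M. norm (V m x - V n x) < e" by blast
  qed
  then obtain U where U: "uniform_limit UNIV V U sequentially"
    using Cauchy_uniformly_convergent unfolding uniformly_convergent_on_def by blast
  have cV: "continuous_on UNIV (V n)" for n
  proof -
    have "continuous_on UNIV W" unfolding W_def by (intro continuous_intros indef_continuous ir)
    from continuous_on_compose2[OF linear_continuous_on[OF bounded_linear_compose[OF bl Q_linear]] this]
    show ?thesis unfolding V_def by auto
  qed
  have cU: "continuous_on UNIV U"
    by (rule uniform_limit_theorem[OF _ U]) (auto intro: cV always_eventually)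
  have lim: "(\<lambda>n. V n t) \<longlonglongrightarrow> U t" for t
    using tendsto_uniform_limitI[OF U] by simp
  have aeU: "AE t in ?M. U t = j (u t)"
    using ae
  proof eventually_elim
    case (elim t)
    have "(\<lambda>n. j (u t - (E ^^ n) (u t))) \<longlonglongrightarrow> j (u t - 0)"
      by (intro j.tendsto tendsto_diff tendsto_const Epow_tendsto_0)
    moreover have "V n t = j (u t - (E ^^ n) (u t))" for n
      using elim by (simp add: V_def W_def QS_eq[symmetric])
    ultimately have "(\<lambda>n. V n t) \<longlonglongrightarrow> j (u t)" by simp
    then show ?case using LIMSEQ_unique[OF lim] by blast
  qed
  show thesis
  proof (rule that[OF continuous_on_subset[OF cU] aeU])
    fix s t :: real assume st: "s \<le> t"
    let ?z = "\<lambda>n x. (r x - (E ^^ n) (r x)) \<bullet> (u x - (E ^^ n) (u x))"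
    note en = filtered_energy[OF ir ae Q_linear Q_sym Q_S st, folded W_def, unfolded QS_eq]
    have "(\<lambda>n. \<integral>x. indicator {s<..t} x *\<^sub>R (2 * ?z n x) \<partial>?M) \<longlonglongrightarrow> (\<integral>x. indicator {s<..t} x *\<^sub>R (2 * (r x \<bullet> u x)) \<partial>?M)"
    \<comment> \<open>A factor 2 for v minus a power of \<open>E\<close> at v in each of the two
      arguments, times the 2 in the integrand.\<close>
    proof (rule integral_dominated_convergence[where w = "\<lambda>x. 8 * (norm (r x) * norm (u x))"])
      show "integrable ?M (\<lambda>x. 8 * (norm (r x) * norm (u x)))" using L2_norm_mult_integrable[OF r u] by simp
      show "(\<lambda>x. indicator {s<..t} x *\<^sub>R (2 * (r x \<bullet> u x))) \<in> borel_measurable ?M"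
        by (intro borel_measurable_integrable indicator_integrable integrable_mult_right L2_inner_integrable r u) simp
      show "(\<lambda>x. indicator {s<..t} x *\<^sub>R (2 * ?z n x)) \<in> borel_measurable ?M" for n
        by (intro borel_measurable_integrable indicator_integrable integrable_mult_right en(2)) simp
      show "AE x in ?M. (\<lambda>n. indicator {s<..t} x *\<^sub>R (2 * ?z n x)) \<longlonglongrightarrow> indicator {s<..t} x *\<^sub>R (2 * (r x \<bullet> u x))"
      proof (rule AE_I2)
        fix x
        have "(\<lambda>n. indicator {s<..t} x *\<^sub>R (2 * ?z n x)) \<longlonglongrightarrow> indicator {s<..t} x *\<^sub>R (2 * ((r x - 0) \<bullet> (u x - 0)))"
          by (intro tendsto_intros Epow_tendsto_0)
        then show "(\<lambda>n. indicator {s<..t} x *\<^sub>R (2 * ?z n x)) \<longlonglongrightarrow> indicator {s<..t} x *\<^sub>R (2 * (r x \<bullet> u x))" by simp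
      qed
      show "AE x in ?M. norm (indicator {s<..t} x *\<^sub>R (2 * ?z n x)) \<le> 8 * (norm (r x) * norm (u x))" for n
      proof (rule AE_I2)
        fix x
        have P: "norm (v - (E ^^ n) v) \<le> 2 * norm v" for v
          using norm_triangle_ineq4[of v "(E ^^ n) v"] Epow_norm_le[of n v] by simp
        have "\<bar>?z n x\<bar> \<le> norm (r x - (E ^^ n) (r x)) * norm (u x - (E ^^ n) (u x))"
          by (rule Cauchy_Schwarz_ineq2)
        also have "\<dots> \<le> (2 * norm (r x)) * (2 * norm (u x))" by (intro mult_mono P) auto
        finally show "norm (indicator {s<..t} x *\<^sub>R (2 * ?z n x)) \<le> 8 * (norm (r x) * norm (u x))"
          by (auto split: split_indicator simp: abs_mult)
      qed
    qed
    then have "(\<lambda>n. (norm (V n t))\<^sup>2 - (norm (V n s))\<^sup>2) \<longlonglongrightarrow> (\<integral>x. indicator {s<..t} x *\<^sub>R (2 * (r x \<bullet> u x)) \<partial>?M)"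
      unfolding V_def en(1) .
    moreover have "(\<lambda>n. (norm (V n t))\<^sup>2 - (norm (V n s))\<^sup>2) \<longlonglongrightarrow> (norm (U t))\<^sup>2 - (norm (U s))\<^sup>2"
      by (intro tendsto_intros lim)
    ultimately show "(norm (U t))\<^sup>2 - (norm (U s))\<^sup>2 = (\<integral>x. indicator {s<..t} x *\<^sub>R (2 * (r x \<bullet> u x)) \<partial>?M)"
      using LIMSEQ_unique by blast
  qed simp
qed

section \<open>Linearity, closedness and uniqueness of weak derivatives\<close>

lemma L2_mem [simp]: "weak T u r \<Longrightarrow> u \<in> L2 T" "weak T u r \<Longrightarrow> r \<in> L2 T"
  by (auto simp: weak_def)

lemma weak_rrep:
  assumes u: "u \<in> L2 T" and z: "z \<in> L2 T" and d: "is_weak_deriv T j u z"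
  shows "weak T u (\<lambda>t. rrep (z t))"
proof -
  have "rrep \<in> borel_measurable (borel :: ('v \<Rightarrow>\<^sub>L real) measure)"
    by (intro borel_measurable_continuous_onI linear_continuous_on bounded_linear_rrep)
  from measurable_compose[OF _ this, of z "timeM T"]
  have "(\<lambda>t. rrep (z t)) \<in> L2 T" using z by (simp add: L2_def norm_rrep)
  then show ?thesis using u d unfolding weak_def is_weak_deriv_def inner_rrep by blast
qed

lemma is_weak_deriv_of_weak:
  assumes "weak T u r"
  shows "(\<lambda>t. blinfun_inner_left (r t)) \<in> L2 T" "is_weak_deriv T j u (\<lambda>t. blinfun_inner_left (r t))"
proof -
  have "blinfun_inner_left \<in> borel_measurable (borel :: 'v measure)"
    by (intro borel_measurable_continuous_onI linear_continuous_on bounded_linear_blinfun_inner_left)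
  from measurable_compose[OF _ this, of r "timeM T"]
  have "(\<lambda>t. blinfun_inner_left (r t)) \<in> borel_measurable (timeM T)" using assms by (simp add: weak_def L2_def)
  moreover have "norm (blinfun_inner_left x) = norm x" for x :: 'v
    using norm_rrep[of "blinfun_inner_left x"] by (simp add: rrep_blinfun_inner)
  ultimately show "(\<lambda>t. blinfun_inner_left (r t)) \<in> L2 T" using assms by (simp add: weak_def L2_def)
  have eq: "blinfun_apply (blinfun_inner_left x) y = x \<bullet> y" for x y :: 'v by (simp add: inner_commute)
  show "is_weak_deriv T j u (\<lambda>t. blinfun_inner_left (r t))"
    using assms unfolding weak_def is_weak_deriv_def eq by blast
qed

lemma spaceX_iff: "u \<in> spaceX T j \<longleftrightarrow> (\<exists>r. weak T u r)"
proof
  assume "u \<in> spaceX T j"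
  then show "\<exists>r. weak T u r" unfolding spaceX_def using weak_rrep by blast
next
  assume "\<exists>r. weak T u r"
  then obtain r where r: "weak T u r" ..
  from is_weak_deriv_of_weak[OF r] L2_mem(1)[OF r] show "u \<in> spaceX T j" unfolding spaceX_def by blast
qed

lemma weak_weak_deriv:
  assumes "u \<in> spaceX T j" shows "weak T u (\<lambda>t. rrep (weak_deriv T j u t))"
proof -
  have "\<exists>z. z \<in> L2 T \<and> is_weak_deriv T j u z" using assms by (auto simp: spaceX_def)
  from someI_ex[OF this] show ?thesis
    using assms unfolding weak_deriv_def by (intro weak_rrep) (auto simp: spaceX_def)
qed

lemma bounded_test_fun:
  assumes "test_fun T \<phi>"
  shows "\<exists>B. \<forall>t\<in>{0..T}. \<bar>\<phi> t\<bar> \<le> B \<and> \<bar>deriv \<phi> t\<bar> \<le> B" "continuous_on UNIV \<phi>" "continuous_on UNIV (deriv \<phi>)"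
proof -
  have "((deriv ^^ k) \<phi>) field_differentiable (at t)" for k t using assms by (simp add: test_fun_def)
  from this[of 0] this[of 1] have d: "\<phi> field_differentiable (at t)" "deriv \<phi> field_differentiable (at t)" for t
    by auto
  show c: "continuous_on UNIV \<phi>" "continuous_on UNIV (deriv \<phi>)"
    using d by (auto intro!: continuous_at_imp_continuous_on field_differentiable_imp_continuous_at)
  have "bounded (\<phi> ` {0..T})" "bounded (deriv \<phi> ` {0..T})"
    using c by (auto intro!: compact_imp_bounded compact_continuous_image intro: continuous_on_subset)
  then obtain B1 B2 where "\<forall>t\<in>{0..T}. \<bar>\<phi> t\<bar> \<le> B1" "\<forall>t\<in>{0..T}. \<bar>deriv \<phi> t\<bar> \<le> B2"
    unfolding bounded_iff by auto
  then show "\<exists>B. \<forall>t\<in>{0..T}. \<bar>\<phi> t\<bar> \<le> B \<and> \<bar>deriv \<phi> t\<bar> \<le> B"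
    by (intro exI[of _ "max B1 B2"]) (auto simp: le_max_iff_disj)
qed

lemma test_fun_scaleR_L2:
  fixes \<eta> :: 'v
  assumes "test_fun T \<phi>" shows "(\<lambda>t. \<phi> t *\<^sub>R \<eta>) \<in> L2 T" "(\<lambda>t. deriv \<phi> t *\<^sub>R \<eta>) \<in> L2 T"
proof -
  obtain B where B: "\<And>t. t \<in> {0..T} \<Longrightarrow> \<bar>\<phi> t\<bar> \<le> B \<and> \<bar>deriv \<phi> t\<bar> \<le> B"
    using bounded_test_fun(1)[OF assms] by blast
  have "\<phi> \<in> borel_measurable (timeM T)" "deriv \<phi> \<in> borel_measurable (timeM T)"
    by (intro borel_measurable_timeM borel_measurable_continuous_onI bounded_test_fun[OF assms])+
  then have "(\<lambda>t. \<phi> t *\<^sub>R \<eta>) \<in> borel_measurable (timeM T)" "(\<lambda>t. deriv \<phi> t *\<^sub>R \<eta>) \<in> borel_measurable (timeM T)"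
    by measurable
  then show "(\<lambda>t. \<phi> t *\<^sub>R \<eta>) \<in> L2 T" "(\<lambda>t. deriv \<phi> t *\<^sub>R \<eta>) \<in> L2 T"
    using B by (auto intro!: L2_boundedI[OF L2_const[of \<eta>], where c = B] AE_I2 mult_right_mono)
qed

text \<open>Both sides become pairings with fixed elements of L2, so linearity and closedness of the
  weak derivative reduce to bilinearity and continuity of the inner product.\<close>

lemma weak_iff:
  "weak T u r \<longleftrightarrow> u \<in> L2 T \<and> r \<in> L2 T \<and> (\<forall>\<phi> \<eta>. test_fun T \<phi> \<longrightarrow>
     L2ip T u (\<lambda>t. deriv \<phi> t *\<^sub>R S \<eta>) = - L2ip T r (\<lambda>t. \<phi> t *\<^sub>R \<eta>))"
proof -
  have "L2ip T u (\<lambda>t. deriv \<phi> t *\<^sub>R S \<eta>) = (\<integral>t. deriv \<phi> t * (j (u t) \<bullet> j \<eta>) \<partial>timeM T)"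
    "L2ip T r (\<lambda>t. \<phi> t *\<^sub>R \<eta>) = (\<integral>t. \<phi> t * (r t \<bullet> \<eta>) \<partial>timeM T)" for \<phi> \<eta>
    by (simp_all add: L2ip_def S_sym[symmetric] inner_S)
  then show ?thesis by (simp only: weak_def)
qed

lemma weakD:
  "weak T u r \<Longrightarrow> test_fun T \<phi> \<Longrightarrow> L2ip T u (\<lambda>t. deriv \<phi> t *\<^sub>R S \<eta>) = - L2ip T r (\<lambda>t. \<phi> t *\<^sub>R \<eta>)"
  unfolding weak_iff by blast

lemma weakI:
  assumes "u \<in> L2 T" "r \<in> L2 T"
    and "\<And>\<phi> \<eta>. test_fun T \<phi> \<Longrightarrow> L2ip T u (\<lambda>t. deriv \<phi> t *\<^sub>R S \<eta>) = - L2ip T r (\<lambda>t. \<phi> t *\<^sub>R \<eta>)"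
  shows "weak T u r"
  unfolding weak_iff using assms by blast

lemma weak_add:
  assumes w: "weak T u r" "weak T u' r'" shows "weak T (u + u') (r + r')"
proof (rule weakI)
  fix \<phi> \<eta> assume \<phi>: "test_fun T \<phi>"
  show "L2ip T (u + u') (\<lambda>t. deriv \<phi> t *\<^sub>R S \<eta>) = - L2ip T (r + r') (\<lambda>t. \<phi> t *\<^sub>R \<eta>)"
    using weakD[OF w(1) \<phi>, of \<eta>] weakD[OF w(2) \<phi>, of \<eta>] w
    by (simp add: L2.add_left test_fun_scaleR_L2[OF \<phi>])
qed (use w in \<open>auto intro: L2_add\<close>)

lemma weak_scale:
  assumes w: "weak T u r" shows "weak T (c *\<^sub>R u) (c *\<^sub>R r)"
proof (rule weakI)
  fix \<phi> \<eta> assume \<phi>: "test_fun T \<phi>"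
  show "L2ip T (c *\<^sub>R u) (\<lambda>t. deriv \<phi> t *\<^sub>R S \<eta>) = - L2ip T (c *\<^sub>R r) (\<lambda>t. \<phi> t *\<^sub>R \<eta>)"
    using weakD[OF w \<phi>, of \<eta>] w by (simp add: L2.scale_left test_fun_scaleR_L2[OF \<phi>])
qed (use w in \<open>auto intro: L2_scale\<close>)

lemma weak_diff: "weak T u r \<Longrightarrow> weak T u' r' \<Longrightarrow> weak T (u - u') (r - r')"
  using weak_add[of T u r "(-1) *\<^sub>R u'" "(-1) *\<^sub>R r'"] weak_scale[of T u' r' "-1"]
  by (simp only: scaleR_minus1_left add_uminus_conv_diff)

lemma subspace_spaceX: "subspace (spaceX T j)"
proof (rule subspaceI)
  have "weak T 0 0" unfolding weak_def by (intro conjI L2.mem) (simp_all add: j.zero)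
  then show "0 \<in> spaceX T j" by (auto simp: spaceX_iff)
next
  fix u v c assume "u \<in> spaceX T j" "v \<in> spaceX T j"
  then show "u + v \<in> spaceX T j" "c *\<^sub>R u \<in> spaceX T j"
    unfolding spaceX_iff by (blast intro: weak_add weak_scale)+
qed

lemma weak_limit:
  assumes f: "\<And>n. weak T (f n) (r n)" and u: "u \<in> L2 T" and q: "q \<in> L2 T"
    and fu: "(\<lambda>n. L2.N T (f n - u)) \<longlonglongrightarrow> 0" and rq: "(\<lambda>n. L2.N T (r n - q)) \<longlonglongrightarrow> 0"
  shows "weak T u q"
proof -
  have lim: "(\<lambda>n. L2ip T (h n) g) \<longlonglongrightarrow> L2ip T h' g"
    if h: "\<And>n. h n \<in> L2 T" "h' \<in> L2 T" "(\<lambda>n. L2.N T (h n - h')) \<longlonglongrightarrow> 0" and g: "g \<in> L2 T" for h h' and g :: "real \<Rightarrow> 'v"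
  proof -
    have "(\<lambda>n. L2ip T (h n - h') g) \<longlonglongrightarrow> 0"
      by (rule tendsto_rabs_zero_cancel, rule tendsto_0_dominated[OF h(3), where k = "L2.N T g"])
        (use L2.Cauchy_Schwarz[OF L2_diff[OF h(1,2)] g] in \<open>auto simp: mult.commute\<close>)
    then show ?thesis using h g by (simp add: L2.diff_left LIM_zero_iff)
  qed
  show ?thesis
  proof (rule weakI[OF u q])
    fix \<phi> \<eta> assume \<phi>: "test_fun T \<phi>"
    have "(\<lambda>n. L2ip T (f n) (\<lambda>t. deriv \<phi> t *\<^sub>R S \<eta>)) \<longlonglongrightarrow> L2ip T u (\<lambda>t. deriv \<phi> t *\<^sub>R S \<eta>)"
      by (intro lim u fu test_fun_scaleR_L2[OF \<phi>] L2_mem(1)[OF f])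
    moreover have "(\<lambda>n. - L2ip T (r n) (\<lambda>t. \<phi> t *\<^sub>R \<eta>)) \<longlonglongrightarrow> - L2ip T q (\<lambda>t. \<phi> t *\<^sub>R \<eta>)"
      by (intro tendsto_minus lim q rq test_fun_scaleR_L2[OF \<phi>] L2_mem(2)[OF f])
    moreover have "L2ip T (f n) (\<lambda>t. deriv \<phi> t *\<^sub>R S \<eta>) = - L2ip T (r n) (\<lambda>t. \<phi> t *\<^sub>R \<eta>)" for n
      using weakD[OF f \<phi>] .
    ultimately show "L2ip T u (\<lambda>t. deriv \<phi> t *\<^sub>R S \<eta>) = - L2ip T q (\<lambda>t. \<phi> t *\<^sub>R \<eta>)"
      using LIMSEQ_unique by simp
  qed
qed

text \<open>This is uniqueness of weak derivatives: the indefinite integral of d is constant and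
  starts at 0.\<close>

lemma weak_0_imp_AE_0:
  assumes T: "T > 0" and w: "weak T 0 d" shows "AE t in timeM T. d t = 0"
proof (rule AE_eq_0_of_inner)
  fix \<eta>
  have d: "integrable (timeM T) d" using w by (intro L2_integrable) simp
  obtain C where "AE t in timeM T. S (0 t) = C + indef T d t" using weak_indef[OF T w] by blast
  moreover have "S 0 = 0" by (rule linear_0[OF bounded_linear.linear[OF S_linear]])
  ultimately have "AE t in timeM T. indef T d t = - C" by (auto simp: eq_neg_iff_add_eq_0 add.commute)
  then have const: "indef T d t = - C" if "t \<in> {0..T}" for t
    by (intro continuous_AE_eq_timeM[OF T indef_continuous[OF d] continuous_on_const] that)
  then have "C = 0" using indef_0[of 0 T d] T by (auto dest: spec[of _ 0])
  then have zero: "indef T d t = 0" for t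
    using const[of t] const[of T] indef_0[of t T d] indef_T[of T t d] indef_T[of T T d] T
    by (cases "t < 0"; cases "t \<le> T") auto
  show "AE t in timeM T. d t \<bullet> \<eta> = 0"
    by (intro AE_eq_0_of_indef_eq_0 integrable_inner_left d) (simp add: indef_inner[OF d] zero)
qed

text \<open>\<open>weak_deriv\<close> is an arbitrary choice; by uniqueness any representative r may
  be used to compute the time derivative.\<close>

lemma op_dt_eq:
  assumes T: "T > 0" and w: "weak T u r" and v: "v \<in> L2 T"
  shows "op_dt T j u v = L2ip T r v"
proof -
  define r' where "r' t = rrep (weak_deriv T j u t)" for t
  have w': "weak T u r'" using w weak_weak_deriv unfolding r'_def by (auto simp: spaceX_iff)
  have "weak T 0 (r' - r)" using weak_diff[OF w' w] by simp
  then have ae: "AE t in timeM T. (r' - r) t = 0" by (rule weak_0_imp_AE_0[OF T])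
  have "op_dt T j u v = L2ip T r' v" by (simp add: op_dt_def L2ip_def r'_def inner_rrep)
  also have "\<dots> = L2ip T r v"
    unfolding L2ip_def
  proof (rule integral_cong_AE)
    show "AE t in timeM T. r' t \<bullet> v t = r t \<bullet> v t" using ae by eventually_elim simp
  qed (intro borel_measurable_integrable L2_inner_integrable v L2_mem(2)[OF w] L2_mem(2)[OF w'])+
  finally show ?thesis .
qed

section \<open>Traces and the energy identity\<close>

lemma trace_eqI:
  assumes T: "T > 0" and U: "continuous_on {0..T} U" "AE s in timeM T. U s = j (u s)" and t: "t \<in> {0..T}"
  shows "trace_map T j t u = U t"
  unfolding trace_map_def
proof (rule the_equality)
  show "\<exists>V. continuous_on {0..T} V \<and> (AE s in timeM T. V s = j (u s)) \<and> U t = V t" using U by blast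
  fix h assume "\<exists>V. continuous_on {0..T} V \<and> (AE s in timeM T. V s = j (u s)) \<and> h = V t"
  then obtain V where V: "continuous_on {0..T} V" "AE s in timeM T. V s = j (u s)" "h = V t" by blast
  have "AE s in timeM T. V s = U s" using V(2) U(2) by eventually_elim simp
  then show "h = U t" using continuous_AE_eq_timeM[OF T V(1) U(1) _ t] V(3) by simp
qed

lemma trace_representative:
  assumes T: "T > 0" and w: "weak T u r"
  obtains U where "continuous_on {0..T} U" "AE t in timeM T. U t = j (u t)"
    "\<And>t. t \<in> {0..T} \<Longrightarrow> trace_map T j t u = U t"
    "\<And>s t. s \<le> t \<Longrightarrow> (norm (U t))\<^sup>2 - (norm (U s))\<^sup>2 = (\<integral>x. indicator {s<..t} x *\<^sub>R (2 * (r x \<bullet> u x)) \<partial>timeM T)"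
proof -
  obtain U where U: "continuous_on {0..T} U" "AE t in timeM T. U t = j (u t)"
    "\<And>s t. s \<le> t \<Longrightarrow> (norm (U t))\<^sup>2 - (norm (U s))\<^sup>2 = (\<integral>x. indicator {s<..t} x *\<^sub>R (2 * (r x \<bullet> u x)) \<partial>timeM T)"
    by (rule continuous_representative[OF T w], rule that)
  show thesis by (rule that[OF U(1,2) trace_eqI[OF T U(1,2)] U(3)])
qed

lemma trace_add:
  assumes T: "T > 0" and u: "u \<in> spaceX T j" and v: "v \<in> spaceX T j" and t: "t \<in> {0..T}"
  shows "trace_map T j t (u + v) = trace_map T j t u + trace_map T j t v"
proof -
  obtain r q where "weak T u r" "weak T v q" using u v by (auto simp: spaceX_iff)
  obtain U where U: "continuous_on {0..T} U" "AE t in timeM T. U t = j (u t)" "trace_map T j t u = U t"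
    using trace_representative[OF T \<open>weak T u r\<close>] t by metis
  obtain V where V: "continuous_on {0..T} V" "AE t in timeM T. V t = j (v t)" "trace_map T j t v = V t"
    using trace_representative[OF T \<open>weak T v q\<close>] t by metis
  have "AE s in timeM T. U s + V s = j ((u + v) s)"
    using U(2) V(2) by eventually_elim (simp add: j.add)
  from trace_eqI[OF T continuous_on_add[OF U(1) V(1)] this t] show ?thesis using U V by (simp add: plus_fun_def)
qed

lemma trace_scale:
  assumes T: "T > 0" and u: "u \<in> spaceX T j" and t: "t \<in> {0..T}"
  shows "trace_map T j t (c *\<^sub>R u) = c *\<^sub>R trace_map T j t u"
proof -
  obtain r where "weak T u r" using u by (auto simp: spaceX_iff)
  obtain U where U: "continuous_on {0..T} U" "AE t in timeM T. U t = j (u t)" "trace_map T j t u = U t"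
    using trace_representative[OF T \<open>weak T u r\<close>] t by metis
  have "AE s in timeM T. c *\<^sub>R U s = j ((c *\<^sub>R u) s)"
    using U(2) by eventually_elim (simp add: j.scaleR)
  from trace_eqI[OF T continuous_on_scaleR[OF continuous_on_const U(1)] this t] show ?thesis using U by (simp add: scaleR_fun_def)
qed

lemma energy_identity:
  assumes T: "T > 0" and u: "u \<in> spaceX T j"
  shows "(norm (trace_map T j T u))\<^sup>2 - (norm (trace_map T j 0 u))\<^sup>2 = 2 * op_dt T j u u"
proof -
  obtain r where w: "weak T u r" using u by (auto simp: spaceX_iff)
  obtain U where "continuous_on {0..T} U" "AE t in timeM T. U t = j (u t)"
    and U: "\<And>t. t \<in> {0..T} \<Longrightarrow> trace_map T j t u = U t"
    "\<And>s t. s \<le> t \<Longrightarrow> (norm (U t))\<^sup>2 - (norm (U s))\<^sup>2 = (\<integral>x. indicator {s<..t} x *\<^sub>R (2 * (r x \<bullet> u x)) \<partial>timeM T)"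
    by (rule trace_representative[OF T w], rule that)
  have "(\<integral>x. indicator {0<..T} x *\<^sub>R (2 * (r x \<bullet> u x)) \<partial>timeM T) = (\<integral>x. 2 * (r x \<bullet> u x) \<partial>timeM T)"
    by (intro Bochner_Integration.integral_cong) auto
  then show ?thesis
    using U(1)[of 0] U(1)[of T] U(2)[of 0 T] T op_dt_eq[OF T w L2_mem(1)[OF w]] by (simp add: L2ip_def)
qed

text \<open>The energy identity bounds the squared norm at t by that at any s plus the integral
  term; averaging over s in (0, T) gives the factor 1 / T.\<close>

lemma trace_bound:
  assumes T: "T > 0" and w: "weak T u r" and t: "t \<in> {0..T}"
  shows "(norm (trace_map T j t u))\<^sup>2 \<le> b\<^sup>2 / T * (L2.N T u)\<^sup>2 + 2 * (L2.N T r * L2.N T u)"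
proof -
  let ?M = "timeM T"
  have u: "u \<in> L2 T" and r: "r \<in> L2 T" using w by auto
  obtain U where U: "continuous_on {0..T} U" "AE t in ?M. U t = j (u t)"
    "\<And>t. t \<in> {0..T} \<Longrightarrow> trace_map T j t u = U t"
    "\<And>s t. s \<le> t \<Longrightarrow> (norm (U t))\<^sup>2 - (norm (U s))\<^sup>2 = (\<integral>x. indicator {s<..t} x *\<^sub>R (2 * (r x \<bullet> u x)) \<partial>?M)"
    by (rule trace_representative[OF T w], rule that)
  define k where "k = L2.N T r * L2.N T u"
  have ind: "\<bar>\<integral>x. indicator {p<..q} x *\<^sub>R (2 * (r x \<bullet> u x)) \<partial>?M\<bar> \<le> 2 * k" for p q
  proof -
    have iz: "integrable ?M (\<lambda>x. 2 * (r x \<bullet> u x))"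
      by (intro integrable_mult_right L2_inner_integrable r u)
    then have "\<bar>\<integral>x. indicator {p<..q} x *\<^sub>R (2 * (r x \<bullet> u x)) \<partial>?M\<bar> \<le> (\<integral>x. \<bar>2 * (r x \<bullet> u x)\<bar> \<partial>?M)"
      by (rule abs_indicator_integral_le) simp
    also have "\<dots> \<le> (\<integral>x. 2 * (norm (r x) * norm (u x)) \<partial>?M)"
      by (intro integral_mono integrable_abs iz integrable_mult_right L2_norm_mult_integrable r u)
        (simp add: abs_mult Cauchy_Schwarz_ineq2)
    also have "\<dots> \<le> 2 * k" using L2_integral_norm_mult_le[OF r u] by (simp add: k_def)
    finally show ?thesis .
  qed
  have le: "(norm (U t))\<^sup>2 \<le> (norm (U s))\<^sup>2 + 2 * k" for s
    using U(4)[of s t] U(4)[of t s] ind[of s t] ind[of t s] by (cases "s \<le> t") auto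
  have int: "integrable ?M (\<lambda>s. b\<^sup>2 * (norm (u s))\<^sup>2 + 2 * k)"
    using u by (intro Bochner_Integration.integrable_add integrable_mult_right
        finite_measure.integrable_const[OF finite_measure_timeM]) (simp add: L2_def)
  have meas: "measure ?M (space ?M) = T"
    using T by (simp add: measure_restrict_space)
  have "(\<integral>s. (norm (U t))\<^sup>2 \<partial>?M) \<le> (\<integral>s. b\<^sup>2 * (norm (u s))\<^sup>2 + 2 * k \<partial>?M)"
  proof (rule integral_mono_AE[OF finite_measure.integrable_const[OF finite_measure_timeM] int])
    show "AE s in ?M. (norm (U t))\<^sup>2 \<le> b\<^sup>2 * (norm (u s))\<^sup>2 + 2 * k"
      using U(2)
    proof eventually_elim
      case (elim s)
      have "(norm (U s))\<^sup>2 \<le> (b * norm (u s))\<^sup>2" using b(2) elim by (intro power_mono) auto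
      then show ?case using le[of s] by (simp add: power_mult_distrib)
    qed
  qed
  also have "\<dots> = (\<integral>s. b\<^sup>2 * (norm (u s))\<^sup>2 \<partial>?M) + (\<integral>s. 2 * k \<partial>?M)"
    using u by (intro Bochner_Integration.integral_add integrable_mult_right
        finite_measure.integrable_const[OF finite_measure_timeM]) (simp add: L2_def)
  also have "\<dots> = b\<^sup>2 * (L2.N T u)\<^sup>2 + T * (2 * k)"
    using meas by (simp add: L2_N_sq)
  finally have "T * (norm (U t))\<^sup>2 \<le> b\<^sup>2 * (L2.N T u)\<^sup>2 + T * (2 * k)" using meas by simp
  then have "(norm (U t))\<^sup>2 \<le> b\<^sup>2 / T * (L2.N T u)\<^sup>2 + 2 * k" using T by (simp add: field_simps)
  then show ?thesis using U(3)[OF t] by (simp add: k_def)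
qed

end

section \<open>The parabolic problem\<close>

locale parabolic_problem = parabolic T a K c + hilbert_embedding j
  for T :: real and a :: "real \<Rightarrow> 'v::{real_inner, banach, second_countable_topology} \<Rightarrow> 'v \<Rightarrow> real" and K c
    and j :: "'v \<Rightarrow> 'h::{real_inner, banach, second_countable_topology}" +
  fixes \<beta> :: real
  assumes T: "T > 0" and \<beta>: "\<beta> \<ge> 1"
begin

abbreviation X :: "(real \<Rightarrow> 'v) set" where "X \<equiv> spaceX T j"
abbreviation dt where "dt \<equiv> op_dt T j"
abbreviation tr where "tr \<equiv> trace_map T j"

lemma X_subset: "X \<subseteq> Y" by (auto simp: spaceX_def)

lemma X_mem: "u \<in> X \<Longrightarrow> v \<in> X \<Longrightarrow> u + v \<in> X" "u \<in> X \<Longrightarrow> r *\<^sub>R u \<in> X" "u \<in> X \<Longrightarrow> v \<in> X \<Longrightarrow> u - v \<in> X"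
  using subspace_add[OF subspace_spaceX] subspace_scale[OF subspace_spaceX] subspace_diff[OF subspace_spaceX]
  by auto

lemma spaceXE: assumes "u \<in> X" obtains r where "weak T u r"
  using assms unfolding spaceX_iff by blast

lemma dt_add_left: "u \<in> X \<Longrightarrow> u' \<in> X \<Longrightarrow> v \<in> Y \<Longrightarrow> dt (u + u') v = dt u v + dt u' v"
  by (elim spaceXE) (simp add: op_dt_eq[OF T weak_add] op_dt_eq[OF T] L2.add_left)

lemma dt_scale_left: "u \<in> X \<Longrightarrow> v \<in> Y \<Longrightarrow> dt (r *\<^sub>R u) v = r * dt u v"
  by (elim spaceXE) (simp add: op_dt_eq[OF T weak_scale] op_dt_eq[OF T] L2.scale_left)

lemma dt_add_right: "u \<in> X \<Longrightarrow> v \<in> Y \<Longrightarrow> v' \<in> Y \<Longrightarrow> dt u (v + v') = dt u v + dt u v'"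
  by (elim spaceXE) (simp add: op_dt_eq[OF T] L2.add_right L2_add)

lemma dt_scale_right: "u \<in> X \<Longrightarrow> v \<in> Y \<Longrightarrow> dt u (r *\<^sub>R v) = r * dt u v"
  by (elim spaceXE) (simp add: op_dt_eq[OF T] L2.scale_right L2_scale)

lemma dt_bound:
  assumes w: "weak T u r" and v: "v \<in> Y" shows "\<bar>dt u v\<bar> \<le> L2.N T r / sqrt c * As.N v"
proof -
  have "\<bar>dt u v\<bar> \<le> L2.N T r * L2.N T v"
    using op_dt_eq[OF T w v] L2.Cauchy_Schwarz[OF L2_mem(2)[OF w] v] by simp
  also have "\<dots> \<le> L2.N T r * (As.N v / sqrt c)"
    using w by (intro mult_left_mono L2_le_As v) auto
  finally show ?thesis by simp
qed

lemma dt_functional: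
  assumes Z: "semi_inner Z (opAs T a)" "Z \<subseteq> Y" and u: "u \<in> X"
  shows "semi_inner.bounded_functional Z (opAs T a) (dt u)"
proof -
  obtain r where w: "weak T u r" using u by (rule spaceXE)
  show ?thesis
    using Z(2) u dt_bound[OF w]
    by (intro semi_inner.bounded_functionalI[OF Z(1), where K = "L2.N T r / sqrt c"])
      (auto simp: dt_add_right dt_scale_right subset_iff)
qed

text \<open>The lift of the time derivative to the whole of Y. It makes the squared dual norm of the
  time derivative the diagonal of the symmetric form \<open>D\<close>.\<close>

definition R where "R u = riesz_lift T a Y (dt u)"
definition D where "D u w = opAs T a (R u) (R w)"
definition G where "G u w = tr T u \<bullet> tr T w + (\<beta> - 1) * (tr 0 u \<bullet> tr 0 w)"

lemma R: "u \<in> X \<Longrightarrow> R u \<in> Y" "u \<in> X \<Longrightarrow> v \<in> Y \<Longrightarrow> opAs T a (R u) v = dt u v"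
  using riesz_lift[OF As.semi_inner_axioms As_complete dt_functional[OF As.semi_inner_axioms order_refl]]
  by (auto simp: R_def)

lemma D_eq: "u \<in> X \<Longrightarrow> w \<in> X \<Longrightarrow> D u w = dt u (R w)"
  by (simp add: D_def R)

sublocale X\<^sub>D: semi_inner X D
proof
  fix x y z and r :: real
  assume xy: "x \<in> X" "y \<in> X"
  show "z \<in> X \<Longrightarrow> D (x + y) z = D x z + D y z" using xy by (simp add: D_eq X_mem dt_add_left R)
  show "D (r *\<^sub>R x) y = r * D x y" using xy by (simp add: D_eq X_mem dt_scale_left R)
  show "D x y = D y x" unfolding D_def using xy R by (intro As.sym)
  show "0 \<le> D x x" using xy As.nonneg[OF R(1)] by (simp add: D_def)
qed (rule subspace_spaceX)

sublocale X\<^sub>G: semi_inner X G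
proof
  fix x y z and r :: real
  assume xy: "x \<in> X" "y \<in> X"
  have t: "0 \<in> {0..T}" "T \<in> {0..T}" using T by auto
  show "z \<in> X \<Longrightarrow> G (x + y) z = G x z + G y z" using xy
    by (simp add: G_def trace_add[OF T _ _ t(1)] trace_add[OF T _ _ t(2)] inner_add_left algebra_simps)
  show "G (r *\<^sub>R x) y = r * G x y" using xy
    by (simp add: G_def trace_scale[OF T _ t(1)] trace_scale[OF T _ t(2)] algebra_simps)
  show "G x y = G y x" by (simp add: G_def inner_commute)
  show "0 \<le> G x x" using \<beta> by (simp add: G_def)
qed (rule subspace_spaceX)

lemma D_N: "X\<^sub>D.N u = As.N (R u)" by (simp add: X\<^sub>D.N_def As.N_def D_def)

lemma dt_le_D: "u \<in> X \<Longrightarrow> v \<in> Y \<Longrightarrow> \<bar>dt u v\<bar> \<le> X\<^sub>D.N u * As.N v"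
  using As.Cauchy_Schwarz[OF R(1), of u v] R(2)[of u v] by (simp add: D_N)

lemma dual_norm_dt: "u \<in> X \<Longrightarrow> dual_norm T a (spaceY T) (dt u) = X\<^sub>D.N u"
  using dual_norm_eq[OF As.semi_inner_axioms As_complete dt_functional[OF As.semi_inner_axioms order_refl]]
  by (simp add: D_N R_def spaceY_def)

definition P where "P u w = opAs T a u w + D u w + G u w"

sublocale X: semi_inner X P
  unfolding P_def[abs_def]
  by (intro semi_inner_sum X\<^sub>D.semi_inner_axioms X\<^sub>G.semi_inner_axioms
      semi_inner_subset[OF As.semi_inner_axioms subspace_spaceX X_subset])

lemma normX_eq: "u \<in> X \<Longrightarrow> normX T j a \<beta> u = X.N u"
  using As.nonneg[of u] X_subset X\<^sub>D.nonneg[of u]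
  by (auto simp: normX_def X.N_def P_def dual_norm_dt normY_def G_def dot_square_norm X\<^sub>D.N_sq)

lemma As_le_X: assumes "u \<in> X" shows "As.N u \<le> X.N u"
  unfolding As.N_def X.N_def P_def using X\<^sub>D.nonneg[OF assms] X\<^sub>G.nonneg[OF assms] by simp

lemma D_le_X: assumes "u \<in> X" shows "X\<^sub>D.N u \<le> X.N u"
  unfolding X\<^sub>D.N_def X.N_def P_def using As.nonneg[of u] X_subset assms X\<^sub>G.nonneg[OF assms] by auto

text \<open>The dual norm refers to the energy norm of Y and the L2 norm of r to the standard one.
  Testing the time derivative with r itself gives this half of their equivalence.\<close>

lemma weak_le_D:
  assumes w: "weak T u r" shows "L2.N T r \<le> sqrt K * X\<^sub>D.N u"
proof -
  have u: "u \<in> X" using w by (auto simp: spaceX_iff)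
  have r: "r \<in> Y" using w by simp
  have "L2.N T r * L2.N T r = dt u r"
    using op_dt_eq[OF T w r] L2.N_sq[OF r] by (simp add: power2_eq_square)
  also have "\<dots> \<le> X\<^sub>D.N u * As.N r" using dt_le_D[OF u r] by simp
  also have "\<dots> \<le> X\<^sub>D.N u * (sqrt K * L2.N T r)"
    using u by (intro mult_left_mono As_le r) simp
  finally have le: "L2.N T r * L2.N T r \<le> (sqrt K * X\<^sub>D.N u) * L2.N T r" by (simp add: mult_ac)
  have "0 \<le> sqrt K * X\<^sub>D.N u" using K u by simp
  then show ?thesis
    using mult_right_le_imp_le[OF le] L2.N_nonneg[OF r] by (cases "L2.N T r = 0") auto
qed

lemma D_le_weak:
  assumes w: "weak T u r" shows "X\<^sub>D.N u \<le> L2.N T r / sqrt c"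
proof -
  have u: "u \<in> X" using w by (auto simp: spaceX_iff)
  have "X\<^sub>D.N u * X\<^sub>D.N u = dt u (R u)"
    using X\<^sub>D.N_sq[OF u] D_eq[OF u u] by (simp add: power2_eq_square)
  also have "\<dots> \<le> L2.N T r / sqrt c * X\<^sub>D.N u"
    using dt_bound[OF w R(1)[OF u]] by (simp add: D_N)
  finally have le: "X\<^sub>D.N u * X\<^sub>D.N u \<le> L2.N T r / sqrt c * X\<^sub>D.N u" .
  have "0 \<le> L2.N T r / sqrt c" using c w by simp
  then show ?thesis
    using mult_right_le_imp_le[OF le] X\<^sub>D.N_nonneg[OF u] by (cases "X\<^sub>D.N u = 0") auto
qed

text \<open>The functions and their weak derivatives converge separately in L2, and the weak
  derivative is closed, so the limit lies in X. Convergence of the traces follows from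
  \<open>trace_bound\<close>.\<close>

theorem X_complete: "X.seq_complete"
  unfolding X.seq_complete_def
proof (intro allI impI)
  fix f :: "nat \<Rightarrow> real \<Rightarrow> 'v"
  assume "\<forall>n. f n \<in> X" and cau: "\<forall>e>0. \<exists>n0. \<forall>m\<ge>n0. \<forall>n\<ge>n0. X.N (f m - f n) < e"
  then have f: "f n \<in> X" for n by auto
  then have "\<forall>n. \<exists>r. weak T (f n) r" by (simp add: spaceX_iff)
  then obtain r where r: "\<And>n. weak T (f n) (r n)" by metis
  have fd: "f m - f n \<in> X" for m n using f by (intro X_mem)
  have transfer: "\<exists>x\<in>Y. (\<lambda>n. L2.N T (h n - x)) \<longlonglongrightarrow> 0"
    if h: "\<And>n. h n \<in> Y" and le: "\<And>m n. L2.N T (h m - h n) \<le> k * X.N (f m - f n)" and k: "k > 0" for h k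
  proof -
    from Cauchy_dominated[OF cau le k] show ?thesis
      using L2_complete[of T] h unfolding L2.seq_complete_def by blast
  qed
  have fY: "f n \<in> Y" for n using f X_subset by blast
  have le: "L2.N T (f m - f n) \<le> 1 / sqrt c * X.N (f m - f n)" for m n
  proof -
    have "L2.N T (f m - f n) \<le> As.N (f m - f n) / sqrt c" using fd X_subset by (intro L2_le_As) auto
    also have "\<dots> \<le> X.N (f m - f n) / sqrt c" using As_le_X[OF fd] c by (intro divide_right_mono) auto
    finally show ?thesis by simp
  qed
  from transfer[OF fY le] c obtain u where u: "u \<in> Y" "(\<lambda>n. L2.N T (f n - u)) \<longlonglongrightarrow> 0"
    by auto
  have "L2.N T (r m - r n) \<le> sqrt K * X.N (f m - f n)" for m n
  proof -
    have "L2.N T (r m - r n) \<le> sqrt K * X\<^sub>D.N (f m - f n)" by (intro weak_le_D weak_diff r)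
    also have "\<dots> \<le> sqrt K * X.N (f m - f n)" using K by (intro mult_left_mono D_le_X fd) auto
    finally show ?thesis .
  qed
  then obtain q where q: "q \<in> Y" "(\<lambda>n. L2.N T (r n - q)) \<longlonglongrightarrow> 0"
    using transfer[of r "sqrt K"] L2_mem(2)[OF r] K by auto
  have w: "weak T u q" by (rule weak_limit[OF r u(1) q(1) u(2) q(2)])
  then have uX: "u \<in> X" by (auto simp: spaceX_iff)
  have fu: "f n - u \<in> X" for n using f uX by (intro X_mem)
  have wd: "weak T (f n - u) (r n - q)" for n by (intro weak_diff r w)
  have fuY: "f n - u \<in> Y" for n using fu X_subset by auto
  have "(\<lambda>n. As.N (f n - u)) \<longlonglongrightarrow> 0"
    by (rule tendsto_0_dominated[OF u(2) As.N_nonneg[OF fuY] As_le[OF fuY]])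
  from tendsto_power[OF this, of 2] have lim_As: "(\<lambda>n. opAs T a (f n - u) (f n - u)) \<longlonglongrightarrow> 0"
    by (simp add: As.N_sq[OF fuY])
  have "(\<lambda>n. X\<^sub>D.N (f n - u)) \<longlonglongrightarrow> 0"
    using D_le_weak[OF wd]
    by (intro tendsto_0_dominated[OF q(2) X\<^sub>D.N_nonneg[OF fu], where k = "1 / sqrt c"]) simp
  from tendsto_power[OF this, of 2] have lim_D: "(\<lambda>n. D (f n - u) (f n - u)) \<longlonglongrightarrow> 0"
    by (simp add: X\<^sub>D.N_sq[OF fu])
  have lim_tr: "(\<lambda>n. (norm (tr t (f n - u)))\<^sup>2) \<longlonglongrightarrow> 0" if t: "t \<in> {0..T}" for t
  proof (rule real_tendsto_sandwich[OF _ _ tendsto_const])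
    show "\<forall>\<^sub>F n in sequentially. (norm (tr t (f n - u)))\<^sup>2
        \<le> b\<^sup>2 / T * (L2.N T (f n - u))\<^sup>2 + 2 * (L2.N T (r n - q) * L2.N T (f n - u))"
      by (intro always_eventually allI trace_bound[OF T wd t])
    have "(\<lambda>n. b\<^sup>2 / T * (L2.N T (f n - u))\<^sup>2 + 2 * (L2.N T (r n - q) * L2.N T (f n - u)))
      \<longlonglongrightarrow> b\<^sup>2 / T * 0\<^sup>2 + 2 * (0 * 0)"
      by (intro tendsto_intros u(2) q(2))
    then show "(\<lambda>n. b\<^sup>2 / T * (L2.N T (f n - u))\<^sup>2 + 2 * (L2.N T (r n - q) * L2.N T (f n - u))) \<longlonglongrightarrow> 0"
      by simp
  qed simp
  have "(\<lambda>n. G (f n - u) (f n - u)) \<longlonglongrightarrow> 0 + (\<beta> - 1) * 0"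
    unfolding G_def dot_square_norm using T by (intro tendsto_intros lim_tr) auto
  from tendsto_add[OF tendsto_add[OF lim_As lim_D] this]
  have "(\<lambda>n. sqrt (P (f n - u) (f n - u))) \<longlonglongrightarrow> sqrt 0"
    unfolding P_def by (intro tendsto_real_sqrt) simp
  then have "(\<lambda>n. X.N (f n - u)) \<longlonglongrightarrow> 0" by (simp add: X.N_def)
  then show "\<exists>x\<in>X. (\<lambda>n. X.N (f n - x)) \<longlonglongrightarrow> 0" using uX by blast
qed

lemma Xs_complete:
  assumes cl: "closed_nonzero_subspace T (normX T j a \<beta>) X Xs"
  shows "semi_inner.seq_complete Xs P"
proof (rule X.seq_complete_subset[OF X_complete])
  note cls = closed_subspace[OF cl]
  show "Xs \<subseteq> X" "subspace Xs" by (fact cls)+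
  fix f :: "nat \<Rightarrow> real \<Rightarrow> 'v" and x
  assume f: "\<And>n. f n \<in> Xs" and x: "x \<in> X" and lim: "(\<lambda>n. X.N (f n - x)) \<longlonglongrightarrow> 0"
  have "f n - x \<in> X" for n using f x cls(2) by (intro X_mem) auto
  then have "(\<lambda>n. normX T j a \<beta> (f n - x)) \<longlonglongrightarrow> 0" using lim by (simp add: normX_eq)
  with f x show "x \<in> Xs" by (rule cls(3))
qed

section \<open>Consistency and the error bound\<close>

text \<open>Polarisation of the energy identity.\<close>

lemma integration_by_parts:
  assumes u: "u \<in> X" and w: "w \<in> X"
  shows "tr T u \<bullet> tr T w - tr 0 u \<bullet> tr 0 w = dt u w + dt w u"
proof -
  have t: "0 \<in> {0..T}" "T \<in> {0..T}" using T by auto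
  have uY: "u \<in> Y" "w \<in> Y" using u w X_subset by auto
  have "(norm (tr T u + tr T w))\<^sup>2 - (norm (tr 0 u + tr 0 w))\<^sup>2 = 2 * dt (u + w) (u + w)"
    using energy_identity[OF T X_mem(1)[OF u w]] trace_add[OF T u w t(1)] trace_add[OF T u w t(2)] by simp
  also have "dt (u + w) (u + w) = dt u u + dt u w + (dt w u + dt w w)"
    using u w uY by (simp add: dt_add_left dt_add_right L2_add)
  finally show ?thesis
    using energy_identity[OF T u] energy_identity[OF T w]
    by (simp add: dot_square_norm[symmetric] inner_add_left inner_add_right inner_commute)
qed

theorem error_bound:
  assumes Xs: "closed_nonzero_subspace T (normX T j a \<beta>) X Xs"
    and Ys: "closed_nonzero_subspace T (normY T a) (spaceY T) Ys"
    and \<gamma>: "0 < \<gamma>"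
    and inf_sup: "\<And>w. w \<in> Xs \<Longrightarrow> \<exists>v\<in>spaceY T. dt w v \<noteq> 0 \<Longrightarrow>
       \<gamma> \<le> ereal (dual_norm T a Ys (dt w) / dual_norm T a (spaceY T) (dt w))"
    and u: "u \<in> X" and eq: "\<And>v. v \<in> Y \<Longrightarrow> opB T j a u v = g v"
  defines "\<alpha> \<equiv> op_normY T a (opAa T a)"
  shows "\<exists>ub. BEN_solution T j a \<beta> g (tr 0 u) Xs Ys ub \<and>
     (\<forall>ub'. BEN_solution T j a \<beta> g (tr 0 u) Xs Ys ub' \<longrightarrow> (AE t in timeM T. ub' t = ub t)) \<and>
     (\<forall>w\<in>Xs. \<forall>v\<in>Ys. normX T j a \<beta> (\<lambda>t. u t - ub t) \<le>
       ((1 + 1/2 * (\<alpha>\<^sup>2 + \<alpha> * sqrt (\<alpha>\<^sup>2 + 4))) * normX T j a \<beta> (\<lambda>t. u t - w t)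
        + sqrt (1 + \<alpha>\<^sup>2) * normY T a (\<lambda>t. u t - v t)) / stab_const \<alpha> \<gamma>)" "0 < stab_const \<alpha> \<gamma>"
proof -
  note Xs' = closed_subspace[OF Xs] and Ys' = closed_subspace[OF Ys, unfolded spaceY_def]
  note Ysc = Ys_complete[OF Ys]
  have \<alpha>: "0 \<le> \<alpha>" and \<alpha>b: "\<And>w v. w \<in> Y \<Longrightarrow> v \<in> Y \<Longrightarrow> \<bar>opAa T a w v\<bar> \<le> \<alpha> * As.N w * As.N v"
    using opAa_bound[OF As.mem(4) As.mem(4)] opAa_bound(1) by (auto simp: \<alpha>_def)
  define \<mu> where "\<mu> = stab_const \<alpha> \<gamma>"
  \<comment> \<open>The premise guarded by \<open>X\<^sub>D.N w \<noteq> 0\<close> covers finite and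
    infinite \<gamma> alike: the inf-sup quotient is available only where the time derivative does
    not vanish.\<close>
  have stab: "0 < \<mu> \<and> \<mu> \<le> 1 \<and> (\<forall>w p. w \<in> Xs \<longrightarrow> 0 \<le> p \<longrightarrow>
      (X\<^sub>D.N w \<noteq> 0 \<longrightarrow> As.N (riesz_lift T a Ys (dt w)) \<le> p + \<alpha> * As.N w) \<longrightarrow>
      \<mu> * (D w w + opAs T a w w) \<le> p\<^sup>2 + opAs T a w w)"
  proof (cases "\<gamma> = \<infinity>")
    case True
    have "D w w = 0" if w: "w \<in> Xs" for w
    proof -
      have wX: "w \<in> X" using w Xs' by auto
      \<comment> \<open>An infinite \<gamma> cannot lie below a real quotient, so there is no w to
        which the inf-sup condition applies.\<close>
      have "\<not> (\<exists>v\<in>spaceY T. dt w v \<noteq> 0)" using inf_sup[OF w] True by auto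
      then show ?thesis using D_eq[OF wX wX] R(1)[OF wX] by (simp add: spaceY_def)
    qed
    then show ?thesis using True by (simp add: \<mu>_def stab_const_def)
  next
    case False
    then obtain k where k: "\<gamma> = ereal k" "k > 0" using \<gamma> by (cases \<gamma>) auto
    have \<mu>_eq: "\<mu> = 1/2 * (k\<^sup>2 + \<alpha>\<^sup>2 + 1 - sqrt ((k\<^sup>2 + \<alpha>\<^sup>2 + 1)\<^sup>2 - 4 * k\<^sup>2))"
      by (simp add: \<mu>_def stab_const_def k Let_def)
    note cl = coupling_lower_bound[OF k(2) \<alpha>, folded \<mu>_eq]
    show ?thesis
    proof (intro conjI allI impI cl(1,2))
      fix w p
      assume w: "w \<in> Xs" and p: "0 \<le> p"
        and le: "X\<^sub>D.N w \<noteq> 0 \<longrightarrow> As.N (riesz_lift T a Ys (dt w)) \<le> p + \<alpha> * As.N w"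
      have wX: "w \<in> X" and wY: "w \<in> Y" using w Xs' X_subset by auto
      have "k * X\<^sub>D.N w \<le> p + \<alpha> * As.N w"
      proof (cases "X\<^sub>D.N w = 0")
        case True
        then show ?thesis using p \<alpha> wY by simp
      next
        case False
        then have "dt w (R w) \<noteq> 0" using D_eq[OF wX wX] by (auto simp: X\<^sub>D.N_def)
        then have "\<exists>v\<in>spaceY T. dt w v \<noteq> 0" using R(1)[OF wX] by (auto simp: spaceY_def)
        from inf_sup[OF w this]
        have "k \<le> As.N (riesz_lift T a Ys (dt w)) / X\<^sub>D.N w"
          using dual_norm_eq[OF Ysc dt_functional[OF Ysc(1) Ys'(2) wX]] dual_norm_dt[OF wX] by (simp add: k)
        then have "k * X\<^sub>D.N w \<le> As.N (riesz_lift T a Ys (dt w))"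
          using False X\<^sub>D.N_nonneg[OF wX] by (simp add: pos_le_divide_eq)
        then show ?thesis using le False by simp
      qed
      from cl(3)[OF X\<^sub>D.N_nonneg[OF wX] As.N_nonneg[OF wY] p this]
      show "\<mu> * (D w w + opAs T a w w) \<le> p\<^sup>2 + opAs T a w w"
        by (simp add: X\<^sub>D.N_sq[OF wX] As.N_sq[OF wY])
    qed
  qed
  then show "0 < stab_const \<alpha> \<gamma>" by (simp add: \<mu>_def)
  interpret Ys: semi_inner Ys "opAs T a" by (rule Ysc(1))
  interpret B: discrete_BEN Y X Ys "opAs T a" D G Xs dt "opAa T a" "riesz_lift T a Ys" \<alpha> \<mu>
  proof unfold_locales
    show "X \<subseteq> Y" "Ys \<subseteq> Y" "subspace Xs" "Xs \<subseteq> X" "0 \<le> \<alpha>" "0 < \<mu>" "\<mu> \<le> 1"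
      using X_subset Ys' Xs' \<alpha> stab by auto
    show "semi_inner.seq_complete Xs (\<lambda>w v. opAs T a w v + D w v + G w v)"
      using Xs_complete[OF Xs] by (simp add: P_def[abs_def])
    show "\<mu> * (D w w + opAs T a w w) \<le> p\<^sup>2 + opAs T a w w"
      if "w \<in> Xs" "0 \<le> p" "X\<^sub>D.N w \<noteq> 0 \<Longrightarrow> As.N (riesz_lift T a Ys (dt w)) \<le> p + \<alpha> * As.N w" for w p
      using stab that by blast
    show "riesz_lift T a Ys f \<in> Ys" if "Ys.bounded_functional f" for f
      using riesz_lift(1)[OF Ysc that] .
    show "opAs T a (riesz_lift T a Ys f) v = f v" if "Ys.bounded_functional f" "v \<in> Ys" for f v
      using riesz_lift(2)[OF Ysc that] .
    show "\<bar>dt w v\<bar> \<le> X\<^sub>D.N w * As.N v" if "w \<in> X" "v \<in> Y" for w v using dt_le_D[OF that] .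
    show "\<bar>opAa T a w v\<bar> \<le> \<alpha> * As.N w * As.N v" if "w \<in> Y" "v \<in> Y" for w v using \<alpha>b[OF that] .
  qed (simp_all add: dt_add_left dt_scale_left dt_add_right dt_scale_right opAa_def
      opA_adj_def opA_bil field_simps)
  have C_eq: "B.C w = opC T j a w" for w
    by (simp add: fun_eq_iff B.C_def opC_def opB_def opAs_def opAa_def field_simps)
  have P_eq: "B.P = P" by (simp add: fun_eq_iff B.P_def P_def)
  have uY: "u \<in> Y" using u X_subset by auto
  let ?L = "riesz_lift T a Ys"
  define f where "f w = opC T j a w (?L g) + g w + \<beta> * (tr 0 u \<bullet> tr 0 w)" for w
  have g_eq: "g v = B.C u v + opAs T a u v" if "v \<in> Y" for v
    using eq[OF that] by (simp add: C_eq opC_def)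
  have g_functional: "Ys.bounded_functional g"
  proof -
    have "Ys.bounded_functional (\<lambda>v. B.C u v + opAs T a u v)"
      by (rule B.functional_add[OF B.C_functional[OF u] B.A_functional[OF uY]])
    then show ?thesis
      using g_eq Ys'(2) Ys.mem unfolding Ys.bounded_functional_def by (simp add: subset_iff)
  qed
  have sol: "BEN_solution T j a \<beta> g (tr 0 u) Xs Ys x \<longleftrightarrow> x \<in> Xs \<and> (\<forall>w\<in>Xs. B.b x w = f w)" for x
    by (simp add: BEN_solution_def f_def B.b_def C_eq G_def algebra_simps)
  have rhs: "f w = B.b u w - B.C w (u - ?L (opAs T a u))" if w: "w \<in> Xs" for w
  proof -
    have wX: "w \<in> X" and wY: "w \<in> Y" using w Xs' X_subset by auto
    have LY: "?L (opAs T a u) \<in> Y" using B.lift_mem[OF B.A_functional[OF uY]] Ys' by auto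
    have LC: "?L (B.C w) \<in> Ys" using B.LC[OF wX] by simp
    \<comment> \<open>Moving h out of the lift allows the decomposition of g to be used without
      additivity of the lift.\<close>
    have swap: "B.C w (?L h) = h (?L (B.C w))" if h: "Ys.bounded_functional h" for h
    proof -
      have "B.C w (?L h) = opAs T a (?L (B.C w)) (?L h)"
        using B.lift_eq[OF B.C_functional[OF wX] B.lift_mem[OF h]] by simp
      also have "\<dots> = opAs T a (?L h) (?L (B.C w))" by (intro Ys.sym LC B.lift_mem[OF h])
      also have "\<dots> = h (?L (B.C w))" by (rule B.lift_eq[OF h LC])
      finally show ?thesis .
    qed
    have "B.C w (?L g) = B.C w (?L (B.C u)) + B.C w (?L (opAs T a u))"
      unfolding swap[OF g_functional] swap[OF B.C_functional[OF u]] swap[OF B.A_functional[OF uY]]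
      by (rule g_eq[OF subsetD[OF Ys'(2) LC]])
    moreover have "B.C w (u - ?L (opAs T a u)) = B.C w u - B.C w (?L (opAs T a u))"
    proof -
      have "B.C w (u - ?L (opAs T a u) + ?L (opAs T a u)) = B.C w (u - ?L (opAs T a u)) + B.C w (?L (opAs T a u))"
        using wX wY uY LY unfolding B.C_def by (simp only: dt_add_right B.s_add2 L2_diff)
      then show ?thesis by simp
    qed
    moreover have "B.C w u = dt w u - opAa T a u w" using B.s_skew[OF wY uY] by (simp add: B.C_def)
    moreover have "g w = dt u w + opAa T a u w + opAs T a u w" using g_eq[OF wY] by (simp add: B.C_def)
    ultimately show ?thesis
      \<comment> \<open>Of the factor \<beta> in front of the initial value, \<beta> - 1 matches
        \<open>b\<close>; the remaining 1 combines with the final trace into both time derivatives,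
        leaving - \<open>B.C w u\<close> because \<open>opAa\<close> is skew.\<close>
      using integration_by_parts[OF u wX] unfolding f_def B.b_def C_eq[symmetric] G_def
      by (simp add: algebra_simps)
  qed
  \<comment> \<open>Translates uniqueness up to seminorm zero into equality almost
    everywhere.\<close>
  have AE_0: "AE t in timeM T. x t = 0" if x: "x \<in> X" and 0: "X.N x = 0" for x
  proof -
    have xY: "x \<in> Y" using x X_subset by auto
    have "L2.N T x \<le> 0" using L2_le_As[OF xY] As_le_X[OF x] 0 c As.N_nonneg[OF xY] by simp
    then have "(\<integral>t. (norm (x t))\<^sup>2 \<partial>timeM T) = 0"
      using L2.N_nonneg[OF xY] L2_N_sq[of T x] by simp
    then show ?thesis
      using xY by (subst (asm) integral_nonneg_eq_0_iff_AE) (auto simp: L2_def)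
  qed
  have "\<exists>x\<in>Xs. X.N x \<noteq> 0" using Xs'(2,4) AE_0 by (meson subsetD)
  from B.quasi_optimality[unfolded P_eq, OF u this rhs]
  obtain x where x: "x \<in> Xs" "\<forall>w\<in>Xs. B.b x w = f w"
    and uniq: "\<And>x'. x' \<in> Xs \<Longrightarrow> \<forall>w\<in>Xs. B.b x' w = f w \<Longrightarrow> X.N (x' - x) = 0"
    and bound: "\<And>w v. w \<in> Xs \<Longrightarrow> v \<in> Ys \<Longrightarrow> X.N (u - x) \<le> (B.M * X.N (u - w) + sqrt (1 + \<alpha>\<^sup>2) * As.N (u - v)) / \<mu>"
    by blast
  have xX: "x \<in> X" using x Xs' by auto
  show "\<exists>ub. BEN_solution T j a \<beta> g (tr 0 u) Xs Ys ub \<and>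
     (\<forall>ub'. BEN_solution T j a \<beta> g (tr 0 u) Xs Ys ub' \<longrightarrow> (AE t in timeM T. ub' t = ub t)) \<and>
     (\<forall>w\<in>Xs. \<forall>v\<in>Ys. normX T j a \<beta> (\<lambda>t. u t - ub t) \<le>
       ((1 + 1/2 * (\<alpha>\<^sup>2 + \<alpha> * sqrt (\<alpha>\<^sup>2 + 4))) * normX T j a \<beta> (\<lambda>t. u t - w t)
        + sqrt (1 + \<alpha>\<^sup>2) * normY T a (\<lambda>t. u t - v t)) / stab_const \<alpha> \<gamma>)"
  proof (intro exI[of _ x] conjI allI impI ballI)
    show "BEN_solution T j a \<beta> g (tr 0 u) Xs Ys x" using x sol by blast
  next
    fix x' assume "BEN_solution T j a \<beta> g (tr 0 u) Xs Ys x'"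
    then have x': "x' \<in> Xs" "\<forall>w\<in>Xs. B.b x' w = f w" using sol by auto
    then have "x' - x \<in> X" using Xs' xX by (intro X_mem) auto
    from AE_0[OF this uniq[OF x']] show "AE t in timeM T. x' t = x t" by simp
  next
    fix w v assume w: "w \<in> Xs" and v: "v \<in> Ys"
    have wX: "w \<in> X" using w Xs' by auto
    have norms: "normX T j a \<beta> (\<lambda>t. u t - y t) = X.N (u - y)" if "y \<in> X" for y
      using normX_eq[OF X_mem(3)[OF u that]] by (simp add: fun_diff_def)
    have normYs: "normY T a (\<lambda>t. u t - v t) = As.N (u - v)" by (simp add: normY_eq fun_diff_def)
    show "normX T j a \<beta> (\<lambda>t. u t - x t) \<le>
       ((1 + 1/2 * (\<alpha>\<^sup>2 + \<alpha> * sqrt (\<alpha>\<^sup>2 + 4))) * normX T j a \<beta> (\<lambda>t. u t - w t)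
        + sqrt (1 + \<alpha>\<^sup>2) * normY T a (\<lambda>t. u t - v t)) / stab_const \<alpha> \<gamma>"
      using bound[OF w v] unfolding norms[OF xX] norms[OF wX] normYs B.M_def \<mu>_def .
  qed
qed

end

theorem theorem4p2:
  fixes T :: real
    and j :: "'v::{real_inner, banach, polish_space} \<Rightarrow> 'h::{real_inner, banach, polish_space}"
    and a :: "real \<Rightarrow> 'v \<Rightarrow> 'v \<Rightarrow> real"
    and \<Delta> :: "'d set"
    and Xd Yd :: "'d \<Rightarrow> (real \<Rightarrow> 'v) set"
    and \<beta> :: real
    and g :: "(real \<Rightarrow> 'v) \<Rightarrow> real"
    and u0 :: 'h
    and u :: "real \<Rightarrow> 'v"
  assumes "T > 0"
    and "gelfand_embedding j"
    and "parabolic_form T a"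
    and "\<beta> \<ge> 1"
    and "\<And>\<delta>. \<delta> \<in> \<Delta> \<Longrightarrow> closed_nonzero_subspace T (normX T j a \<beta>) (spaceX T j) (Xd \<delta>)"
    and "\<And>\<delta>. \<delta> \<in> \<Delta> \<Longrightarrow> closed_nonzero_subspace T (normY T a) (spaceY T) (Yd \<delta>)"
    and "inf_sup T j a \<Delta> Xd Yd > 0"
    and "g \<in> dualY T a"
    and "u \<in> spaceX T j"
    and "\<And>v. v \<in> spaceY T \<Longrightarrow> opB T j a u v = g v"
    and "trace_map T j 0 u = u0"
  shows "\<forall>\<delta>\<in>\<Delta>. \<exists>ub. BEN_solution T j a \<beta> g u0 (Xd \<delta>) (Yd \<delta>) ub \<and>
     (\<forall>ub'. BEN_solution T j a \<beta> g u0 (Xd \<delta>) (Yd \<delta>) ub' \<longrightarrow> (AE t in timeM T. ub' t = ub t)) \<and>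
     (let \<alpha> = op_normY T a (opAa T a); \<gamma> = inf_sup T j a \<Delta> Xd Yd in
       normX T j a \<beta> (\<lambda>t. u t - ub t)
       \<le> ((1 + 1/2 * (\<alpha>\<^sup>2 + \<alpha> * sqrt (\<alpha>\<^sup>2 + 4))) * (INF w\<in>Xd \<delta>. normX T j a \<beta> (\<lambda>t. u t - w t))
            + sqrt (1 + \<alpha>\<^sup>2) * (INF v\<in>Yd \<delta>. normY T a (\<lambda>t. u t - v t)))
          / stab_const \<alpha> \<gamma>)"
proof (rule ballI, goal_cases)
  case \<delta>: (1 \<delta>)
  obtain K c where Kc: "K > 0" "c > 0" "AE t in timeM T. bilinear (a t) \<and>
      (\<forall>\<eta> \<zeta>. \<bar>a t \<eta> \<zeta>\<bar> \<le> K * norm \<eta> * norm \<zeta>) \<and> (\<forall>\<eta>. a t \<eta> \<eta> \<ge> c * (norm \<eta>)\<^sup>2)"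
    using assms(3) unfolding parabolic_form_def by blast
  interpret parabolic_problem T a K c j \<beta>
  proof (intro parabolic_problem.intro parabolic.intro hilbert_embedding.intro
      parabolic_problem_axioms.intro Kc assms(1,4))
    show "bounded_linear j" "inj j" using assms(2) by (auto simp: gelfand_embedding_def)
    show "(\<lambda>t. a t \<eta> \<zeta>) \<in> borel_measurable (timeM T)" for \<eta> \<zeta>
      using assms(3) by (simp add: parabolic_form_def)
  qed
  define \<alpha> \<gamma> where "\<alpha> = op_normY T a (opAa T a)" and "\<gamma> = inf_sup T j a \<Delta> Xd Yd"
  have inf_sup_le: "\<gamma> \<le> ereal (dual_norm T a (Yd \<delta>) (op_dt T j w) / dual_norm T a (spaceY T) (op_dt T j w))"
    if "w \<in> Xd \<delta>" "\<exists>v\<in>spaceY T. op_dt T j w v \<noteq> 0" for w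
    unfolding \<gamma>_def inf_sup_def using that \<delta> by (intro INF_lower2[of \<delta>] INF_lower) auto
  have \<gamma>: "0 < \<gamma>" using assms(7) by (simp add: \<gamma>_def)
  have eq: "opB T j a u v = g v" if "v \<in> L2 T" for v using assms(10) that by (simp add: spaceY_def)
  note eb = error_bound[OF assms(5)[OF \<delta>] assms(6)[OF \<delta>] \<gamma> inf_sup_le assms(9) eq, folded \<alpha>_def,
      unfolded assms(11)]
  define M where "M = 1 + 1/2 * (\<alpha>\<^sup>2 + \<alpha> * sqrt (\<alpha>\<^sup>2 + 4))"
  have \<alpha>0: "0 \<le> \<alpha>" using opAa_bound(2)[OF As.mem(4) As.mem(4)] by (simp add: \<alpha>_def)
  then have M: "M > 0" unfolding M_def by (intro add_pos_nonneg) auto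
  obtain ub where ub: "BEN_solution T j a \<beta> g u0 (Xd \<delta>) (Yd \<delta>) ub"
    "\<forall>ub'. BEN_solution T j a \<beta> g u0 (Xd \<delta>) (Yd \<delta>) ub' \<longrightarrow> (AE t in timeM T. ub' t = ub t)"
    and bound: "\<And>w v. w \<in> Xd \<delta> \<Longrightarrow> v \<in> Yd \<delta> \<Longrightarrow> normX T j a \<beta> (\<lambda>t. u t - ub t) \<le>
       (M * normX T j a \<beta> (\<lambda>t. u t - w t) + sqrt (1 + \<alpha>\<^sup>2) * normY T a (\<lambda>t. u t - v t)) / stab_const \<alpha> \<gamma>"
    using eb(1) unfolding M_def by blast
  define e where "e = normX T j a \<beta> (\<lambda>t. u t - ub t) * stab_const \<alpha> \<gamma>"
  have pos: "0 < stab_const \<alpha> \<gamma>" by (rule eb(2))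
  have s: "0 < sqrt (1 + \<alpha>\<^sup>2)" by (simp add: add_pos_nonneg)
  have le: "e \<le> M * normX T j a \<beta> (\<lambda>t. u t - w t) + sqrt (1 + \<alpha>\<^sup>2) * normY T a (\<lambda>t. u t - v t)"
    if "w \<in> Xd \<delta>" "v \<in> Yd \<delta>" for w v
    using bound[OF that] pos by (simp add: e_def pos_le_divide_eq)
  have ne: "Xd \<delta> \<noteq> {}" "Yd \<delta> \<noteq> {}"
    using closed_subspace(4)[OF assms(5)[OF \<delta>]] closed_subspace(4)[OF assms(6)[OF \<delta>]] by auto
  define I where "I = (INF w\<in>Xd \<delta>. normX T j a \<beta> (\<lambda>t. u t - w t))"
  define J where "J = (INF v\<in>Yd \<delta>. normY T a (\<lambda>t. u t - v t))"
  \<comment> \<open>The two infima are inserted one at a time: solving for one norm with the other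
    argument fixed exhibits a lower bound of the set under the infimum.\<close>
  have "(e - sqrt (1 + \<alpha>\<^sup>2) * normY T a (\<lambda>t. u t - v t)) / M \<le> I" if v: "v \<in> Yd \<delta>" for v
    unfolding I_def using le[OF _ v] M by (intro cINF_greatest ne) (simp add: pos_divide_le_eq mult.commute diff_le_eq)
  then have "(e - M * I) / sqrt (1 + \<alpha>\<^sup>2) \<le> normY T a (\<lambda>t. u t - v t)" if "v \<in> Yd \<delta>" for v
    using that M s by (simp add: pos_divide_le_eq mult.commute diff_le_eq add.commute)
  then have "(e - M * I) / sqrt (1 + \<alpha>\<^sup>2) \<le> J" unfolding J_def by (intro cINF_greatest ne)
  then have "e \<le> M * I + sqrt (1 + \<alpha>\<^sup>2) * J" using s by (simp add: pos_divide_le_eq mult.commute diff_le_eq add.commute)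
  then have "normX T j a \<beta> (\<lambda>t. u t - ub t) \<le> (M * I + sqrt (1 + \<alpha>\<^sup>2) * J) / stab_const \<alpha> \<gamma>"
    using pos by (simp add: e_def pos_le_divide_eq)
  then show ?case
    using ub unfolding Let_def M_def I_def J_def \<alpha>_def \<gamma>_def by blast
qed

end
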